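(* Let $X$ be a Banach space with a shrinking FDD $(E_n)$ and let $\mathcal{D}\geq 1$ be its strong bimonotonicity constant. Then for every $\varepsilon>0$, $X$ embeds isometrically (and linearly) into a Banach space $W$ with a shrinking Schauder basis $(w_n)$ which is $(1+\varepsilon)$-monotone and has strong bimonotonicity constant at most $\mathcal{D}(1+\varepsilon)$.
   Context: A finite dimensional decomposition (FDD) of a Banach space $Z$ is a sequence $(Z_j)$ of finite dimensional subspaces of $Z$ such that each $z\in Z$ can be uniquely written as $z=\sum_{n=1}^\infty z_n$ with $z_n\in Z_n$ for all $n\in\mathbb{N}$. The associated $n$-th projection is $P_n^Z(z)=z_n$, and for a finite set $A\subset\mathbb{N}$ one puts $P_A^Z=\sum_{n\in A}P_n^Z$. For $m\le n$ in $\mathbb{N}$, $[m,n]$ denotes $\{m,m+1,\dots,n\}$. The FDD $(Z_j)$ is $\mathcal{K}$-monotone if $\sup_{n\ge1}\|P^Z_{[1,n]}\|\le\mathcal{K}$. Its strong bimonotonicity (projection) constant is $$\sup_{m<n}\max\big(\|P^Z_{[m,n]}\|,\ \|I-P^Z_{[m,n]}\|\big),$$ where $I$ is the identity operator on $Z$. The FDD $(Z_j)$ is shrinking if for every $f\in Z^*$ the norm of the restriction of $f$ to the closed linear span of $\bigcup_{k\ge n}Z_k$ tends to $0$ as $n\to\infty$. A Schauder basis $(e_n)$ is regarded as the FDD $(\operatorname{span}\{e_n\})$, and the same terminology applies to it. *)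

theory Defs
  imports "HOL-Analysis.Analysis"
begin

text \<open>
  Banach spaces are real. A Banach space is rendered as a closed linear subspace \<open>Z\<close> of a type of
  class \<open>banach\<close>, which may be the whole type (\<open>Z = UNIV\<close>); the carrier \<open>Z\<close> is passed explicitly.
  Sequences are indexed from 0, so that the interval $[1,n]$ becomes \<open>{0..n}\<close>.
\<close>

text \<open>The norm of the restriction of an operator to a subspace, with value \<open>\<infinity>\<close> if it is unbounded.\<close>

definition opnorm_on ::
    "'a::real_normed_vector set \<Rightarrow> ('a \<Rightarrow> 'b::real_normed_vector) \<Rightarrow> ereal" where
  "opnorm_on Z T = (SUP z\<in>{z \<in> Z. norm z \<le> 1}. ereal (norm (T z)))"

definition is_FDD :: "'a::real_normed_vector set \<Rightarrow> (nat \<Rightarrow> 'a set) \<Rightarrow> bool" where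
  "is_FDD Z E \<longleftrightarrow>
     (\<forall>n. subspace (E n) \<and> E n \<subseteq> Z \<and> (\<exists>B. finite B \<and> E n = span B)) \<and>
     (\<forall>z\<in>Z. \<exists>!x. (\<forall>n. x n \<in> E n) \<and> x sums z)"

text \<open>These projections are meaningful only on the space of which \<open>E\<close> is an FDD.\<close>

definition FDD_component :: "(nat \<Rightarrow> 'a::real_normed_vector set) \<Rightarrow> nat \<Rightarrow> 'a \<Rightarrow> 'a" where
  "FDD_component E n z = (THE x. (\<forall>n. x n \<in> E n) \<and> x sums z) n"

definition FDD_proj :: "(nat \<Rightarrow> 'a::real_normed_vector set) \<Rightarrow> nat set \<Rightarrow> 'a \<Rightarrow> 'a" where
  "FDD_proj E A z = (\<Sum>n\<in>A. FDD_component E n z)"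

definition FDD_monotone ::
    "real \<Rightarrow> 'a::real_normed_vector set \<Rightarrow> (nat \<Rightarrow> 'a set) \<Rightarrow> bool" where
  "FDD_monotone K Z E \<longleftrightarrow> (SUP n. opnorm_on Z (FDD_proj E {0..n})) \<le> ereal K"

definition strong_bimonotonicity_constant ::
    "'a::real_normed_vector set \<Rightarrow> (nat \<Rightarrow> 'a set) \<Rightarrow> ereal" where
  "strong_bimonotonicity_constant Z E =
     (SUP (m, n)\<in>{(m, n). m < n}.
        max (opnorm_on Z (FDD_proj E {m..n}))
            (opnorm_on Z (\<lambda>z. z - FDD_proj E {m..n} z)))"

text \<open>
  Membership in the dual of \<open>Z\<close>. Such an \<open>f\<close> is a functional on \<open>Z\<close> only; its values elsewhere
  are irrelevant.
\<close>

definition bounded_functional_on ::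
    "'a::real_normed_vector set \<Rightarrow> ('a \<Rightarrow> real) \<Rightarrow> bool" where
  "bounded_functional_on Z f \<longleftrightarrow>
     (\<forall>x\<in>Z. \<forall>y\<in>Z. f (x + y) = f x + f y) \<and>
     (\<forall>c. \<forall>x\<in>Z. f (c *\<^sub>R x) = c * f x) \<and>
     (\<exists>K. \<forall>x\<in>Z. \<bar>f x\<bar> \<le> K * norm x)"

definition FDD_shrinking :: "'a::real_normed_vector set \<Rightarrow> (nat \<Rightarrow> 'a set) \<Rightarrow> bool" where
  "FDD_shrinking Z E \<longleftrightarrow>
     (\<forall>f. bounded_functional_on Z f \<longrightarrow>
        (\<lambda>n. opnorm_on (closure (span (\<Union>k\<in>{n..}. E k))) f) \<longlonglongrightarrow> 0)"

definition is_Schauder_basis :: "'a::real_normed_vector set \<Rightarrow> (nat \<Rightarrow> 'a) \<Rightarrow> bool" where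
  "is_Schauder_basis Z e \<longleftrightarrow>
     (\<forall>n. e n \<in> Z) \<and>
     (\<forall>z\<in>Z. \<exists>!a::nat \<Rightarrow> real. (\<lambda>n. a n *\<^sub>R e n) sums z)"

definition basis_FDD :: "(nat \<Rightarrow> 'a::real_vector) \<Rightarrow> nat \<Rightarrow> 'a set" where
  "basis_FDD e n = span {e n}"

text \<open>
  The type \<open>nat \<Rightarrow>\<^sub>C real\<close> of bounded (continuous) functions on the discrete space \<open>nat\<close> with the
  supremum norm is the space of bounded real sequences. Every separable Banach space, hence every
  Banach space with a Schauder basis, is linearly isometric to one of its closed subspaces, so that
  ``there is a Banach space with a Schauder basis such that'' can be expressed by quantifying over
  these closed subspaces.
\<close>

type_synonym linfty = "nat \<Rightarrow>\<^sub>C real"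

end

theory Submission
  imports Defs
begin

text \<open>
  Let $P_n$ be the partial sum projections of the FDD of $X$. Their norms may be as large as
  $D$, and then a basis whose projections extend the $P_n$ is not $(1+\varepsilon)$-monotone for
  small $\varepsilon$. The proof therefore replaces sharp cuts by random ones.

  \<^emph>\<open>Random cuts are almost contractive.\<close> As the FDD is shrinking, $P_n^*f \to f$ in norm for every
  $f$ in the dual ball. The functions $f \mapsto \|P_n^*f\|$ are weak* continuous on this compact ball
  and their upper limit is at most 1 at each point. Simons' inequality turns this into a uniform statement about
  averages: there are convex weights on arbitrarily large $n$ with
  $\sum_n \alpha_n \|P_n^*f\| \le 1+\varepsilon$ for all $f$ in the ball at once
  (\<open>averaging_weights\<close>).

  \<^emph>\<open>A slow expansion of the identity.\<close> Choose such weights with successive supports and interpolate linearly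
  between each and the next in very many small steps. This gives finite rank operators
  $V_0 = 0, V_1, V_2, \dots$ that converge to the identity. Coupling all the random thresholds monotonically,
  by level sets, exhibits $V_t - V_s$ as an average of interval projections of $X$, so it has norm at most
  $D$, and more generally a sum of increments $V_{t+1}-V_t$ over a set of $t<s$ cut out by $k$
  intervals or complements of intervals has norm at most $D^k(1+\varepsilon)$
  (\<open>averaged_pattern_bound\<close>). The increments (called slices) are small, so each splits into rank one
  operators $\varphi_i \otimes v_i$ with $\sum \|\varphi_i\|\|v_i\| \le \eta$ over the slice.

  \<^emph>\<open>The space.\<close> On scalar sequences take the norm
  \[ \|a\| = \max\Big(\sup_{L,s} \frac{1}{D^{|L|}\gamma_s}\Big\|\sum_{i} a_i v_i\Big\|,\ \sup_i \frac{|a_i|}{\kappa_i}\Big),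
     \qquad \kappa_i \ge \|\varphi_i\|, \]
  where $L$ is a finite list of intervals and complements of intervals of slices, the sum extends over
  the $i$ whose slice comes before $s$ and belongs to all members of $L$, and $\gamma_s \downarrow 1$ are
  the bounds of the averages. Then $x \mapsto (\varphi_i(x))_i$ is an isometry by the bounds
  above. Cutting $a$ to an interval of slices, or to its complement, makes $L$ longer by one entry and
  costs the factor $D$; cutting it to an initial segment only changes $s$ and costs
  $1+\varepsilon$. Slices cut in the middle are paid for by the second supremum and $\eta$.
  Arbitrarily long lists are needed because for $D = 1$ nothing may be lost when cuts are repeated.

  \<^emph>\<open>The basis is shrinking.\<close> If a functional is not small on tails, it is bounded below on a sequence of
  normalised vectors supported ever further out, and the averages of many such vectors have small second supremum.
  For fixed $f$ in the dual ball of $X$, evaluations of $f$ at the sums in the first supremum tend to 0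
  along the sequence, uniformly in $L$ and $s$, since the $v_i$ go to infinity along the shrinking FDD of $X$.
  By Simons' inequality once more, some convex combination is small in norm, a contradiction.
\<close>

section \<open>Norming functionals\<close>

text \<open>
  The Hahn-Banach theorem in the form that is used here, existence of norming functionals, follows
  from the fact that minimal sublinear functionals are linear.
\<close>

definition sublinear :: "('a::real_vector \<Rightarrow> real) \<Rightarrow> bool" where
  "sublinear q \<longleftrightarrow> (\<forall>x y. q (x + y) \<le> q x + q y) \<and> (\<forall>t\<ge>0. \<forall>x. q (t *\<^sub>R x) = t * q x)"

lemma sublinear_zero: "sublinear q \<Longrightarrow> q 0 = 0"
  unfolding sublinear_def by (metis mult_zero_left order_refl scale_zero_left)

lemma sublinear_ge_minus:
  assumes "sublinear q"
  shows "- q (- x) \<le> q x"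
proof -
  have "q (x + - x) \<le> q x + q (- x)" using assms unfolding sublinear_def by blast
  then show ?thesis using sublinear_zero[OF assms] by simp
qed

lemma sublinear_homI:
  fixes q :: "'a::real_vector \<Rightarrow> real"
  assumes "\<And>t x. t > 0 \<Longrightarrow> q (t *\<^sub>R x) \<le> t * q x" and "q 0 = 0" and "t \<ge> 0"
  shows "q (t *\<^sub>R x) = t * q x"
proof (cases "t = 0")
  case False
  then have t: "t > 0" using assms(3) by simp
  have "q ((1/t) *\<^sub>R (t *\<^sub>R x)) \<le> (1/t) * q (t *\<^sub>R x)" by (rule assms(1)) (use t in simp)
  then have "q x \<le> q (t *\<^sub>R x) / t" using t by simp
  then have "t * q x \<le> q (t *\<^sub>R x)" using t by (simp add: field_simps)
  then show ?thesis using assms(1)[OF t, of x] by simp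
qed (use assms(2) in simp)

text \<open>
  The infimum of \<open>q (x + t *\<^sub>R y) - t * q y\<close> over \<open>t \<ge> 0\<close> is the largest sublinear minorant of \<open>q\<close>
  with value \<open>- q y\<close> at \<open>- y\<close>. It shows that a minimal \<open>q\<close> is odd, and it serves to prescribe the value
  of a functional at one vector.
\<close>

lemma sublinear_decrease:
  assumes q: "sublinear q"
  obtains r where "sublinear r" "r \<le> q" "r (- y) \<le> - q y"
proof -
  define S where "S x = (\<lambda>t. q (x + t *\<^sub>R y) - t * q y) ` {0..}" for x
  define r where "r x = Inf (S x)" for x
  have tri: "q (a + b) \<le> q a + q b" for a b using q unfolding sublinear_def by blast
  have hom: "t \<ge> 0 \<Longrightarrow> q (t *\<^sub>R a) = t * q a" for a t using q unfolding sublinear_def by blast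
  have lb: "- q (- x) \<le> q (x + t *\<^sub>R y) - t * q y" if "t \<ge> 0" for x t
    using tri[of "x + t *\<^sub>R y" "- x"] hom[OF that, of y] by simp
  have bdd: "bdd_below (S x)" for x
    unfolding S_def by (rule bdd_belowI2[of _ "- q (- x)"]) (use lb in auto)
  have ne: "S x \<noteq> {}" for x unfolding S_def by auto
  have le: "r x \<le> q (x + t *\<^sub>R y) - t * q y" if "t \<ge> 0" for x t
    unfolding r_def by (rule cInf_lower[OF _ bdd]) (use that in \<open>auto simp: S_def\<close>)
  have ge: "c \<le> r x" if "\<And>t. t \<ge> 0 \<Longrightarrow> c \<le> q (x + t *\<^sub>R y) - t * q y" for x c
    unfolding r_def by (rule cInf_greatest[OF ne]) (use that in \<open>auto simp: S_def\<close>)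
  have r0: "r 0 = 0"
  proof (rule antisym)
    show "r 0 \<le> 0" using le[of 0 0] sublinear_zero[OF q] by simp
    show "0 \<le> r 0" by (rule ge) (use hom in auto)
  qed
  have rtri: "r (a + b) \<le> r a + r b" for a b
  proof -
    have "r (a + b) - (q (b + t *\<^sub>R y) - t * q y) \<le> q (a + s *\<^sub>R y) - s * q y"
      if "s \<ge> 0" "t \<ge> 0" for s t
    proof -
      have "r (a + b) \<le> q ((a + b) + (s + t) *\<^sub>R y) - (s + t) * q y" by (rule le) (use that in simp)
      also have "\<dots> \<le> q (a + s *\<^sub>R y) + q (b + t *\<^sub>R y) - (s + t) * q y"
        using tri[of "a + s *\<^sub>R y" "b + t *\<^sub>R y"] by (simp add: algebra_simps)
      finally show ?thesis by (simp add: algebra_simps)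
    qed
    then have "r (a + b) - (q (b + t *\<^sub>R y) - t * q y) \<le> r a" if "t \<ge> 0" for t
      using ge that by meson
    then have "r (a + b) - r a \<le> q (b + t *\<^sub>R y) - t * q y" if "t \<ge> 0" for t
      using that by (smt (verit))
    then have "r (a + b) - r a \<le> r b" using ge by meson
    then show ?thesis by simp
  qed
  have rhom: "r (c *\<^sub>R x) \<le> c * r x" if "c > 0" for c x
  proof -
    have "r (c *\<^sub>R x) / c \<le> q (x + t *\<^sub>R y) - t * q y" if "t \<ge> 0" for t
    proof -
      have "r (c *\<^sub>R x) \<le> q (c *\<^sub>R x + (c * t) *\<^sub>R y) - (c * t) * q y"
        by (rule le) (use that \<open>c > 0\<close> in simp)
      also have "c *\<^sub>R x + (c * t) *\<^sub>R y = c *\<^sub>R (x + t *\<^sub>R y)" by (simp add: algebra_simps)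
      also have "q (c *\<^sub>R (x + t *\<^sub>R y)) = c * q (x + t *\<^sub>R y)" by (rule hom) (use \<open>c > 0\<close> in simp)
      finally show ?thesis using \<open>c > 0\<close> by (simp add: field_simps)
    qed
    then have "r (c *\<^sub>R x) / c \<le> r x" using ge by meson
    then show ?thesis using \<open>c > 0\<close> by (simp add: field_simps)
  qed
  have "sublinear r"
    unfolding sublinear_def using rtri sublinear_homI[of r, OF rhom r0] by blast
  moreover have "r \<le> q" using le[of 0] by (auto simp: le_fun_def)
  moreover have "r (- y) \<le> - q y" using le[of 1 "- y"] sublinear_zero[OF q] by simp
  ultimately show ?thesis using that by blast
qed

lemma sublinear_chain_Inf:
  assumes "C \<noteq> {}" and sub: "\<And>q. q \<in> C \<Longrightarrow> sublinear q"
    and chain: "\<And>q r. q \<in> C \<Longrightarrow> r \<in> C \<Longrightarrow> q \<le> r \<or> r \<le> q"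
  obtains p where "sublinear p" "\<And>q. q \<in> C \<Longrightarrow> p \<le> q"
proof -
  obtain q0 where q0: "q0 \<in> C" using assms(1) by blast
  define p where "p x = Inf ((\<lambda>q. q x) ` C)" for x
  have lb: "min (q0 x) (- q0 (- x)) \<le> q x" if "q \<in> C" for q x
  proof -
    have "q0 x \<le> q x \<or> q (- x) \<le> q0 (- x)" using chain[OF q0 that] by (auto simp: le_fun_def)
    then show ?thesis using sublinear_ge_minus[OF sub[OF that], of x] by linarith
  qed
  have bdd: "bdd_below ((\<lambda>q. q x) ` C)" for x
    by (rule bdd_belowI2[of _ "min (q0 x) (- q0 (- x))"]) (use lb in auto)
  have le: "p x \<le> q x" if "q \<in> C" for q x
    unfolding p_def by (rule cInf_lower[OF _ bdd]) (use that in auto)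
  have ge: "c \<le> p x" if "\<And>q. q \<in> C \<Longrightarrow> c \<le> q x" for c x
    unfolding p_def by (rule cInf_greatest) (use that assms(1) in auto)
  have p0: "p 0 = 0"
  proof (rule antisym)
    show "p 0 \<le> 0" using le[OF q0, of 0] sublinear_zero[OF sub[OF q0]] by simp
    show "0 \<le> p 0" by (rule ge) (metis sublinear_zero sub order_refl)
  qed
  have tri: "p (a + b) \<le> p a + p b" for a b
  proof -
    have "p (a + b) - q a \<le> r b" if qr: "q \<in> C" "r \<in> C" for q r
    proof -
      obtain s where s: "s \<in> C" "s \<le> q" "s \<le> r" using chain[OF qr] qr by blast
      have "p (a + b) \<le> s (a + b)" by (rule le[OF s(1)])
      also have "\<dots> \<le> s a + s b" using sub[OF s(1)] unfolding sublinear_def by blast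
      also have "\<dots> \<le> q a + r b" using s by (auto simp: le_fun_def intro: add_mono)
      finally show ?thesis by simp
    qed
    then have "p (a + b) - q a \<le> p b" if "q \<in> C" for q using ge that by meson
    then have "p (a + b) - p b \<le> q a" if "q \<in> C" for q using that by (smt (verit))
    then have "p (a + b) - p b \<le> p a" using ge by meson
    then show ?thesis by simp
  qed
  have hom: "p (c *\<^sub>R x) \<le> c * p x" if "c > 0" for c x
  proof -
    have "p (c *\<^sub>R x) / c \<le> q x" if "q \<in> C" for q
      using le[OF that, of "c *\<^sub>R x"] sub[OF that] \<open>c > 0\<close>
      unfolding sublinear_def by (simp add: field_simps)
    then have "p (c *\<^sub>R x) / c \<le> p x" using ge by meson
    then show ?thesis using \<open>c > 0\<close> by (simp add: field_simps)
  qed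
  have "sublinear p" unfolding sublinear_def using tri sublinear_homI[of p, OF hom p0] by blast
  then show ?thesis using that le by (auto simp: le_fun_def)
qed

lemma ex_minimal_sublinear:
  assumes "sublinear q"
  obtains m where "sublinear m" "m \<le> q" "\<And>r. sublinear r \<Longrightarrow> r \<le> m \<Longrightarrow> r = m"
proof -
  define A where "A = {r. sublinear r \<and> r \<le> q}"
  define P :: "('a \<Rightarrow> real) \<Rightarrow> ('a \<Rightarrow> real) \<Rightarrow> bool" where "P f g \<longleftrightarrow> g \<le> f" for f g
  have po: "partial_order_on A (relation_of P A)"
    by (rule partial_order_on_relation_ofI) (auto simp: P_def)
  have "\<exists>u\<in>A. \<forall>a\<in>C. P a u" if C: "C \<in> Chains (relation_of P A)" for C
  proof (cases "C = {}")
    case True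
    then show ?thesis using assms by (auto simp: A_def)
  next
    case False
    have CA: "C \<subseteq> A" and ch: "\<And>a b. a \<in> C \<Longrightarrow> b \<in> C \<Longrightarrow> a \<le> b \<or> b \<le> a"
      using C unfolding Chains_def relation_of_def P_def by blast+
    obtain p where p: "sublinear p" "\<And>q. q \<in> C \<Longrightarrow> p \<le> q"
      using sublinear_chain_Inf[OF False, of thesis] CA ch by (auto simp: A_def)
    have "p \<in> A" using False p CA by (force simp: A_def intro: order_trans)
    then show ?thesis using p by (auto simp: P_def)
  qed
  from predicate_Zorn[OF po this] obtain m where m: "m \<in> A" "\<And>a. a \<in> A \<Longrightarrow> P m a \<Longrightarrow> a = m" by blast
  show ?thesis
  proof (rule that)
    show "sublinear m" "m \<le> q" using m(1) by (auto simp: A_def)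
    show "r = m" if "sublinear r" "r \<le> m" for r
      using that m by (auto simp: A_def P_def intro: order_trans)
  qed
qed

lemma minimal_sublinear_linear:
  assumes m: "sublinear m" and min: "\<And>r. sublinear r \<Longrightarrow> r \<le> m \<Longrightarrow> r = m"
  shows "linear m"
proof -
  have neg: "m (- y) = - m y" for y
  proof (rule antisym)
    obtain r where "sublinear r" "r \<le> m" "r (- y) \<le> - m y" using sublinear_decrease[OF m] by blast
    then show "m (- y) \<le> - m y" using min by blast
    show "- m y \<le> m (- y)" using sublinear_ge_minus[OF m, of "- y"] by simp
  qed
  have tri: "m (a + b) \<le> m a + m b" for a b using m unfolding sublinear_def by blast
  have add: "m (a + b) = m a + m b" for a b
    using tri[of a b] tri[of "- a" "- b"] neg[of "a + b"] neg[of a] neg[of b] by simp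
  have pos: "m (t *\<^sub>R x) = t * m x" if "t \<ge> 0" for t x
    using m that unfolding sublinear_def by blast
  have "m (t *\<^sub>R x) = t * m x" for t x
  proof (cases "t \<ge> 0")
    case False
    then have "m ((- t) *\<^sub>R (- x)) = (- t) * m (- x)" by (intro pos) simp
    then show ?thesis using neg[of x] by simp
  qed (rule pos)
  with add show ?thesis by (intro linearI) auto
qed

definition dual_ball :: "('a::real_normed_vector \<Rightarrow> real) set" where
  "dual_ball = {f. linear f \<and> (\<forall>x. \<bar>f x\<bar> \<le> norm x)}"

text \<open>
  A minimal sublinear functional below the one that \<open>sublinear_decrease\<close> produces from the norm at \<open>x\<close>
  is linear, bounded by the norm, and cannot be smaller than the norm at \<open>x\<close>.
\<close>

theorem norming_functional:
  fixes x :: "'a::real_normed_vector"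
  obtains f where "f \<in> dual_ball" "f x = norm x"
proof -
  have n: "sublinear (norm :: 'a \<Rightarrow> real)"
    unfolding sublinear_def by (auto simp: norm_triangle_ineq)
  obtain r where r: "sublinear r" "r \<le> norm" "r (- x) \<le> - norm x"
    using sublinear_decrease[OF n, of x] by blast
  obtain m where m: "sublinear m" "m \<le> r" "\<And>s. sublinear s \<Longrightarrow> s \<le> m \<Longrightarrow> s = m"
    using ex_minimal_sublinear[OF r(1)] by blast
  have lin: "linear m" using minimal_sublinear_linear[OF m(1,3)] .
  have le: "m y \<le> norm y" for y using m(2) r(2) by (auto simp: le_fun_def intro: order_trans)
  have neg: "m (- y) = - m y" for y using lin by (rule linear_neg)
  have "\<bar>m y\<bar> \<le> norm y" for y using le[of y] le[of "- y"] neg[of y] by simp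
  moreover have "m x = norm x"
    using le[of x] neg[of x] m(2) r(3) by (smt (verit) le_fun_def)
  ultimately show ?thesis using that[of m] lin by (auto simp: dual_ball_def)
qed

section \<open>Coordinates in finite-dimensional subspaces\<close>

text \<open>
  Bounded coordinates of a Cauchy sequence are Cauchy. This is the inductive input for
  \<open>coordinates_bounded\<close>: a vector outside the closed span of the previous basis vectors has positive
  distance from it, which bounds its coordinate.
\<close>

lemma closed_span_if_coordinates_bounded:
  fixes B :: "'a::real_normed_vector set"
  assumes fin: "finite B" and ind: "independent B"
    and C: "\<And>z b. z \<in> span B \<Longrightarrow> \<bar>representation B z b\<bar> \<le> C * norm z"
  shows "closed (span B)"
  unfolding closed_sequential_limits
proof (intro allI impI, elim conjE)
  fix z l assume z: "\<forall>n. z n \<in> span B" and lim: "z \<longlonglongrightarrow> l"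
  have "\<exists>c. (\<lambda>n. representation B (z n) b) \<longlonglongrightarrow> c" for b
  proof -
    have "Cauchy (\<lambda>n. representation B (z n) b)"
    proof (rule metric_CauchyI)
      fix e :: real assume e: "e > 0"
      obtain N where N: "\<And>m n. m \<ge> N \<Longrightarrow> n \<ge> N \<Longrightarrow> dist (z m) (z n) < e / (\<bar>C\<bar> + 1)"
        using metric_CauchyD[OF LIMSEQ_imp_Cauchy[OF lim], of "e / (\<bar>C\<bar> + 1)"] e by fastforce
      have "dist (representation B (z m) b) (representation B (z n) b) < e" if "m \<ge> N" "n \<ge> N" for m n
      proof -
        have "representation B (z m) b - representation B (z n) b = representation B (z m - z n) b"
          using representation_diff[OF ind, of "z n" "z m"] z by simp
        then have "dist (representation B (z m) b) (representation B (z n) b) \<le> C * norm (z m - z n)"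
          using C[of "z m - z n" b] span_diff[of "z m" B "z n"] z by (simp add: dist_real_def)
        also have "\<dots> \<le> (\<bar>C\<bar> + 1) * norm (z m - z n)" by (intro mult_right_mono) auto
        also have "\<dots> < e" using N[OF that] by (simp add: dist_norm field_simps)
        finally show ?thesis .
      qed
      then show "\<exists>N. \<forall>m\<ge>N. \<forall>n\<ge>N. dist (representation B (z m) b) (representation B (z n) b) < e" by blast
    qed
    then show ?thesis using Cauchy_convergent convergent_def by blast
  qed
  then obtain c where c: "\<And>b. (\<lambda>n. representation B (z n) b) \<longlonglongrightarrow> c b" by metis
  have "(\<lambda>n. \<Sum>b\<in>B. representation B (z n) b *\<^sub>R b) \<longlonglongrightarrow> (\<Sum>b\<in>B. c b *\<^sub>R b)"
    by (intro tendsto_intros c)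
  moreover have "(\<Sum>b\<in>B. representation B (z n) b *\<^sub>R b) = z n" for n
    using sum_representation_eq[OF ind, of "z n" B] z fin by auto
  ultimately have "l = (\<Sum>b\<in>B. c b *\<^sub>R b)" using lim LIMSEQ_unique by auto
  then show "l \<in> span B" by (auto intro: span_sum span_scale span_base)
qed

theorem coordinates_bounded:
  fixes B :: "'a::real_normed_vector set"
  assumes "finite B" and "independent B"
  shows "\<exists>C. \<forall>z\<in>span B. \<forall>b. \<bar>representation B z b\<bar> \<le> C * norm z"
  using assms
proof (induction B rule: finite_induct)
  case empty
  then show ?case by (auto simp: representation_zero)
next
  case (insert a B)
  have ind: "independent B" and a: "a \<notin> span B"
    using insert by (auto simp: independent_insert)
  obtain C where C: "\<And>z b. z \<in> span B \<Longrightarrow> \<bar>representation B z b\<bar> \<le> C * norm z"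
    using insert.IH[OF ind] by blast
  have cl: "closed (span B)" using closed_span_if_coordinates_bounded[OF insert(1) ind C] .
  then obtain d where d: "d > 0" "\<And>y. y \<in> span B \<Longrightarrow> d \<le> dist a y"
  proof -
    have "open (- span B)" "a \<in> - span B" using cl a by auto
    then obtain e where "e > 0" "ball a e \<subseteq> - span B" by (meson open_contains_ball)
    then show ?thesis using that[of e] by (force simp: not_le[symmetric])
  qed
  define K where "K = max (1 / d) (\<bar>C\<bar> * (1 + norm a / d))"
  have "\<bar>representation (insert a B) z b\<bar> \<le> K * norm z" if z: "z \<in> span (insert a B)" for z b
  proof -
    obtain t where t: "z - t *\<^sub>R a \<in> span B" using z span_breakdown_eq by blast
    have za: "z = t *\<^sub>R a + (z - t *\<^sub>R a)" by simp
    have tn: "\<bar>t\<bar> \<le> norm z / d"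
    proof (cases "t = 0")
      case False
      have "(- 1 / t) *\<^sub>R (z - t *\<^sub>R a) \<in> span B" using t by (rule span_scale)
      from d(2)[OF this] have "d \<le> norm (a - (- 1 / t) *\<^sub>R (z - t *\<^sub>R a))" by (simp add: dist_norm)
      also have "a - (- 1 / t) *\<^sub>R (z - t *\<^sub>R a) = (1 / t) *\<^sub>R z" using False by (simp add: algebra_simps)
      finally show ?thesis using False d(1) by (simp add: field_simps)
    qed (use d in simp)
    have ain: "a \<in> span (insert a B)" "z - t *\<^sub>R a \<in> span (insert a B)"
      using t span_mono[of B "insert a B"] by (auto intro: span_base)
    have "representation (insert a B) z = (\<lambda>b. t * representation (insert a B) a b + representation (insert a B) (z - t *\<^sub>R a) b)"
      using representation_add[OF insert.prems, of "z - t *\<^sub>R a" "t *\<^sub>R a"] ain za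
        representation_scale[OF insert.prems ain(1), of t] span_scale[OF ain(1), of t] by simp
    moreover have "representation (insert a B) a = (\<lambda>v. if v = a then 1 else 0)"
      by (rule representation_basis[OF insert.prems]) simp
    moreover have "representation (insert a B) (z - t *\<^sub>R a) = representation B (z - t *\<^sub>R a)"
      by (rule representation_extend[OF insert.prems t]) auto
    ultimately have rep: "representation (insert a B) z b = t * (if b = a then 1 else 0) + representation B (z - t *\<^sub>R a) b"
      by simp
    show ?thesis
    proof (cases "b = a")
      case True
      have "a \<notin> B" using insert by blast
      then have "representation B (z - t *\<^sub>R a) a = 0" using representation_ne_zero by blast
      then have "\<bar>representation (insert a B) z b\<bar> = \<bar>t\<bar>" using rep True by simp
      also have "\<dots> \<le> (1 / d) * norm z" using tn by simp
      also have "\<dots> \<le> K * norm z" unfolding K_def by (intro mult_right_mono) auto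
      finally show ?thesis .
    next
      case False
      then have "\<bar>representation (insert a B) z b\<bar> \<le> C * norm (z - t *\<^sub>R a)" using rep C[OF t, of b] by simp
      also have "\<dots> \<le> \<bar>C\<bar> * norm (z - t *\<^sub>R a)" by (intro mult_right_mono) auto
      also have "\<dots> \<le> \<bar>C\<bar> * (norm z + \<bar>t\<bar> * norm a)"
        by (intro mult_left_mono) (use norm_triangle_ineq4[of z "t *\<^sub>R a"] in auto)
      also have "\<dots> \<le> \<bar>C\<bar> * (norm z + (norm z / d) * norm a)"
        by (intro mult_left_mono add_left_mono mult_right_mono tn) auto
      also have "\<dots> = (\<bar>C\<bar> * (1 + norm a / d)) * norm z" by (simp add: algebra_simps)
      also have "\<dots> \<le> K * norm z" unfolding K_def by (intro mult_right_mono) auto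
      finally show ?thesis .
    qed
  qed
  then show ?case by blast
qed

section \<open>Simons' inequality\<close>

text \<open>
  The sets \<open>C n\<close> play the role of the convex hulls of the tails of a bounded sequence of continuous functions. If the
  sequence is eventually at most \<open>c\<close> at each point, up to any \<open>e\<close>, then some convex combination is so uniformly.
  The argument chooses \<open>g\<^sub>n \<in> C n\<close> greedily so that \<open>\<Sum>k<n. g\<^sub>k / 2 ^ Suc k + g\<^sub>n / 2 ^ n\<close> has almost minimal
  supremum. Minimality against the midpoint of \<open>g\<^sub>n\<close> and \<open>g\<^sub>n\<^sub>+\<^sub>1\<close> shows that these suprema almost increase,
  towards the supremum of the whole series. At a point where the series attains its supremum, all of its
  tails must therefore be large, and so must elements of every \<open>C n\<close>.
\<close>

lemma Simons_inequality:
  fixes C :: "nat \<Rightarrow> ('q::topological_space \<Rightarrow> real) set" and c M :: real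
  assumes Q: "compact Q" "Q \<noteq> {}"
    and ne: "\<And>n. C n \<noteq> {}" and dec: "\<And>n. C (Suc n) \<subseteq> C n"
    and mid: "\<And>n g h. g \<in> C n \<Longrightarrow> h \<in> C n \<Longrightarrow> (\<lambda>q. (g q + h q) / 2) \<in> C n"
    and cont: "\<And>g. g \<in> C 0 \<Longrightarrow> continuous_on Q g"
    and bd: "\<And>g q. g \<in> C 0 \<Longrightarrow> q \<in> Q \<Longrightarrow> \<bar>g q\<bar> \<le> M"
    and lim: "\<And>q e. q \<in> Q \<Longrightarrow> e > 0 \<Longrightarrow> \<exists>n. \<forall>g\<in>C n. g q \<le> c + e"
    and e: "e > 0"
  shows "\<exists>g\<in>C 0. \<forall>q\<in>Q. g q \<le> c + e"
proof (rule ccontr)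
  assume "\<not> ?thesis"
  then have big: "\<exists>q\<in>Q. c + e < g q" if "g \<in> C 0" for g using that by force
  have C0: "g \<in> C 0" if "g \<in> C n" for g n
    using that dec by (induction n) auto
  have Cdec: "C n \<subseteq> C m" if "m \<le> n" for m n
    using that dec by (rule lift_Suc_antimono_le[rotated])
  define S where "S u = (SUP q\<in>Q. u q)" for u :: "'q \<Rightarrow> real"
  have Sup: "u q \<le> S u" if "q \<in> Q" "\<And>q. q \<in> Q \<Longrightarrow> u q \<le> b" for u q b
    unfolding S_def by (rule cSUP_upper[OF that(1) bdd_aboveI2[of Q u b]]) (use that in auto)
  have Sle: "S u \<le> b" if "\<And>q. q \<in> Q \<Longrightarrow> u q \<le> b" for u b
    unfolding S_def by (rule cSUP_least) (use that Q in auto)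
  define d where "d = e / 12"
  have d: "d > 0" using e by (simp add: d_def)
  \<comment> \<open>The choice of $g_n$, with a tolerance small enough to survive the factors $2^n$ below.\<close>
  define near where "near n H g \<longleftrightarrow> g \<in> C n \<and>
     (\<forall>g'\<in>C n. S (\<lambda>q. H q + g q / 2 ^ n) \<le> S (\<lambda>q. H q + g' q / 2 ^ n) + d / 4 ^ n)" for n H g
  have ex_near: "\<exists>g. near n H g" if H: "\<And>q. q \<in> Q \<Longrightarrow> \<bar>H q\<bar> \<le> K" for n H K
  proof -
    define A where "A = (\<lambda>g. S (\<lambda>q. H q + g q / 2 ^ n)) ` C n"
    obtain q0 where q0: "q0 \<in> Q" using Q by blast
    have gb: "\<bar>g q / 2 ^ n\<bar> \<le> M" if "g \<in> C n" "q \<in> Q" for g q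
    proof -
      have "\<bar>g q / 2 ^ n\<bar> = \<bar>g q\<bar> / 2 ^ n" by simp
      also have "\<dots> \<le> \<bar>g q\<bar> / 1" by (rule divide_left_mono) auto
      also have "\<dots> \<le> M" using bd[OF C0[OF that(1)] that(2)] by simp
      finally show ?thesis .
    qed
    have "- K - M \<le> S (\<lambda>q. H q + g q / 2 ^ n)" if g: "g \<in> C n" for g
    proof -
      have "- K - M \<le> H q0 + g q0 / 2 ^ n" using H[OF q0] gb[OF g q0] unfolding abs_le_iff by linarith
      also have "\<dots> \<le> S (\<lambda>q. H q + g q / 2 ^ n)"
        by (rule Sup[OF q0, of _ "K + M"]) (rule add_mono, use H abs_le_D1 in blast, use gb[OF g] abs_le_D1 in blast)
      finally show ?thesis .
    qed
    then have bdd: "bdd_below A" unfolding A_def by (intro bdd_belowI2)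
    have "Inf A < Inf A + d / 4 ^ n" using d by simp
    moreover have "A \<noteq> {}" using ne by (simp add: A_def)
    ultimately obtain g where g: "g \<in> C n" "S (\<lambda>q. H q + g q / 2 ^ n) < Inf A + d / 4 ^ n"
      using cInf_lessD[of A "Inf A + d / 4 ^ n"] by (auto simp: A_def)
    have "Inf A \<le> S (\<lambda>q. H q + g' q / 2 ^ n)" if "g' \<in> C n" for g'
      by (rule cInf_lower[OF _ bdd]) (use that in \<open>auto simp: A_def\<close>)
    then show ?thesis using g unfolding near_def by force
  qed
  define P where "P n H \<longleftrightarrow> (\<forall>q\<in>Q. \<bar>H q\<bar> \<le> real n * M) \<and> (n = 0 \<longrightarrow> H = (\<lambda>q. 0))" for n :: nat and H :: "'q \<Rightarrow> real"
  define R where "R n H H' \<longleftrightarrow> (\<exists>g. near n H g \<and> H' = (\<lambda>q. H q + g q / 2 ^ Suc n))" for n :: nat and H H' :: "'q \<Rightarrow> real"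
  have "\<exists>h. \<forall>n. P n (h n) \<and> R n (h n) (h (Suc n))"
  proof (rule dependent_nat_choice)
    show "\<exists>H. P 0 H" by (simp add: P_def)
    fix H n assume H: "P n H"
    then obtain g where g: "near n H g" using ex_near[of H "real n * M" n] by (auto simp: P_def)
    have "\<bar>H q + g q / 2 ^ Suc n\<bar> \<le> real (Suc n) * M" if "q \<in> Q" for q
    proof -
      have "\<bar>g q / 2 ^ Suc n\<bar> = \<bar>g q\<bar> / 2 ^ Suc n" by simp
      also have "\<dots> \<le> \<bar>g q\<bar> / 1" by (rule divide_left_mono) (auto simp: one_le_power simp del: power_Suc)
      also have "\<dots> \<le> M" using bd[OF C0[of g n] that] g by (simp add: near_def)
      finally have "\<bar>g q / 2 ^ Suc n\<bar> \<le> M" .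
      moreover have "\<bar>H q\<bar> \<le> real n * M" using H that by (simp add: P_def)
      moreover have "real (Suc n) * M = real n * M + M" by (simp add: algebra_simps)
      ultimately show ?thesis by linarith
    qed
    then have "P (Suc n) (\<lambda>q. H q + g q / 2 ^ Suc n)" unfolding P_def by blast
    moreover have "R n H (\<lambda>q. H q + g q / 2 ^ Suc n)" using g unfolding R_def by blast
    ultimately show "\<exists>H'. P (Suc n) H' \<and> R n H H'" by blast
  qed
  then obtain h where h: "\<And>n. P n (h n)" "\<And>n. R n (h n) (h (Suc n))" by blast
  from h(2) obtain g where g: "\<And>n. near n (h n) (g n)" "\<And>n. h (Suc n) = (\<lambda>q. h n q + g n q / 2 ^ Suc n)"
    unfolding R_def by metis
  have gC: "g n \<in> C n" for n using g(1) by (simp add: near_def)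
  have gM: "\<bar>g n q\<bar> \<le> M" if "q \<in> Q" for n q using bd[OF C0[OF gC] that] .
  have h0: "h 0 = (\<lambda>q. 0)" using h(1)[of 0] by (simp add: P_def)
  have hsum: "h n q = (\<Sum>k<n. g k q / 2 ^ Suc k)" for n q
    by (induction n) (simp_all add: h0 g(2))
  define F where "F q = (\<Sum>k. g k q / 2 ^ Suc k)" for q
  have geo: "summable (\<lambda>k. M / 2 ^ Suc k)"
    using summable_mult[OF summable_geometric[of "1/2::real"], of "M / 2"] by (simp add: power_divide)
  have gk: "norm (g k q / 2 ^ Suc k) \<le> M / 2 ^ Suc k" if "q \<in> Q" for k q
    using gM[OF that, of k] by (simp add: divide_right_mono)
  have ulim: "uniform_limit Q h F sequentially"
    using Weierstrass_m_test[of Q "\<lambda>k q. g k q / 2 ^ Suc k" "\<lambda>k. M / 2 ^ Suc k", OF gk geo]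
    by (simp add: hsum[abs_def] F_def[abs_def])
  have gcont: "continuous_on Q (g n)" for n using cont C0[OF gC] by blast
  have hcont: "continuous_on Q (h n)" for n
    by (induction n) (auto simp: h0 g(2) intro!: continuous_intros gcont)
  have "continuous_on Q F"
    by (rule uniform_limit_theorem[OF _ ulim]) (use hcont in auto)
  then obtain y where y: "y \<in> Q" "\<And>q. q \<in> Q \<Longrightarrow> F q \<le> F y" using continuous_attains_sup[OF Q] by blast
  have sums: "(\<lambda>k. g k q / 2 ^ Suc k) sums F q" if "q \<in> Q" for q
    unfolding F_def by (intro summable_sums summable_comparison_test[OF _ geo] exI allI impI gk that)
  have half: "(\<lambda>k. x / 2 ^ Suc (n + k)) sums (x / 2 ^ n)" for x :: real and n
    using sums_mult[OF power_half_series, of "x / 2 ^ n"] by (simp add: power_add power_divide mult_ac)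
  have tail: "(\<lambda>k. g (n + k) q / 2 ^ Suc (n + k)) sums (F q - h n q)" if "q \<in> Q" for n q
    using sums_split_initial_segment[OF sums[OF that], of n] by (simp add: hsum add.commute)
  have tail_le: "\<bar>F q - h n q\<bar> \<le> M / 2 ^ n" if "q \<in> Q" for n q
  proof -
    have "F q - h n q \<le> M / 2 ^ n"
      by (rule sums_le[OF _ tail[OF that] half]) (rule divide_right_mono, use gM[OF that] abs_le_D1 in blast, simp)
    moreover have "- M / 2 ^ n \<le> F q - h n q"
      by (rule sums_le[OF _ half tail[OF that]]) (rule divide_right_mono, use gM[OF that] abs_le_iff minus_le_iff in metis, simp)
    ultimately show ?thesis by (auto simp: abs_le_iff)
  qed
  define a where "a n = S (\<lambda>q. h n q + g n q / 2 ^ n)" for n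
  have hb: "\<bar>h n q\<bar> \<le> real n * M" if "q \<in> Q" for n q using h(1)[of n] that by (auto simp: P_def)
  have gM2: "g n q / 2 ^ m \<le> M / 2 ^ m" if "q \<in> Q" for n m q
    by (rule divide_right_mono) (use gM[OF that] abs_le_D1 in blast, simp)
  have au: "h n q + g n q / 2 ^ n \<le> a n" if "q \<in> Q" for n q
    unfolding a_def by (rule Sup[OF that, of _ "real n * M + M / 2 ^ n"])
      (rule add_mono, use hb abs_le_D1 in blast, rule gM2)
  have a_Suc: "a n \<le> a (Suc n) + d / 4 ^ n" for n
  proof -
    have "(\<lambda>q. (g n q + g (Suc n) q) / 2) \<in> C n"
      by (rule mid[OF gC subsetD[OF Cdec gC]]) simp
    then have "a n \<le> S (\<lambda>q. h n q + ((g n q + g (Suc n) q) / 2) / 2 ^ n) + d / 4 ^ n"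
      using bspec[OF conjunct2[OF g(1)[of n, unfolded near_def]]] unfolding a_def by blast
    also have "(\<lambda>q. h n q + ((g n q + g (Suc n) q) / 2) / 2 ^ n) = (\<lambda>q. h (Suc n) q + g (Suc n) q / 2 ^ Suc n)"
      by (auto simp: g(2) field_simps)
    finally show ?thesis by (simp add: a_def)
  qed
  have a0: "c + e \<le> a 0"
  proof -
    obtain q where "q \<in> Q" "c + e < g 0 q" using big[OF gC[of 0]] by blast
    then show ?thesis using au[of q 0] by (simp add: h0)
  qed
  have aF: "a n \<le> F y + 2 * M / 2 ^ n" for n
    unfolding a_def
  proof (rule Sle)
    fix q assume q: "q \<in> Q"
    have "h n q \<le> F q + M / 2 ^ n" using tail_le[OF q, of n] by (auto simp: abs_le_iff)
    then show "h n q + g n q / 2 ^ n \<le> F y + 2 * M / 2 ^ n" using y(2)[OF q] gM2[OF q, of n n] by simp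
  qed
  \<comment> \<open>A single correction term absorbs all later tolerances, as $\sum_{k \ge n} 4^{-k} \le 2 \cdot 4^{-n}$.\<close>
  have inc: "incseq (\<lambda>n. a n - 2 * d / 4 ^ n)"
  proof (rule incseq_SucI)
    fix n
    have "d / 4 ^ n \<ge> 0" using d by simp
    moreover have "2 * d / 4 ^ Suc n = (1/2) * (d / 4 ^ n)" "2 * d / 4 ^ n = 2 * (d / 4 ^ n)" by auto
    ultimately show "a n - 2 * d / 4 ^ n \<le> a (Suc n) - 2 * d / 4 ^ Suc n" using a_Suc[of n] by linarith
  qed
  have aup: "a n - 2 * d / 4 ^ n \<le> F y" for n
  proof (rule LIMSEQ_le_const)
    show "(\<lambda>m. F y + 2 * M * (1/2) ^ m) \<longlonglongrightarrow> F y"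
      using tendsto_add[OF tendsto_const tendsto_mult[OF tendsto_const LIMSEQ_power_zero[of "1/2::real"]], of "F y" "2 * M"] by simp
    show "\<exists>N. \<forall>m\<ge>N. a n - 2 * d / 4 ^ n \<le> F y + 2 * M * (1/2) ^ m"
    proof (intro exI allI impI)
      fix m assume "n \<le> m"
      then have "a n - 2 * d / 4 ^ n \<le> a m - 2 * d / 4 ^ m" using inc by (rule incseqD[rotated])
      also have "\<dots> \<le> a m" using d by simp
      also have "\<dots> \<le> F y + 2 * M * (1/2) ^ m" using aF[of m] by (simp add: power_divide)
      finally show "a n - 2 * d / 4 ^ n \<le> F y + 2 * M * (1/2) ^ m" .
    qed
  qed
  \<comment> \<open>At $y$ the remainder after $n$ terms, which has total weight $2^{-n}$, is at least $F y - S (h n)$.\<close>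
  have u: "c + e - 6 * d + 4 * d / 2 ^ n \<le> 2 ^ n * (F y - S (h n))" for n
  proof (induction n)
    case 0
    have "S (h 0) \<le> 0" by (rule Sle) (simp add: h0)
    then show ?case using a0 aup[of 0] by simp
  next
    case (Suc n)
    have "S (h (Suc n)) \<le> S (h n) / 2 + a n / 2"
    proof (rule Sle)
      fix q assume q: "q \<in> Q"
      have "h n q \<le> S (h n)" by (rule Sup[OF q, of _ "real n * M"]) (use hb in \<open>auto simp: abs_le_iff\<close>)
      moreover have "h (Suc n) q = h n q / 2 + (h n q + g n q / 2 ^ n) / 2" by (simp add: g(2) field_simps)
      moreover have "t \<le> a n \<Longrightarrow> u \<le> S (h n) \<Longrightarrow> u / 2 + t / 2 \<le> S (h n) / 2 + a n / 2" for t u :: real by linarith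
      ultimately show "h (Suc n) q \<le> S (h n) / 2 + a n / 2" using au[OF q, of n] by presburger
    qed
    then have "F y - S (h (Suc n)) \<ge> (F y - S (h n)) / 2 - d / 4 ^ n"
    proof -
      have "2 * d / 4 ^ n = 2 * (d / 4 ^ n)" by simp
      with aup[of n] have "a n \<le> F y + 2 * (d / 4 ^ n)" by linarith
      moreover have "s \<le> u / 2 + b / 2 \<Longrightarrow> b \<le> v + 2 * w \<Longrightarrow> v - s \<ge> (v - u) / 2 - w" for s u b v w :: real by argo
      ultimately show ?thesis using \<open>S (h (Suc n)) \<le> _\<close> by blast
    qed
    then have "2 ^ Suc n * (F y - S (h (Suc n))) \<ge> 2 ^ Suc n * ((F y - S (h n)) / 2 - d / 4 ^ n)"
      by (intro mult_left_mono) auto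
    moreover have "(4::real) ^ n = 2 ^ n * 2 ^ n" by (simp flip: power_mult_distrib)
    then have "2 ^ Suc n * ((F y - S (h n)) / 2 - d / 4 ^ n) = 2 ^ n * (F y - S (h n)) - 2 * d / 2 ^ n"
      by (simp add: right_diff_distrib)
    moreover have "4 * d / 2 ^ Suc n = 2 * d / 2 ^ n" "4 * d / 2 ^ n = 2 * (2 * d / 2 ^ n)" by auto
    ultimately show ?case using Suc by linarith
  qed
  obtain n where n: "\<And>g. g \<in> C n \<Longrightarrow> g y \<le> c + e / 4" using lim[OF y(1), of "e / 4"] e by auto
  have "F y - h n y \<le> (c + e / 4) / 2 ^ n"
    by (rule sums_le[OF _ tail[OF y(1)] half])
      (use n[OF subsetD[OF Cdec gC]] in \<open>auto intro!: divide_right_mono\<close>)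
  then have "2 ^ n * (F y - h n y) \<le> c + e / 4" by (simp add: field_simps)
  moreover have "h n y \<le> S (h n)" by (rule Sup[OF y(1), of _ "real n * M"]) (use hb in \<open>auto simp: abs_le_iff\<close>)
  then have "2 ^ n * (F y - S (h n)) \<le> 2 ^ n * (F y - h n y)" by simp
  moreover have "4 * d / 2 ^ n \<ge> 0" using d by simp
  ultimately have "c + e - 6 * d \<le> c + e / 4" using u[of n] by linarith
  then show False using e by (simp add: d_def)
qed

section \<open>Convex combinations of support functions\<close>

text \<open>
  The Banach-Alaoglu theorem. The topology is that of pointwise convergence on the function space.
\<close>

lemma compact_dual_ball: "compact (dual_ball :: ('a::real_normed_vector \<Rightarrow> real) set)"
proof -
  have c: "continuous_on UNIV (\<lambda>f::'a \<Rightarrow> real. f x)" for x by simp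
  have "compactin (product_topology (\<lambda>i. euclidean) UNIV) (Pi\<^sub>E UNIV (\<lambda>x::'a. {- norm x..norm x :: real}))"
    by (auto simp: compactin_PiE)
  then have K: "compact (Pi\<^sub>E UNIV (\<lambda>x::'a. {- norm x..norm x :: real}))"
    by (simp add: euclidean_product_topology)
  have cl: "closed {f::'a \<Rightarrow> real. (\<forall>x y. f (x + y) = f x + f y) \<and> (\<forall>r x. f (r *\<^sub>R x) = r * f x)}"
    by (intro closed_Collect_conj closed_Collect_all closed_Collect_eq continuous_intros c)
  have "dual_ball = Pi\<^sub>E UNIV (\<lambda>x::'a. {- norm x..norm x :: real}) \<inter>
      {f. (\<forall>x y. f (x + y) = f x + f y) \<and> (\<forall>r x. f (r *\<^sub>R x) = r * f x)}"
    by (auto simp: dual_ball_def PiE_iff abs_le_iff linear_iff minus_le_iff)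
  with compact_Int_closed[OF K cl] show ?thesis by simp
qed

text \<open>
  On a finite-dimensional subspace pointwise convergence of functionals is uniform on bounded sets, as only
  finitely many coordinates matter.
\<close>

lemma continuous_support_function:
  fixes Z B :: "'a::real_normed_vector set"
  assumes "Z \<noteq> {}" and bd: "\<And>z. z \<in> Z \<Longrightarrow> norm z \<le> M" and B: "finite B" "Z \<subseteq> span B"
  shows "continuous_on dual_ball (\<lambda>f. SUP z\<in>Z. f z)"
proof -
  obtain B' where B': "B' \<subseteq> B" "independent B'" "B \<subseteq> span B'"
    using maximal_independent_subset by blast
  have fin: "finite B'" using B' B finite_subset by blast
  have ZB: "Z \<subseteq> span B'" using B(2) B'(3) span_minimal[of B "span B'"] by auto
  obtain C where C: "\<And>z b. z \<in> span B' \<Longrightarrow> \<bar>representation B' z b\<bar> \<le> C * norm z"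
    using coordinates_bounded[OF fin B'(2)] by blast
  have fM: "f z \<le> M" if "f \<in> dual_ball" "z \<in> Z" for f z
    using that bd[of z] by (force simp: dual_ball_def abs_le_iff intro: order_trans)
  have bdd: "bdd_above ((\<lambda>z. f z) ` Z)" if "f \<in> dual_ball" for f
    using fM[OF that] by (intro bdd_aboveI2)
  have le: "(SUP z\<in>Z. f z) \<le> (SUP z\<in>Z. g z) + \<bar>C\<bar> * M * (\<Sum>b\<in>B'. \<bar>f b - g b\<bar>)"
    if f: "f \<in> dual_ball" and g: "g \<in> dual_ball" for f g
  proof (rule cSUP_least[OF assms(1)])
    fix z assume z: "z \<in> Z"
    have zeq: "z = (\<Sum>b\<in>B'. representation B' z b *\<^sub>R b)"
      using sum_representation_eq[OF B'(2) subsetD[OF ZB z] fin] by simp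
    have lin: "linear f" "linear g" using f g by (auto simp: dual_ball_def)
    have "h z = (\<Sum>b\<in>B'. representation B' z b * h b)" if "linear h" for h :: "'a \<Rightarrow> real"
      using arg_cong[OF zeq, of h] by (simp only: linear_sum[OF that] linear_cmul[OF that] real_scaleR_def)
    from this[OF lin(1)] this[OF lin(2)]
    have "f z - g z = (\<Sum>b\<in>B'. representation B' z b * (f b - g b))"
      by (simp add: sum_subtractf right_diff_distrib)
    also have "\<dots> \<le> (\<Sum>b\<in>B'. (\<bar>C\<bar> * M) * \<bar>f b - g b\<bar>)"
    proof (rule sum_mono)
      fix b
      have "\<bar>representation B' z b\<bar> \<le> C * norm z" by (rule C[OF subsetD[OF ZB z]])
      also have "\<dots> \<le> \<bar>C\<bar> * norm z" by (intro mult_right_mono) auto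
      also have "\<dots> \<le> \<bar>C\<bar> * M" by (intro mult_left_mono bd z) auto
      finally have "\<bar>representation B' z b\<bar> * \<bar>f b - g b\<bar> \<le> (\<bar>C\<bar> * M) * \<bar>f b - g b\<bar>"
        by (rule mult_right_mono) simp
      then show "representation B' z b * (f b - g b) \<le> (\<bar>C\<bar> * M) * \<bar>f b - g b\<bar>"
        by (metis abs_ge_self abs_mult order_trans)
    qed
    also have "\<dots> = \<bar>C\<bar> * M * (\<Sum>b\<in>B'. \<bar>f b - g b\<bar>)" by (simp add: sum_distrib_left)
    finally show "f z \<le> (SUP z\<in>Z. g z) + \<bar>C\<bar> * M * (\<Sum>b\<in>B'. \<bar>f b - g b\<bar>)"
      using cSUP_upper[OF z bdd[OF g]] by simp
  qed
  have c: "continuous_on UNIV (\<lambda>f::'a \<Rightarrow> real. f x)" for x by simp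
  show ?thesis
    unfolding continuous_on_def
  proof
    fix f :: "'a \<Rightarrow> real" assume f: "f \<in> dual_ball"
    have ev: "((\<lambda>g. g x) \<longlongrightarrow> f x) (at f within dual_ball)" for x
      using continuous_on_subset[OF c, of dual_ball] f by (auto simp: continuous_on_def)
    have "((\<lambda>g. \<bar>C\<bar> * M * (\<Sum>b\<in>B'. \<bar>g b - f b\<bar>)) \<longlongrightarrow> \<bar>C\<bar> * M * (\<Sum>b\<in>B'. \<bar>f b - f b\<bar>)) (at f within dual_ball)"
      by (intro tendsto_intros ev)
    then have z: "((\<lambda>g. \<bar>C\<bar> * M * (\<Sum>b\<in>B'. \<bar>g b - f b\<bar>)) \<longlongrightarrow> 0) (at f within dual_ball)" by simp
    have "((\<lambda>g. (SUP z\<in>Z. g z) - (SUP z\<in>Z. f z)) \<longlongrightarrow> 0) (at f within dual_ball)"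
    proof (rule Lim_null_comparison[OF _ z])
      show "\<forall>\<^sub>F g in at f within dual_ball. norm ((SUP z\<in>Z. g z) - (SUP z\<in>Z. f z)) \<le> \<bar>C\<bar> * M * (\<Sum>b\<in>B'. \<bar>g b - f b\<bar>)"
      proof (rule eventually_at_topological[THEN iffD2], intro exI[of _ UNIV] conjI ballI impI)
        fix g :: "'a \<Rightarrow> real" assume "g \<in> dual_ball"
        then show "norm ((SUP z\<in>Z. g z) - (SUP z\<in>Z. f z)) \<le> \<bar>C\<bar> * M * (\<Sum>b\<in>B'. \<bar>g b - f b\<bar>)"
          using le[OF f, of g] le[OF _ f, of g] by (simp add: abs_le_iff abs_minus_commute)
      qed auto
    qed
    then show "((\<lambda>g. SUP z\<in>Z. g z) \<longlongrightarrow> (SUP z\<in>Z. f z)) (at f within dual_ball)"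
      by (simp add: LIM_zero_iff)
  qed
qed

text \<open>
  The vanishing outside \<open>{n..<m}\<close> is part of the definition so that sums over any larger interval agree.
\<close>

definition convex_weights :: "nat \<Rightarrow> nat \<Rightarrow> (nat \<Rightarrow> real) \<Rightarrow> bool" where
  "convex_weights n m \<alpha> \<longleftrightarrow> (\<forall>k. 0 \<le> \<alpha> k) \<and> (\<forall>k. k \<notin> {n..<m} \<longrightarrow> \<alpha> k = 0) \<and> sum \<alpha> {n..<m} = 1"

lemma convex_weights_sum:
  assumes "convex_weights n m \<alpha>" "{n..<m} \<subseteq> A" "finite A"
  shows "(\<Sum>k\<in>A. \<alpha> k * f k) = (\<Sum>k=n..<m. \<alpha> k * f k)"
  using assms by (intro sum.mono_neutral_right) (auto simp: convex_weights_def)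

lemma convex_weights_extend:
  assumes "convex_weights n m \<alpha>" "n' \<le> n" "m \<le> m'"
  shows "convex_weights n' m' \<alpha>"
proof -
  have "(\<Sum>k=n'..<m'. \<alpha> k) = (\<Sum>k=n..<m. \<alpha> k)"
    using convex_weights_sum[OF assms(1), of "{n'..<m'}" "\<lambda>_. 1"] assms by auto
  then show ?thesis using assms by (auto simp: convex_weights_def)
qed

lemma convex_weights_le:
  assumes "convex_weights n m \<alpha>" "\<And>k. k \<in> {n..<m} \<Longrightarrow> f k \<le> b"
  shows "(\<Sum>k=n..<m. \<alpha> k * f k) \<le> b"
proof -
  have "(\<Sum>k=n..<m. \<alpha> k * f k) \<le> (\<Sum>k=n..<m. \<alpha> k * b)"
    by (intro sum_mono mult_left_mono) (use assms in \<open>auto simp: convex_weights_def\<close>)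
  also have "\<dots> = b" using assms(1) by (simp add: convex_weights_def flip: sum_distrib_right)
  finally show ?thesis .
qed

text \<open>
  This is the tool that makes pointwise estimates on the dual ball uniform. It serves twice: for the
  images of the unit ball under the projections \<open>P j\<close>, with \<open>c = 1\<close>, and to show that the constructed
  basis is shrinking, with \<open>c = 0\<close>.
\<close>

theorem convex_combination_of_support_functions:
  fixes Z :: "nat \<Rightarrow> 'a::real_normed_vector set" and c M :: real
  assumes ne: "\<And>j. Z j \<noteq> {}" and bd: "\<And>j z. z \<in> Z j \<Longrightarrow> norm z \<le> M"
    and fd: "\<And>j. \<exists>B. finite B \<and> Z j \<subseteq> span B"
    and lim: "\<And>f e. f \<in> dual_ball \<Longrightarrow> e > 0 \<Longrightarrow> \<exists>n. \<forall>j\<ge>n. \<forall>z\<in>Z j. f z \<le> c + e"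
    and e: "e > 0"
  shows "\<exists>m \<alpha>. convex_weights n m \<alpha> \<and> (\<forall>f\<in>dual_ball. (\<Sum>j=n..<m. \<alpha> j * (SUP z\<in>Z j. f z)) \<le> c + e)"
proof -
  define s where "s j f = (SUP z\<in>Z j. f z)" for j and f :: "'a \<Rightarrow> real"
  \<comment> \<open>Simons' inequality is applied to the convex hulls of the tails.\<close>
  define C where "C i = {g. \<exists>m \<alpha>. convex_weights (n + i) m \<alpha> \<and> g = (\<lambda>f. \<Sum>j=n+i..<m. \<alpha> j * s j f)}" for i
  have fM: "\<bar>f z\<bar> \<le> M" if "f \<in> dual_ball" "z \<in> Z j" for f z j
    using that bd[OF that(2)] by (force simp: dual_ball_def intro: order_trans)
  have bdd: "bdd_above ((\<lambda>z. f z) ` Z j)" if "f \<in> dual_ball" for f j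
    using fM[OF that] by (intro bdd_aboveI2[of _ _ M]) (force simp: abs_le_iff)
  have sle: "s j f \<le> b" if "\<And>z. z \<in> Z j \<Longrightarrow> f z \<le> b" for j f b
    unfolding s_def using that by (intro cSUP_least ne)
  have sM: "\<bar>s j f\<bar> \<le> M" if f: "f \<in> dual_ball" for j f
  proof -
    obtain z where z: "z \<in> Z j" using ne by blast
    have "f z \<le> s j f" unfolding s_def by (rule cSUP_upper[OF z bdd[OF f]])
    moreover have "s j f \<le> M" by (rule sle) (use fM[OF f] in \<open>force simp: abs_le_iff\<close>)
    ultimately show ?thesis using fM[OF f z] by (auto simp: abs_le_iff)
  qed
  have sc: "continuous_on dual_ball (s j)" for j
  proof -
    obtain B where B: "finite B" "Z j \<subseteq> span B" using fd by blast
    show ?thesis unfolding s_def[abs_def]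
      by (rule continuous_support_function[OF ne _ B]) (rule bd)
  qed
  have "\<exists>g\<in>C 0. \<forall>f\<in>dual_ball. g f \<le> c + e"
  proof (rule Simons_inequality)
    show "compact (dual_ball :: ('a \<Rightarrow> real) set)" by (rule compact_dual_ball)
    show "(dual_ball :: ('a \<Rightarrow> real) set) \<noteq> {}" using norming_functional by blast
    show "C i \<noteq> {}" for i
    proof -
      have "convex_weights (n + i) (Suc (n + i)) (\<lambda>k. if k = n + i then 1 else 0)"
        by (auto simp: convex_weights_def)
      then show ?thesis unfolding C_def by blast
    qed
    show "C (Suc i) \<subseteq> C i" for i
    proof
      fix g assume "g \<in> C (Suc i)"
      then obtain m \<alpha> where *: "convex_weights (n + Suc i) m \<alpha>" "g = (\<lambda>f. \<Sum>j=n+Suc i..<m. \<alpha> j * s j f)"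
        by (auto simp: C_def)
      have "convex_weights (n + i) m \<alpha>" by (rule convex_weights_extend[OF *(1)]) auto
      moreover have "g = (\<lambda>f. \<Sum>j=n+i..<m. \<alpha> j * s j f)"
        using convex_weights_sum[OF *(1), of "{n+i..<m}"] *(2) by auto
      ultimately show "g \<in> C i" by (auto simp: C_def)
    qed
    show "(\<lambda>q. (g q + h q) / 2) \<in> C i" if gh: "g \<in> C i" "h \<in> C i" for i g h
    proof -
      obtain m \<alpha> m' \<mu> where *: "convex_weights (n + i) m \<alpha>" "g = (\<lambda>f. \<Sum>j=n+i..<m. \<alpha> j * s j f)"
         "convex_weights (n + i) m' \<mu>" "h = (\<lambda>f. \<Sum>j=n+i..<m'. \<mu> j * s j f)"
        using gh by (auto simp: C_def)
      define k where "k = max m m'"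
      have 1: "convex_weights (n + i) k \<alpha>" "convex_weights (n + i) k \<mu>"
        using convex_weights_extend[OF *(1), of "n + i" k] convex_weights_extend[OF *(3), of "n + i" k] by (auto simp: k_def)
      have 2: "g = (\<lambda>f. \<Sum>j=n+i..<k. \<alpha> j * s j f)" "h = (\<lambda>f. \<Sum>j=n+i..<k. \<mu> j * s j f)"
        using convex_weights_sum[OF *(1), of "{n+i..<k}"] convex_weights_sum[OF *(3), of "{n+i..<k}"] *(2,4)
        by (auto simp: k_def)
      have "convex_weights (n + i) k (\<lambda>j. (\<alpha> j + \<mu> j) / 2)"
        using 1 by (auto simp: convex_weights_def sum.distrib simp flip: sum_divide_distrib)
      moreover have "(\<lambda>q. (g q + h q) / 2) = (\<lambda>f. \<Sum>j=n+i..<k. (\<alpha> j + \<mu> j) / 2 * s j f)"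
        unfolding 2 by (rule ext, subst sum.distrib[symmetric], subst sum_divide_distrib) (simp add: algebra_simps)
      ultimately show ?thesis unfolding C_def by blast
    qed
    show "continuous_on dual_ball g" if "g \<in> C 0" for g
      using that by (auto simp: C_def intro!: continuous_intros sc)
    show "\<bar>g f\<bar> \<le> M" if g: "g \<in> C 0" and f: "f \<in> dual_ball" for g f
    proof -
      obtain m \<alpha> where *: "convex_weights n m \<alpha>" "g = (\<lambda>f. \<Sum>j=n..<m. \<alpha> j * s j f)"
        using g unfolding C_def mem_Collect_eq add_0_right by blast
      have "\<bar>g f\<bar> \<le> (\<Sum>j=n..<m. \<alpha> j * \<bar>s j f\<bar>)"
        using *(1) unfolding *(2) convex_weights_def by (intro order_trans[OF sum_abs]) (simp add: abs_mult)
      also have "\<dots> \<le> M" by (rule convex_weights_le[OF *(1)]) (rule sM[OF f])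
      finally show ?thesis .
    qed
    show "\<exists>i. \<forall>g\<in>C i. g f \<le> c + e" if f: "f \<in> dual_ball" and e: "e > 0" for f e
    proof -
      obtain N where N: "\<And>j z. j \<ge> N \<Longrightarrow> z \<in> Z j \<Longrightarrow> f z \<le> c + e" using lim[OF f e] by blast
      have "g f \<le> c + e" if g: "g \<in> C N" for g
      proof -
        obtain m \<alpha> where *: "convex_weights (n + N) m \<alpha>" "g = (\<lambda>f. \<Sum>j=n+N..<m. \<alpha> j * s j f)"
          using g by (auto simp: C_def)
        show ?thesis unfolding *(2) by (rule convex_weights_le[OF *(1)], rule sle, rule N) auto
      qed
      then show ?thesis by blast
    qed
    show "e > 0" by (rule e)
  qed
  then show ?thesis by (auto simp: C_def s_def)
qed

section \<open>A basis from a slow expansion of the identity\<close>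

text \<open>
  A pattern is a list of intervals \<open>{l..<h}\<close> (marked \<open>True\<close>) and complements of intervals (marked
  \<open>False\<close>); it stands for their intersection. The list is kept because its length, not the intersection,
  determines the weight in the norm.
\<close>

type_synonym pattern = "(bool \<times> nat \<times> nat) list"

fun block_set :: "bool \<times> nat \<times> nat \<Rightarrow> nat set" where
  "block_set (b, l, h) = (if b then {l..<h} else - {l..<h})"

definition pattern_set :: "pattern \<Rightarrow> nat set" where
  "pattern_set L = (\<Inter>I\<in>set L. block_set I)"

lemma pattern_set_simps [simp]:
  "pattern_set [] = UNIV" "pattern_set (I # L) = block_set I \<inter> pattern_set L"
  by (auto simp: pattern_set_def)

text \<open>
  The coordinates of a vector of the new space: functionals that evaluate a norming functional of the
  original space (numbered by a list of rationals) at a sum over a pattern before a slice \<open>s\<close>, and one functional for each basis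
  vector. As this type is countable, the vectors are bounded sequences.
\<close>

type_synonym index = "pattern \<times> nat \<times> rat list + nat"

definition linfty_of :: "(index \<Rightarrow> real) \<Rightarrow> linfty" where
  "linfty_of g = Bcontfun (\<lambda>n. g (from_nat n))"

definition coord :: "linfty \<Rightarrow> index \<Rightarrow> real" where
  "coord z p = apply_bcontfun z (to_nat p)"

lemma apply_linfty_of:
  assumes "\<And>p. \<bar>g p\<bar> \<le> M"
  shows "apply_bcontfun (linfty_of g) n = g (from_nat n)"
proof -
  have "(\<lambda>n. g (from_nat n)) \<in> (bcontfun :: (nat \<Rightarrow> real) set)"
    using assms by (auto simp: bcontfun_def bounded_iff)
  then show ?thesis unfolding linfty_of_def by (simp add: Bcontfun_inverse)
qed

lemma coord_linear: "linear (\<lambda>z. coord z p)"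
  by (auto simp: coord_def linear_iff plus_bcontfun.rep_eq scaleR_bcontfun.rep_eq)

lemma coord_le: "\<bar>coord z p\<bar> \<le> norm z"
  unfolding coord_def using norm_bounded[of z "to_nat p"] by simp

lemma subspace_closure:
  fixes S :: "'b::real_normed_vector set"
  assumes "subspace S"
  shows "subspace (closure S)"
  unfolding subspace_def
proof (intro conjI ballI allI)
  show "0 \<in> closure S" using subspace_0[OF assms] closure_subset by blast
  fix x y assume "x \<in> closure S" "y \<in> closure S"
  then obtain f g where "\<forall>n. f n \<in> S" "f \<longlonglongrightarrow> x" "\<forall>n. g n \<in> S" "g \<longlonglongrightarrow> y"
    unfolding closure_sequential by blast
  then show "x + y \<in> closure S"
    unfolding closure_sequential by (intro exI[of _ "\<lambda>n. f n + g n"]) (auto intro: tendsto_add subspace_add[OF assms])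
next
  fix c x assume "x \<in> closure S"
  then obtain f where "\<forall>n. f n \<in> S" "f \<longlonglongrightarrow> x" unfolding closure_sequential by blast
  then show "c *\<^sub>R x \<in> closure S"
    unfolding closure_sequential by (intro exI[of _ "\<lambda>n. c *\<^sub>R f n"]) (auto intro: tendsto_scaleR subspace_scale[OF assms])
qed

lemma opnorm_on_le:
  assumes "\<And>z. z \<in> Z \<Longrightarrow> norm (R z) \<le> C * norm z" "C \<ge> 0"
  shows "opnorm_on Z R \<le> ereal C"
  unfolding opnorm_on_def
proof (rule SUP_least)
  fix z assume "z \<in> {z \<in> Z. norm z \<le> 1}"
  then have "norm (R z) \<le> C * norm z" "norm z \<le> 1" using assms by auto
  then show "ereal (norm (R z)) \<le> ereal C" using assms(2) mult_left_mono[of "norm z" 1 C] by simp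
qed

lemma opnorm_on_leD:
  assumes sub: "subspace Z" and lin: "\<And>c z. z \<in> Z \<Longrightarrow> R (c *\<^sub>R z) = c *\<^sub>R R z"
    and le: "opnorm_on Z R \<le> ereal C" and z: "z \<in> Z"
  shows "norm (R z) \<le> C * norm z"
proof (cases "z = 0")
  case True
  then show ?thesis using lin[OF z, of 0] by simp
next
  case False
  have "ereal (norm (R ((1 / norm z) *\<^sub>R z))) \<le> opnorm_on Z R"
    unfolding opnorm_on_def by (rule SUP_upper) (use z False in \<open>auto intro: subspace_scale[OF sub]\<close>)
  then have "norm (R ((1 / norm z) *\<^sub>R z)) \<le> C" using le by (metis ereal_less_eq(3) order_trans)
  then show ?thesis using False by (simp add: lin[OF z] pos_divide_le_eq)
qed

text \<open>
  The identity is written as \<open>\<Sum>i. \<phi> i x *\<^sub>R v i\<close>, where the index \<open>i\<close> belongs to the slice \<open>sl i\<close>. Sums over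
  whole slices are controlled by \<open>pattern_bound\<close>, while a single slice is small in the absolute sense of \<open>slice_small\<close>.
  The vectors \<open>v i\<close> may vanish; the coordinates \<open>Inr\<close> keep the basis vectors apart.
\<close>

locale slow_expansion =
  fixes v :: "nat \<Rightarrow> 'a::real_normed_vector" and \<phi> :: "nat \<Rightarrow> 'a \<Rightarrow> real" and \<kappa> :: "nat \<Rightarrow> real"
    and sl :: "nat \<Rightarrow> nat" and D \<eta> \<gamma>\<^sub>0 :: real and \<gamma> :: "nat \<Rightarrow> real"
  assumes D: "D \<ge> 1" and \<eta>: "\<eta> \<ge> 0" and \<kappa>: "\<And>i. \<kappa> i > 0"
    and sl_mono: "mono sl" and finite_below: "\<And>s. finite {i. sl i < s}"
    and slice_small: "\<And>p. (\<Sum>i | sl i = p. \<kappa> i * norm (v i)) \<le> \<eta>"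
    and \<gamma>: "\<And>s. 1 \<le> \<gamma> s" "\<And>s. \<gamma> s \<le> \<gamma>\<^sub>0" "\<gamma> \<longlonglongrightarrow> 1"
    and \<phi>_linear: "\<And>i. linear (\<phi> i)" and \<phi>_le: "\<And>i x. \<bar>\<phi> i x\<bar> \<le> \<kappa> i * norm x"
    and pattern_bound: "\<And>L s x. norm (\<Sum>i | sl i < s \<and> sl i \<in> pattern_set L. \<phi> i x *\<^sub>R v i)
        \<le> D ^ length L * \<gamma> s * norm x"
    and dense: "closure {x. finite {i. \<phi> i x \<noteq> 0} \<and>
        (\<forall>\<^sub>F s in sequentially. (\<Sum>i | sl i < s. \<phi> i x *\<^sub>R v i) = x)} = UNIV"
    and far: "\<And>f e. f \<in> dual_ball \<Longrightarrow> e > 0 \<Longrightarrow> \<exists>n. \<forall>z\<in>span (v ` {n..}). \<bar>f z\<bar> \<le> e * norm z"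
begin

definition rational_combination :: "rat list \<Rightarrow> 'a" where
  "rational_combination q = (\<Sum>i<length q. real_of_rat (q ! i) *\<^sub>R v i)"

definition norming :: "rat list \<Rightarrow> 'a \<Rightarrow> real" where
  "norming q = (SOME f. f \<in> dual_ball \<and> f (rational_combination q) = norm (rational_combination q))"

lemma norming: "norming q \<in> dual_ball" "norming q (rational_combination q) = norm (rational_combination q)"
  using someI_ex[of "\<lambda>f. f \<in> dual_ball \<and> f (rational_combination q) = norm (rational_combination q)"]
    norming_functional[of "rational_combination q"] unfolding norming_def by blast+

lemma norming_linear: "linear (norming q)" and norming_le: "\<bar>norming q x\<bar> \<le> norm x"
  using norming(1)[of q] by (auto simp: dual_ball_def)

text \<open>
  Rational combinations are dense among the combinations of the \<open>v i\<close>, so countably many functionals are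
  norming there.
\<close>

lemma norm_le_if_norming_le:
  assumes "finite A" and le: "\<And>q. \<bar>norming q (\<Sum>i\<in>A. a i *\<^sub>R v i)\<bar> \<le> b"
  shows "norm (\<Sum>i\<in>A. a i *\<^sub>R v i) \<le> b"
proof (rule field_le_epsilon)
  fix e :: real assume e: "e > 0"
  define z where "z = (\<Sum>i\<in>A. a i *\<^sub>R v i)"
  obtain n where n: "A \<subseteq> {..<n}" using assms(1) finite_nat_bounded by blast
  define a' where "a' i = (if i \<in> A then a i else 0)" for i
  have z: "z = (\<Sum>i<n. a' i *\<^sub>R v i)"
    unfolding z_def by (rule sum.mono_neutral_cong_left) (use n in \<open>auto simp: a'_def\<close>)
  define V where "V = (\<Sum>i<n. norm (v i)) + 1"
  have V: "V > 0" unfolding V_def by (simp add: add_nonneg_pos sum_nonneg)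
  have "\<exists>r. \<bar>real_of_rat r - a' i\<bar> \<le> e / (2 * V)" for i
  proof -
    obtain r where "a' i < real_of_rat r" "real_of_rat r < a' i + e / (2 * V)"
      using of_rat_dense[of "a' i" "a' i + e / (2 * V)"] e V by auto
    then show ?thesis by (intro exI[of _ r]) linarith
  qed
  then obtain r where r: "\<And>i. \<bar>real_of_rat (r i) - a' i\<bar> \<le> e / (2 * V)" by metis
  define q where "q = map r [0..<n]"
  have "rational_combination q - z = (\<Sum>i<n. (real_of_rat (r i) - a' i) *\<^sub>R v i)"
    by (simp add: rational_combination_def q_def z scaleR_diff_left sum_subtractf)
  also have "norm \<dots> \<le> (\<Sum>i<n. norm ((real_of_rat (r i) - a' i) *\<^sub>R v i))" by (rule norm_sum)
  also have "\<dots> \<le> (\<Sum>i<n. e / (2 * V) * norm (v i))"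
    unfolding norm_scaleR by (intro sum_mono mult_right_mono r norm_ge_zero)
  also have "\<dots> = e / (2 * V) * (V - 1)" by (simp add: V_def sum_distrib_left)
  also have "\<dots> \<le> e / (2 * V) * V" using e V by (intro mult_left_mono) auto
  also have "\<dots> = e / 2" using V by simp
  finally have close: "norm (rational_combination q - z) \<le> e / 2" .
  have "norm z \<le> norm (rational_combination q) + e / 2" using close norm_triangle_ineq2[of z "rational_combination q"]
    by (simp add: norm_minus_commute)
  also have "norm (rational_combination q) = norming q z + norming q (rational_combination q - z)"
    using norming(2)[of q] linear_diff[OF norming_linear] by simp
  also have "\<dots> \<le> b + e / 2" using le[of q] norming_le[of q "rational_combination q - z"] close by (simp add: z_def)
  finally show "norm z \<le> b + e" unfolding z_def by simp
qed

fun basis_coord :: "nat \<Rightarrow> index \<Rightarrow> real" where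
  "basis_coord i (Inl (L, s, q)) = (if sl i < s \<and> sl i \<in> pattern_set L then norming q (v i) / (D ^ length L * \<gamma> s) else 0)"
| "basis_coord i (Inr j) = (if i = j then 1 / \<kappa> i else 0)"

definition w :: "nat \<Rightarrow> linfty" where
  "w i = linfty_of (basis_coord i)"

lemma weight_ge_1: "1 \<le> D ^ length L * \<gamma> s" for L :: pattern
  using D \<gamma>(1)[of s] mult_mono[of 1 "D ^ length L" 1 "\<gamma> s"] by (simp add: one_le_power)

lemma weight_pos: "0 < D ^ length L * \<gamma> s" for L :: pattern
  using weight_ge_1[of L s] by linarith

lemma basis_coord_bounded: "\<bar>basis_coord i p\<bar> \<le> max (norm (v i)) (1 / \<kappa> i)"
proof (cases p)
  case (Inl a)
  obtain L s q where p: "p = Inl (L, s, q)" using Inl by (cases a) auto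
  have "\<bar>norming q (v i)\<bar> / (D ^ length L * \<gamma> s) \<le> norm (v i) / 1"
    by (rule frac_le) (use norming_le weight_ge_1 in auto)
  then show ?thesis using weight_pos[of L s] unfolding p
    by (auto simp: abs_divide le_max_iff_disj)
next
  case (Inr j)
  then show ?thesis using \<kappa>[of i] by (auto simp: le_max_iff_disj)
qed

lemma coord_w: "coord (w i) p = basis_coord i p"
  unfolding w_def coord_def using apply_linfty_of[of "basis_coord i", OF basis_coord_bounded] by simp

lemma apply_w: "apply_bcontfun (w i) n = coord (w i) (from_nat n)"
  unfolding coord_w unfolding w_def using apply_linfty_of[of "basis_coord i", OF basis_coord_bounded] by simp

text \<open>
  The coefficient functionals are defined on the whole space of bounded sequences, which makes the
  uniqueness of expansions immediate.
\<close>

definition coeff :: "nat \<Rightarrow> linfty \<Rightarrow> real" where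
  "coeff i z = \<kappa> i * coord z (Inr i)"

lemma coeff_linear: "linear (coeff i)"
  using coord_linear[of "Inr i"] unfolding coeff_def by (auto simp: linear_iff algebra_simps)

lemma coeff_le: "\<bar>coeff i z\<bar> \<le> \<kappa> i * norm z"
  unfolding coeff_def abs_mult using \<kappa>[of i] by (intro mult_mono coord_le) auto

lemma coeff_bounded_linear: "bounded_linear (coeff i)"
  using coeff_linear coeff_le by (intro bounded_linear_intro[of _ "\<kappa> i"]) (auto simp: linear_iff mult.commute)

lemma coeff_w: "coeff i (w j) = (if i = j then 1 else 0)"
  using \<kappa>[of i] by (auto simp: coeff_def coord_w)

lemmas coeff_simps = linear_add[OF coeff_linear] linear_diff[OF coeff_linear] linear_cmul[OF coeff_linear]
  linear_sum[OF coeff_linear] linear_0[OF coeff_linear]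

definition basis_proj :: "nat set \<Rightarrow> linfty \<Rightarrow> linfty" where
  "basis_proj I z = (\<Sum>i\<in>I. coeff i z *\<^sub>R w i)"

lemma basis_proj_linear: "linear (basis_proj I)"
  by (auto simp: basis_proj_def linear_iff coeff_simps scaleR_left_distrib sum.distrib scaleR_sum_right)

lemma basis_proj_bounded_linear: "bounded_linear (basis_proj I)"
  unfolding basis_proj_def by (intro bounded_linear_sum bounded_linear_scaleR_left[THEN bounded_linear_compose] coeff_bounded_linear)

lemma coeff_basis_proj: "finite I \<Longrightarrow> coeff j (basis_proj I z) = (if j \<in> I then coeff j z else 0)"
  by (auto simp: basis_proj_def coeff_simps coeff_w if_distrib cong: if_cong)

lemma basis_proj_w: "finite I \<Longrightarrow> basis_proj I (w j) = (if j \<in> I then w j else 0)"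
proof -
  assume "finite I"
  have "basis_proj I (w j) = (\<Sum>i\<in>I. if i = j then w j else 0)" unfolding basis_proj_def by (intro sum.cong) (auto simp: coeff_w)
  then show ?thesis using \<open>finite I\<close> by simp
qed

definition basis_span :: "linfty set" where "basis_span = span (range w)"

lemma basis_proj_basis_span: "basis_proj I z \<in> basis_span"
  unfolding basis_proj_def basis_span_def by (intro span_sum span_scale span_base) auto

lemma subspace_basis_span: "subspace basis_span" unfolding basis_span_def by simp

lemma basis_span_w: "w i \<in> basis_span" unfolding basis_span_def by (simp add: span_base)

lemma basis_span_eq_basis_proj:
  assumes "z \<in> basis_span"
  obtains n where "\<And>m. m \<ge> n \<Longrightarrow> basis_proj {..<m} z = z" "\<And>i. i \<ge> n \<Longrightarrow> coeff i z = 0"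
proof -
  let ?S = "{z. \<exists>n. \<forall>m\<ge>n. basis_proj {..<m} z = z}"
  have "subspace ?S"
    unfolding subspace_def
  proof (intro conjI ballI allI)
    show "0 \<in> ?S" by (simp add: linear_0[OF basis_proj_linear])
    fix x y assume "x \<in> ?S" "y \<in> ?S"
    then obtain n m where "\<forall>k\<ge>n. basis_proj {..<k} x = x" "\<forall>k\<ge>m. basis_proj {..<k} y = y" by auto
    then have "\<forall>k\<ge>max n m. basis_proj {..<k} (x + y) = x + y" by (simp add: linear_add[OF basis_proj_linear])
    then show "x + y \<in> ?S" by blast
  next
    fix c x assume "x \<in> ?S"
    then show "c *\<^sub>R x \<in> ?S" by (auto simp: linear_cmul[OF basis_proj_linear])
  qed
  moreover have "w i \<in> ?S" for i
    by (rule CollectI, rule exI[of _ "Suc i"]) (auto simp: basis_proj_w)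
  ultimately have "basis_span \<subseteq> ?S" unfolding basis_span_def by (intro span_minimal) auto
  then obtain n where n: "\<And>m. m \<ge> n \<Longrightarrow> basis_proj {..<m} z = z" using assms by blast
  have "coeff i z = 0" if "i \<ge> n" for i
    using coeff_basis_proj[of "{..<n}" i z] n[of n] that by simp
  then show ?thesis using n that by blast
qed

lemma basis_span_support:
  assumes "z \<in> basis_span"
  shows "\<exists>n. \<forall>i\<ge>n. coeff i z = 0"
  by (rule basis_span_eq_basis_proj[OF assms]) auto

definition cells :: "pattern \<Rightarrow> nat \<Rightarrow> nat set" where
  "cells L s = {i. sl i < s \<and> sl i \<in> pattern_set L}"

lemma finite_cells [simp]: "finite (cells L s)"
  unfolding cells_def by (rule finite_subset[OF _ finite_below[of s]]) auto

definition pattern_vector :: "pattern \<Rightarrow> nat \<Rightarrow> linfty \<Rightarrow> 'a" where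
  "pattern_vector L s z = (\<Sum>i\<in>cells L s. coeff i z *\<^sub>R v i)"

lemma pattern_vector_linear: "linear (pattern_vector L s)"
  by (auto simp: pattern_vector_def linear_iff coeff_simps scaleR_left_distrib sum.distrib scaleR_sum_right)

lemma coord_Inl:
  assumes "z \<in> basis_span"
  shows "coord z (Inl (L, s, q)) = norming q (pattern_vector L s z) / (D ^ length L * \<gamma> s)"
proof -
  have 0: "coord z (Inl (L, s, q)) - norming q (pattern_vector L s z) / (D ^ length L * \<gamma> s) = 0"
    if "z \<in> range w" for z
  proof -
    obtain i where i: "z = w i" using \<open>z \<in> range w\<close> by blast
    have "pattern_vector L s (w i) = (\<Sum>j\<in>cells L s. if j = i then v i else 0)"
      unfolding pattern_vector_def by (intro sum.cong) (auto simp: coeff_w)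
    then have pvw: "pattern_vector L s (w i) = (if i \<in> cells L s then v i else 0)" by simp
    show ?thesis unfolding i pvw by (auto simp: coord_w linear_0[OF norming_linear] cells_def)
  qed
  have 1: "linear (\<lambda>z. coord z (Inl (L, s, q)) - norming q (pattern_vector L s z) / (D ^ length L * \<gamma> s))"
    using coord_linear[of "Inl (L, s, q)"]
    by (auto simp: linear_iff linear_add[OF norming_linear] linear_cmul[OF norming_linear]
        linear_add[OF pattern_vector_linear] linear_cmul[OF pattern_vector_linear] add_divide_distrib algebra_simps)
  have "coord z (Inl (L, s, q)) - norming q (pattern_vector L s z) / (D ^ length L * \<gamma> s) = 0"
    by (rule linear_eq_0_on_span[OF 1 0 assms[unfolded basis_span_def]])
  then show ?thesis by simp
qed

text \<open>
  Together with \<open>coeff_le\<close> and \<open>norm_pattern_vector_le\<close> this describes the norm of a finite combination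
  intrinsically, without reference to the coordinates.
\<close>

lemma norm_basis_span_le:
  assumes z: "z \<in> basis_span" and p: "\<And>L s. norm (pattern_vector L s z) \<le> b * (D ^ length L * \<gamma> s)"
    and c: "\<And>i. \<bar>coeff i z\<bar> \<le> b * \<kappa> i"
  shows "norm z \<le> b"
proof (rule norm_bound)
  fix n
  have "apply_bcontfun (w i) n = coord (w i) (from_nat n)" for i by (rule apply_w)
  then have "range w \<subseteq> {z. apply_bcontfun z n - coord z (from_nat n) = 0}" by auto
  moreover have "linear (\<lambda>z. apply_bcontfun z n - coord z (from_nat n))"
    by (auto simp: coord_def linear_iff plus_bcontfun.rep_eq scaleR_bcontfun.rep_eq algebra_simps)
  ultimately have eq: "apply_bcontfun z n = coord z (from_nat n)"
    using linear_eq_0_on_span[of "\<lambda>z. apply_bcontfun z n - coord z (from_nat n)" "range w" z] z unfolding basis_span_def by auto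
  show "norm (apply_bcontfun z n) \<le> b"
  proof (cases "from_nat n :: index")
    case (Inl a)
    obtain L s q where a: "from_nat n = (Inl (L, s, q) :: index)" using Inl by (cases a) auto
    have "\<bar>norming q (pattern_vector L s z)\<bar> \<le> b * (D ^ length L * \<gamma> s)" using norming_le p by (rule order_trans)
    then show ?thesis unfolding eq a coord_Inl[OF z] using weight_pos[of L s]
      by (simp add: abs_divide pos_divide_le_eq)
  next
    case (Inr i)
    then show ?thesis unfolding eq Inr using c[of i] \<kappa>[of i] by (simp add: coeff_def abs_mult mult.commute)
  qed
qed

lemma norm_pattern_vector_le:
  assumes z: "z \<in> basis_span"
  shows "norm (pattern_vector L s z) \<le> D ^ length L * \<gamma> s * norm z"
  unfolding pattern_vector_def
proof (rule norm_le_if_norming_le)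
  fix q
  have "\<bar>norming q (pattern_vector L s z)\<bar> / (D ^ length L * \<gamma> s) \<le> norm z"
    using coord_le[of z "Inl (L, s, q)"] weight_pos[of L s] unfolding coord_Inl[OF z] by (simp add: abs_divide)
  then show "\<bar>norming q (\<Sum>i\<in>cells L s. coeff i z *\<^sub>R v i)\<bar> \<le> D ^ length L * \<gamma> s * norm z"
    using weight_pos[of L s] by (simp add: pos_divide_le_eq pattern_vector_def mult.commute)
qed simp

lemma finite_slice: "finite {i. sl i = p}"
  by (rule finite_subset[OF _ finite_below[of "Suc p"]]) auto

text \<open>
  The common estimate for all projections of the new basis. The set \<open>I\<close> of basis indices is a union of slices, those
  in \<open>J\<close>, apart from the few slices \<open>P\<close> through which a boundary of \<open>I\<close> passes; each of these contributes at most \<open>\<eta>\<close>.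
\<close>

lemma cut_bound:
  assumes z: "z \<in> basis_span" and y: "y \<in> basis_span" and P: "finite P"
    and coeff_y: "\<And>i. coeff i y = (if i \<in> I then coeff i z else 0)"
    and I: "\<And>i. sl i \<notin> P \<Longrightarrow> i \<in> I \<longleftrightarrow> sl i \<in> J" and J: "J \<inter> P = {}"
    and K: "K \<ge> 1"
    and bound: "\<And>L s. norm (\<Sum>i\<in>{i\<in>cells L s. sl i \<in> J}. coeff i z *\<^sub>R v i) \<le> K * (D ^ length L * \<gamma> s) * norm z"
  shows "norm y \<le> (K + card P * \<eta>) * norm z"
proof (rule norm_basis_span_le[OF y])
  have nn: "K + real (card P) * \<eta> \<ge> K" using \<eta> by simp
  show "\<bar>coeff i y\<bar> \<le> (K + card P * \<eta>) * norm z * \<kappa> i" for i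
  proof -
    have "\<bar>coeff i y\<bar> \<le> 1 * (\<kappa> i * norm z)" using coeff_y[of i] coeff_le[of i z] \<kappa>[of i] by auto
    also have "\<dots> \<le> (K + card P * \<eta>) * (\<kappa> i * norm z)"
      using nn K \<kappa>[of i] by (intro mult_right_mono) auto
    finally show ?thesis by (simp add: mult_ac)
  qed
  fix L s
  let ?A = "{i\<in>cells L s. sl i \<in> J}" and ?B = "{i\<in>cells L s. sl i \<in> P}"
  let ?r = "D ^ length L * \<gamma> s"
  have "pattern_vector L s y = (\<Sum>i\<in>?A \<union> ?B. coeff i y *\<^sub>R v i)"
    unfolding pattern_vector_def
  proof (rule sum.mono_neutral_right)
    show "\<forall>i\<in>cells L s - (?A \<union> ?B). coeff i y *\<^sub>R v i = 0" using I coeff_y by auto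
  qed auto
  also have "\<dots> = (\<Sum>i\<in>?A. coeff i y *\<^sub>R v i) + (\<Sum>i\<in>?B. coeff i y *\<^sub>R v i)"
    by (rule sum.union_disjoint) (use J in auto)
  also have "(\<Sum>i\<in>?A. coeff i y *\<^sub>R v i) = (\<Sum>i\<in>?A. coeff i z *\<^sub>R v i)"
    by (rule sum.cong) (use I J coeff_y in auto)
  finally have eq: "pattern_vector L s y = (\<Sum>i\<in>?A. coeff i z *\<^sub>R v i) + (\<Sum>i\<in>?B. coeff i y *\<^sub>R v i)" .
  have "norm (\<Sum>i\<in>?B. coeff i y *\<^sub>R v i) \<le> (\<Sum>i\<in>?B. norm (coeff i y *\<^sub>R v i))" by (rule norm_sum)
  also have "\<dots> \<le> (\<Sum>i\<in>?B. \<kappa> i * norm (v i) * norm z)"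
  proof (rule sum_mono)
    fix i
    have "\<bar>coeff i y\<bar> \<le> \<kappa> i * norm z" using coeff_y[of i] coeff_le[of i z] \<kappa>[of i] by auto
    then show "norm (coeff i y *\<^sub>R v i) \<le> \<kappa> i * norm (v i) * norm z"
      using mult_right_mono[of "\<bar>coeff i y\<bar>" "\<kappa> i * norm z" "norm (v i)"] by (simp add: mult_ac)
  qed
  also have "\<dots> \<le> (\<Sum>i\<in>(\<Union>p\<in>P. {i. sl i = p}). \<kappa> i * norm (v i) * norm z)"
    by (rule sum_mono2) (use P finite_slice \<kappa> in \<open>auto simp: less_imp_le\<close>)
  also have "\<dots> = (\<Sum>p\<in>P. \<Sum>i | sl i = p. \<kappa> i * norm (v i) * norm z)"
    by (rule sum.UNION_disjoint) (use P finite_slice in auto)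
  also have "\<dots> \<le> (\<Sum>p\<in>P. \<eta> * norm z)"
    by (rule sum_mono) (simp add: slice_small mult_right_mono flip: sum_distrib_right)
  also have "\<dots> = 1 * (card P * \<eta> * norm z)" by simp
  also have "\<dots> \<le> ?r * (card P * \<eta> * norm z)" using weight_ge_1[of L s] \<eta> by (intro mult_right_mono) auto
  finally have "norm (\<Sum>i\<in>?B. coeff i y *\<^sub>R v i) \<le> ?r * (card P * \<eta> * norm z)" .
  then have "norm (pattern_vector L s y) \<le> K * ?r * norm z + ?r * (card P * \<eta> * norm z)"
    unfolding eq by (intro norm_triangle_mono bound)
  then show "norm (pattern_vector L s y) \<le> (K + card P * \<eta>) * norm z * ?r" by (simp add: algebra_simps)
qed

text \<open>
  Adding the block to the pattern makes the list longer by one entry. This is where the factor \<open>D\<close> comes from.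
\<close>

lemma block_bound:
  assumes "z \<in> basis_span"
  shows "norm (\<Sum>i\<in>{i\<in>cells L s. sl i \<in> block_set I}. coeff i z *\<^sub>R v i) \<le> D * (D ^ length L * \<gamma> s) * norm z"
proof -
  have "{i\<in>cells L s. sl i \<in> block_set I} = cells (I # L) s" by (auto simp: cells_def)
  then show ?thesis using norm_pattern_vector_le[OF assms, of "I # L" s] by (simp add: pattern_vector_def mult_ac)
qed

lemma two_points: "real (card {p, q}) * \<eta> \<le> 2 * \<eta>"
  using \<eta> by (intro mult_right_mono) (cases "p = q", auto)

lemma interval_bound_basis_span:
  assumes z: "z \<in> basis_span"
  shows "norm (basis_proj {m..n} z) \<le> (D + 2 * \<eta>) * norm z"
proof -
  define I where "I = (True, Suc (sl m), sl n)"
  have mono: "sl i \<le> sl j" if "i \<le> j" for i j using monoD[OF sl_mono that] .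
  have iff: "i \<in> {m..n} \<longleftrightarrow> sl i \<in> block_set I" if "m \<le> n" "sl i \<notin> {sl m, sl n}" for i
    using that mono[of i m] mono[of m i] mono[of i n] mono[of n i] unfolding I_def by (cases "i \<le> m"; cases "i \<le> n") auto
  show ?thesis
  proof (cases "m \<le> n")
    case True
    have "norm (basis_proj {m..n} z) \<le> (D + card {sl m, sl n} * \<eta>) * norm z"
    proof (rule cut_bound[OF z basis_proj_basis_span, where I = "{m..n}" and J = "block_set I"])
      show "coeff i (basis_proj {m..n} z) = (if i \<in> {m..n} then coeff i z else 0)" for i by (rule coeff_basis_proj) simp
      show "i \<in> {m..n} \<longleftrightarrow> sl i \<in> block_set I" if "sl i \<notin> {sl m, sl n}" for i by (rule iff[OF True that])
      show "block_set I \<inter> {sl m, sl n} = {}" by (simp add: I_def)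
    qed (simp, rule D, rule block_bound[OF z])
    also have "\<dots> \<le> (D + 2 * \<eta>) * norm z" by (intro mult_right_mono add_left_mono two_points) simp
    finally show ?thesis .
  next
    case False
    then show ?thesis using D \<eta> by (simp add: basis_proj_def)
  qed
qed

lemma cointerval_bound_basis_span:
  assumes z: "z \<in> basis_span" and mn: "m \<le> n"
  shows "norm (z - basis_proj {m..n} z) \<le> (D + 2 * \<eta>) * norm z"
proof -
  define I where "I = (False, sl m, Suc (sl n))"
  have mono: "sl i \<le> sl j" if "i \<le> j" for i j using monoD[OF sl_mono that] .
  have iff: "i \<in> - {m..n} \<longleftrightarrow> sl i \<in> block_set I" if "sl i \<notin> {sl m, sl n}" for i
    using that mn mono[of i m] mono[of m i] mono[of i n] mono[of n i] unfolding I_def by (cases "i \<le> m"; cases "i \<le> n") auto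
  have "norm (z - basis_proj {m..n} z) \<le> (D + card {sl m, sl n} * \<eta>) * norm z"
  proof (rule cut_bound[OF z, where I = "- {m..n}" and J = "block_set I"])
    show "z - basis_proj {m..n} z \<in> basis_span" by (rule subspace_diff[OF subspace_basis_span z basis_proj_basis_span])
    show "coeff i (z - basis_proj {m..n} z) = (if i \<in> - {m..n} then coeff i z else 0)" for i
      by (simp add: linear_diff[OF coeff_linear] coeff_basis_proj)
    show "i \<in> - {m..n} \<longleftrightarrow> sl i \<in> block_set I" if "sl i \<notin> {sl m, sl n}" for i by (rule iff[OF that])
    show "block_set I \<inter> {sl m, sl n} = {}" using mono[OF mn] by (simp add: I_def)
  qed (simp, rule D, rule block_bound[OF z])
  also have "\<dots> \<le> (D + 2 * \<eta>) * norm z" by (intro mult_right_mono add_left_mono two_points) simp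
  finally show ?thesis .
qed

lemma initial_bound_basis_span:
  assumes z: "z \<in> basis_span"
  shows "norm (basis_proj {0..n} z) \<le> (\<gamma>\<^sub>0 + \<eta>) * norm z"
proof -
  have mono: "sl i \<le> sl j" if "i \<le> j" for i j using monoD[OF sl_mono that] .
  have g0: "\<gamma>\<^sub>0 \<ge> 1" using \<gamma>(1,2)[of 0] by linarith
  have "norm (basis_proj {0..n} z) \<le> (\<gamma>\<^sub>0 + card {sl n} * \<eta>) * norm z"
  proof (rule cut_bound[OF z basis_proj_basis_span, where I = "{0..n}" and J = "{..<sl n}"])
    fix L s
    have "{i\<in>cells L s. sl i \<in> {..<sl n}} = cells L (min s (sl n))" by (auto simp: cells_def)
    then have "norm (\<Sum>i\<in>{i\<in>cells L s. sl i \<in> {..<sl n}}. coeff i z *\<^sub>R v i) \<le> D ^ length L * \<gamma> (min s (sl n)) * norm z"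
      using norm_pattern_vector_le[OF z, of L "min s (sl n)"] by (simp add: pattern_vector_def)
    also have "\<dots> \<le> D ^ length L * (\<gamma>\<^sub>0 * \<gamma> s) * norm z"
    proof (intro mult_right_mono mult_left_mono)
      \<comment> \<open>An initial segment changes only the bound $s$ of the pattern.\<close>
      have "\<gamma> (min s (sl n)) \<le> \<gamma>\<^sub>0 * 1" using \<gamma>(2) by simp
      also have "\<dots> \<le> \<gamma>\<^sub>0 * \<gamma> s" using \<gamma>(1) g0 by (intro mult_left_mono) auto
      finally show "\<gamma> (min s (sl n)) \<le> \<gamma>\<^sub>0 * \<gamma> s" .
    qed (use D in auto)
    finally show "norm (\<Sum>i\<in>{i\<in>cells L s. sl i \<in> {..<sl n}}. coeff i z *\<^sub>R v i) \<le> \<gamma>\<^sub>0 * (D ^ length L * \<gamma> s) * norm z"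
      by (simp add: mult_ac)
    show "i \<in> {0..n} \<longleftrightarrow> sl i \<in> {..<sl n}" if "sl i \<notin> {sl n}" for i
      using that mono[of i n] mono[of n i] by (cases "i \<le> n") auto
  qed (use coeff_basis_proj g0 in auto)
  then show ?thesis by simp
qed

definition W :: "linfty set" where "W = closure basis_span"

lemma subspace_W: "subspace W"
  unfolding W_def by (rule subspace_closure[OF subspace_basis_span])

lemma basis_span_subset_W: "basis_span \<subseteq> W" unfolding W_def by (rule closure_subset)

lemma extend_to_W:
  assumes "bounded_linear R" and "\<And>z. z \<in> basis_span \<Longrightarrow> norm (R z :: linfty) \<le> C * norm z" and "z \<in> W"
  shows "norm (R z) \<le> C * norm z"
proof -
  have "closed {z. norm (R z) \<le> C * norm z}"
    by (intro closed_Collect_le continuous_intros bounded_linear.continuous_on[OF assms(1)])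
  then have "closure basis_span \<subseteq> {z. norm (R z) \<le> C * norm z}" using assms(2) by (intro closure_minimal) auto
  then show ?thesis using assms(3) unfolding W_def by blast
qed

lemma interval_bound: "z \<in> W \<Longrightarrow> norm (basis_proj {m..n} z) \<le> (D + 2 * \<eta>) * norm z"
  by (rule extend_to_W[OF basis_proj_bounded_linear interval_bound_basis_span])

lemma cointerval_bound: "z \<in> W \<Longrightarrow> m \<le> n \<Longrightarrow> norm (z - basis_proj {m..n} z) \<le> (D + 2 * \<eta>) * norm z"
  by (rule extend_to_W[OF bounded_linear_sub[OF bounded_linear_ident basis_proj_bounded_linear] cointerval_bound_basis_span])

lemma initial_bound: "z \<in> W \<Longrightarrow> norm (basis_proj {0..n} z) \<le> (\<gamma>\<^sub>0 + \<eta>) * norm z"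
  by (rule extend_to_W[OF basis_proj_bounded_linear initial_bound_basis_span])

text \<open>
  The partial sums are uniformly bounded operators that are eventually the identity at each vector of a dense subspace.
\<close>

lemma expansion_sums:
  assumes z: "z \<in> W"
  shows "(\<lambda>i. coeff i z *\<^sub>R w i) sums z"
proof -
  have g0: "\<gamma>\<^sub>0 \<ge> 1" using \<gamma>(1,2)[of 0] by linarith
  have "(\<lambda>n. basis_proj {0..n} z) \<longlonglongrightarrow> z"
  proof (rule metric_LIMSEQ_I)
    fix e :: real assume e: "e > 0"
    define c where "c = \<gamma>\<^sub>0 + \<eta> + 2"
    have c: "c > 0" using g0 \<eta> by (simp add: c_def)
    obtain y where y: "y \<in> basis_span" "dist y z < e / c"
      using z e c unfolding W_def closure_approachable by (meson divide_pos_pos)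
    obtain N where N: "\<And>m. m \<ge> N \<Longrightarrow> basis_proj {..<m} y = y" using basis_span_eq_basis_proj[OF y(1)] by metis
    have "dist (basis_proj {0..n} z) z < e" if "n \<ge> N" for n
    proof -
      have "basis_proj {0..n} y = y" using N[of "Suc n"] that by (simp add: lessThan_Suc_atMost atLeast0AtMost)
      then have "basis_proj {0..n} z - z = basis_proj {0..n} (z - y) + (y - z)" by (simp add: linear_diff[OF basis_proj_linear])
      also have "norm \<dots> \<le> (\<gamma>\<^sub>0 + \<eta>) * norm (z - y) + norm (y - z)"
        using subspace_diff[OF subspace_W z, of y] y(1) basis_span_subset_W
        by (intro norm_triangle_mono initial_bound) auto
      also have "\<dots> \<le> c * norm (y - z)" by (simp add: c_def norm_minus_commute algebra_simps)
      also have "\<dots> < e" using y(2) c by (simp add: dist_norm field_simps)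
      finally show ?thesis by (simp add: dist_norm)
    qed
    then show "\<exists>N. \<forall>n\<ge>N. dist (basis_proj {0..n} z) z < e" by blast
  qed
  then show ?thesis unfolding basis_proj_def sums_def_le atLeast0AtMost .
qed

lemma expansion_unique:
  assumes "(\<lambda>i. a i *\<^sub>R w i) sums z"
  shows "a j = coeff j z"
proof -
  have "(\<lambda>i. coeff j (a i *\<^sub>R w i)) sums coeff j z" by (rule bounded_linear.sums[OF coeff_bounded_linear assms])
  moreover have "(\<lambda>i. coeff j (a i *\<^sub>R w i)) = (\<lambda>i. if i = j then a j else 0)"
    by (auto simp: coeff_simps coeff_w)
  ultimately show ?thesis using sums_single[of j "\<lambda>_. a j"] sums_unique2 by metis
qed

lemma Schauder_basis_W: "is_Schauder_basis W w"
  unfolding is_Schauder_basis_def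
proof (intro conjI allI ballI)
  show "w n \<in> W" for n using basis_span_w basis_span_subset_W by blast
  show "\<exists>!a. (\<lambda>n. a n *\<^sub>R w n) sums z" if "z \<in> W" for z
    by (rule ex1I[of _ "\<lambda>i. coeff i z"]) (rule expansion_sums[OF that], rule ext, rule expansion_unique)
qed

lemma FDD_component_W:
  assumes "z \<in> W"
  shows "FDD_component (basis_FDD w) n z = coeff n z *\<^sub>R w n"
proof -
  have "(THE x. (\<forall>n. x n \<in> basis_FDD w n) \<and> x sums z) = (\<lambda>n. coeff n z *\<^sub>R w n)"
  proof (rule the_equality)
    show "(\<forall>n. coeff n z *\<^sub>R w n \<in> basis_FDD w n) \<and> (\<lambda>n. coeff n z *\<^sub>R w n) sums z"
      using expansion_sums[OF assms] by (auto simp: basis_FDD_def intro: span_scale span_base)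
    fix x assume x: "(\<forall>n. x n \<in> basis_FDD w n) \<and> x sums z"
    then have "\<forall>n. \<exists>a. x n = a *\<^sub>R w n" by (auto simp: basis_FDD_def span_singleton)
    then obtain a where a: "\<And>n. x n = a n *\<^sub>R w n" by metis
    then have "(\<lambda>n. a n *\<^sub>R w n) sums z" using x by (simp add: a[symmetric])
    then show "x = (\<lambda>n. coeff n z *\<^sub>R w n)" using expansion_unique a by metis
  qed
  then show ?thesis unfolding FDD_component_def by simp
qed

lemma FDD_proj_W: "z \<in> W \<Longrightarrow> FDD_proj (basis_FDD w) A z = basis_proj A z"
  unfolding FDD_proj_def basis_proj_def by (simp add: FDD_component_W)

lemma monotone_W: "FDD_monotone (\<gamma>\<^sub>0 + \<eta>) W (basis_FDD w)"
  unfolding FDD_monotone_def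
  by (intro SUP_least opnorm_on_le) (use \<gamma>(1,2)[of 0] \<eta> in \<open>auto simp: FDD_proj_W initial_bound\<close>)

lemma bimonotone_W: "strong_bimonotonicity_constant W (basis_FDD w) \<le> ereal (D + 2 * \<eta>)"
  unfolding strong_bimonotonicity_constant_def
proof (rule SUP_least, safe)
  fix m n :: nat assume "m < n"
  then show "max (opnorm_on W (FDD_proj (basis_FDD w) {m..n})) (opnorm_on W (\<lambda>z. z - FDD_proj (basis_FDD w) {m..n} z))
      \<le> ereal (D + 2 * \<eta>)"
    by (intro max.boundedI opnorm_on_le) (use D \<eta> in \<open>auto simp: FDD_proj_W interval_bound cointerval_bound\<close>)
qed

section \<open>The isometric embedding\<close>

text \<open>
  The coordinates of the formal series \<open>\<Sum>i. \<phi> i x *\<^sub>R w i\<close>; each of them involves finitely many terms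
  only, so the map is defined before convergence is known.
\<close>

fun embed_coord :: "'a \<Rightarrow> index \<Rightarrow> real" where
  "embed_coord x (Inl (L, s, q)) = norming q (\<Sum>i\<in>cells L s. \<phi> i x *\<^sub>R v i) / (D ^ length L * \<gamma> s)"
| "embed_coord x (Inr j) = \<phi> j x / \<kappa> j"

lemma embed_coord_le: "\<bar>embed_coord x p\<bar> \<le> norm x"
proof (cases p)
  case (Inl a)
  obtain L s q where p: "p = Inl (L, s, q)" using Inl by (cases a) auto
  have "\<bar>norming q (\<Sum>i\<in>cells L s. \<phi> i x *\<^sub>R v i)\<bar> \<le> norm x * (D ^ length L * \<gamma> s)"
    using order_trans[OF norming_le pattern_bound] by (simp add: cells_def mult_ac)
  then show ?thesis unfolding p using weight_pos[of L s] by (simp add: abs_divide pos_divide_le_eq)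
next
  case (Inr j)
  then show ?thesis using \<phi>_le[of j x] \<kappa>[of j] by (simp add: abs_divide pos_divide_le_eq mult.commute)
qed

lemma embed_coord_linear: "linear (\<lambda>x. embed_coord x p)"
proof -
  have 1: "\<phi> i (x + y) = \<phi> i x + \<phi> i y" "\<phi> i (c *\<^sub>R x) = c * \<phi> i x" for i x y c
    using linear_add[OF \<phi>_linear] linear_cmul[OF \<phi>_linear] by auto
  show ?thesis
  proof (cases p)
    case (Inl a)
    obtain L s q where p: "p = Inl (L, s, q)" using Inl by (cases a) auto
    have "(\<Sum>i\<in>cells L s. \<phi> i (x + y) *\<^sub>R v i) = (\<Sum>i\<in>cells L s. \<phi> i x *\<^sub>R v i) + (\<Sum>i\<in>cells L s. \<phi> i y *\<^sub>R v i)" for x y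
      by (simp add: 1 scaleR_left_distrib sum.distrib)
    moreover have "(\<Sum>i\<in>cells L s. \<phi> i (c *\<^sub>R x) *\<^sub>R v i) = c *\<^sub>R (\<Sum>i\<in>cells L s. \<phi> i x *\<^sub>R v i)" for c x
      by (simp add: 1 scaleR_sum_right)
    ultimately show ?thesis unfolding p
      by (simp add: linear_iff linear_add[OF norming_linear] linear_cmul[OF norming_linear] add_divide_distrib)
  qed (auto simp: linear_iff 1 add_divide_distrib)
qed

definition T :: "'a \<Rightarrow> linfty" where "T x = linfty_of (embed_coord x)"

lemma apply_T: "apply_bcontfun (T x) n = embed_coord x (from_nat n)"
  unfolding T_def by (rule apply_linfty_of[OF embed_coord_le])

lemma coord_T: "coord (T x) p = embed_coord x p"
  by (simp add: coord_def apply_T)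

lemma T_linear: "linear T"
proof (rule linearI)
  show "T (x + y) = T x + T y" for x y
    by (rule bcontfun_eqI) (simp add: apply_T plus_bcontfun.rep_eq linear_add[OF embed_coord_linear])
  show "T (c *\<^sub>R x) = c *\<^sub>R T x" for c x
    by (rule bcontfun_eqI) (simp add: apply_T scaleR_bcontfun.rep_eq linear_cmul[OF embed_coord_linear])
qed

lemma norm_T_le: "norm (T x) \<le> norm x"
  by (rule norm_bound) (use embed_coord_le in \<open>simp add: apply_T\<close>)

lemma T_bounded_linear: "bounded_linear T"
  using T_linear norm_T_le by (intro bounded_linear_intro[of _ 1]) (auto simp: linear_iff)

text \<open>
  The upper bound is \<open>pattern_bound\<close>. For the lower bound the empty pattern suffices, as \<open>\<gamma>\<close> tends to 1.
\<close>

lemma norm_T: "norm (T x) = norm x"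
proof -
  have "closed {x. norm x \<le> norm (T x)}"
    by (intro closed_Collect_le continuous_intros bounded_linear.continuous_on[OF T_bounded_linear])
  moreover have "norm x \<le> norm (T x)" if ev: "\<forall>\<^sub>F s in sequentially. (\<Sum>i | sl i < s. \<phi> i x *\<^sub>R v i) = x" for x
  proof -
    have "\<forall>\<^sub>F s in sequentially. norm x \<le> \<gamma> s * norm (T x)"
      using ev
    proof eventually_elim
      case (elim s)
      have c: "cells [] s = {i. sl i < s}" by (auto simp: cells_def)
      have "norm (\<Sum>i\<in>cells [] s. \<phi> i x *\<^sub>R v i) \<le> \<gamma> s * norm (T x)"
      proof (rule norm_le_if_norming_le)
        fix q
        show "\<bar>norming q (\<Sum>i\<in>cells [] s. \<phi> i x *\<^sub>R v i)\<bar> \<le> \<gamma> s * norm (T x)"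
          using coord_le[of "T x" "Inl ([], s, q)"] \<gamma>(1)[of s]
          by (simp add: coord_T abs_divide pos_divide_le_eq mult.commute)
      qed simp
      then show ?case unfolding c elim .
    qed
    moreover have "(\<lambda>s. \<gamma> s * norm (T x)) \<longlonglongrightarrow> 1 * norm (T x)" by (intro tendsto_intros \<gamma>)
    ultimately show ?thesis using tendsto_lowerbound[of "\<lambda>s. \<gamma> s * norm (T x)"] by simp
  qed
  ultimately have "UNIV \<subseteq> {x. norm x \<le> norm (T x)}" using closure_minimal dense by (smt (verit) mem_Collect_eq subsetI)
  then have "norm x \<le> norm (T x)" by blast
  then show ?thesis using norm_T_le[of x] by simp
qed

lemma range_T: "range T \<subseteq> W"
proof -
  let ?Y = "{x. finite {i. \<phi> i x \<noteq> 0} \<and> (\<forall>\<^sub>F s in sequentially. (\<Sum>i | sl i < s. \<phi> i x *\<^sub>R v i) = x)}"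
  have "closed (T -` W)"
    unfolding W_def by (intro closed_vimage closed_closure linear_continuous_on T_bounded_linear)
  moreover have "T x \<in> W" if f: "finite {i. \<phi> i x \<noteq> 0}" for x
  proof -
    let ?F = "{i. \<phi> i x \<noteq> 0}"
    let ?y = "\<Sum>i\<in>?F. \<phi> i x *\<^sub>R w i"
    have y: "?y \<in> basis_span" unfolding basis_span_def by (intro span_sum span_scale span_base) auto
    have coeff: "coeff j ?y = \<phi> j x" for j
      using f by (auto simp: coeff_simps coeff_w if_distrib cong: if_cong)
    have c: "coord ?y p = embed_coord x p" for p
    proof (cases p)
      case (Inl a)
      obtain L s q where p: "p = Inl (L, s, q)" using Inl by (cases a) auto
      show ?thesis unfolding p coord_Inl[OF y] by (simp add: pattern_vector_def coeff del: coeff_simps)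
    next
      case (Inr j)
      then show ?thesis using coeff[of j] \<kappa>[of j] by (simp add: coeff_def field_simps)
    qed
    have "apply_bcontfun ?y n = coord ?y (from_nat n)" for n
    proof -
      have l: "linear (\<lambda>z::linfty. apply_bcontfun z n)"
        by (auto simp: linear_iff plus_bcontfun.rep_eq scaleR_bcontfun.rep_eq)
      show ?thesis
        by (simp add: linear_sum[OF l] linear_cmul[OF l] linear_sum[OF coord_linear] linear_cmul[OF coord_linear] apply_w)
    qed
    then have "T x = ?y" by (intro bcontfun_eqI) (simp add: apply_T c)
    then show ?thesis using y basis_span_subset_W by auto
  qed
  ultimately have "closure ?Y \<subseteq> T -` W" by (intro closure_minimal) auto
  then show ?thesis using dense by auto
qed

section \<open>The basis is shrinking\<close>

lemma span_tail_basis_span: "span (w ` {n..}) \<subseteq> basis_span"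
  unfolding basis_span_def by (intro span_mono) auto

lemma coeff_span_tail:
  assumes "z \<in> span (w ` {n..})" "i < n"
  shows "coeff i z = 0"
  by (rule linear_eq_0_on_span[OF coeff_linear _ assms(1)]) (use assms(2) in \<open>auto simp: coeff_w\<close>)

text \<open>
  Adding \<open>K\<close> vectors with disjoint supports on which \<open>\<psi>\<close> is at least \<open>e\<close> keeps the coefficients bounded while
  \<open>\<psi>\<close> grows linearly. After division by \<open>K\<close> the coefficients are small.
\<close>

lemma spread_out_vectors:
  assumes add: "\<And>x y. x \<in> W \<Longrightarrow> y \<in> W \<Longrightarrow> \<psi> (x + y) = \<psi> x + \<psi> y"
    and scale: "\<And>c x. x \<in> W \<Longrightarrow> \<psi> (c *\<^sub>R x) = c * \<psi> x"
    and bad: "\<And>n. \<exists>z\<in>span (w ` {n..}). e * norm z < \<bar>\<psi> z\<bar>" and e: "e > 0"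
  shows "\<exists>u\<in>span (w ` {n..}). norm u \<le> real K \<and> real K * e \<le> \<psi> u \<and> (\<forall>i. \<bar>coeff i u\<bar> \<le> \<kappa> i)"
proof (induction K arbitrary: n)
  case 0
  have "\<psi> 0 = 0" using scale[of 0 0] subspace_0[OF subspace_W] by simp
  then show ?case by (intro bexI[of _ 0]) (auto simp: coeff_simps span_zero less_imp_le[OF \<kappa>])
next
  case (Suc K)
  have inW: "z \<in> W" if "z \<in> span (w ` {n..})" for z n using that span_tail_basis_span basis_span_subset_W by blast
  obtain z0 where z0: "z0 \<in> span (w ` {n..})" "e * norm z0 < \<bar>\<psi> z0\<bar>" using bad by blast
  have "\<bar>\<psi> z0\<bar> > 0" using z0(2) e by (smt (verit) mult_nonneg_nonneg norm_ge_zero)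
  moreover have "\<psi> 0 = 0" using scale[of 0 0] subspace_0[OF subspace_W] by simp
  ultimately have nz: "norm z0 > 0" by (cases "z0 = 0") auto
  define z where "z = (sgn (\<psi> z0) / norm z0) *\<^sub>R z0"
  have z: "z \<in> span (w ` {n..})" unfolding z_def by (intro span_scale z0)
  have "norm z = \<bar>sgn (\<psi> z0)\<bar>" unfolding z_def using nz by simp
  then have nz1: "norm z \<le> 1" by (simp add: sgn_if)
  have "\<psi> z = \<bar>\<psi> z0\<bar> / norm z0"
    unfolding z_def scale[OF inW[OF z0(1)]] by (simp add: sgn_if)
  then have pz: "e \<le> \<psi> z" using z0(2) nz by (simp add: pos_le_divide_eq)
  obtain m where m: "\<And>i. i \<ge> m \<Longrightarrow> coeff i z = 0" using basis_span_support[OF subsetD[OF span_tail_basis_span z]] by blast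
  \<comment> \<open>The next vectors start beyond the support of the first one.\<close>
  obtain u where u: "u \<in> span (w ` {max n m..})" "norm u \<le> real K" "real K * e \<le> \<psi> u" "\<And>i. \<bar>coeff i u\<bar> \<le> \<kappa> i"
    using Suc.IH[of "max n m"] by blast
  have un: "u \<in> span (w ` {n..})" using u(1) by (rule subsetD[OF span_mono, rotated]) auto
  show ?case
  proof (intro bexI conjI allI)
    show "z + u \<in> span (w ` {n..})" by (intro span_add z un)
    show "norm (z + u) \<le> real (Suc K)" using norm_triangle_ineq[of z u] nz1 u(2) by simp
    show "real (Suc K) * e \<le> \<psi> (z + u)" using add[OF inW[OF z] inW[OF un]] pz u(3) by (simp add: algebra_simps)
    fix i
    have "\<kappa> i * norm z \<le> \<kappa> i * 1" by (rule mult_left_mono[OF nz1]) (rule less_imp_le[OF \<kappa>])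
    then have "\<bar>coeff i z\<bar> \<le> \<kappa> i" using coeff_le[of i z] by linarith
    then show "\<bar>coeff i (z + u)\<bar> \<le> \<kappa> i"
      using u(4)[of i] m[of i] coeff_span_tail[OF u(1), of i] by (cases "i < max n m"; cases "i < m") (auto simp: coeff_simps)
  qed
qed

text \<open>
  For each functional \<open>f\<close> of the original dual ball, the values of \<open>f\<close> at the normalised pattern vectors
  of \<open>y j\<close> tend to 0 uniformly in the pattern, by \<open>far\<close>. The support functions of the sets \<open>Z j\<close> of all these vectors
  are convex in \<open>y j\<close>, so smallness of their averages bounds the pattern vectors of a convex combination.
\<close>

lemma small_far_combination:
  fixes y :: "nat \<Rightarrow> linfty"
  assumes y: "\<And>j. y j \<in> span (w ` {j..})" and y1: "\<And>j. norm (y j) \<le> 1" and e: "e > 0"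
  shows "\<exists>m \<alpha>. convex_weights 0 m \<alpha> \<and>
    (\<forall>L s. norm (pattern_vector L s (\<Sum>j=0..<m. \<alpha> j *\<^sub>R y j)) \<le> e * (D ^ length L * \<gamma> s))"
proof -
  have yf: "y j \<in> basis_span" for j using y span_tail_basis_span by blast
  define Z where "Z j = (\<lambda>(t, L, s). (t / (D ^ length L * \<gamma> s)) *\<^sub>R pattern_vector L s (y j)) ` ({-1, 1 :: real} \<times> UNIV \<times> UNIV)" for j
  have bd: "norm z \<le> 1" if zj: "z \<in> Z j" for z j
  proof -
    obtain t L s where t: "t \<in> {-1, 1 :: real}" "z = (t / (D ^ length L * \<gamma> s)) *\<^sub>R pattern_vector L s (y j)"
      using zj unfolding Z_def by auto
    have "norm z = norm (pattern_vector L s (y j)) / (D ^ length L * \<gamma> s)"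
      using t weight_pos[of L s] by auto
    also have "\<dots> \<le> norm (y j)" using norm_pattern_vector_le[OF yf, of L s j] weight_pos[of L s]
      by (simp add: pos_divide_le_eq mult.commute)
    finally show ?thesis using y1[of j] by simp
  qed
  have "\<exists>m \<alpha>. convex_weights 0 m \<alpha> \<and> (\<forall>f\<in>dual_ball. (\<Sum>j=0..<m. \<alpha> j * (SUP z\<in>Z j. f z)) \<le> 0 + e)"
  proof (rule convex_combination_of_support_functions[where M = 1])
    show "norm z \<le> 1" if "z \<in> Z j" for z j using that by (rule bd)
    show "Z j \<noteq> {}" for j unfolding Z_def by auto
    show "\<exists>B. finite B \<and> Z j \<subseteq> span B" for j
    proof -
      obtain m where m: "\<And>i. i \<ge> m \<Longrightarrow> coeff i (y j) = 0" using basis_span_support[OF yf[of j]] by blast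
      have "pattern_vector L s (y j) \<in> span (v ` {..<m})" for L s
        unfolding pattern_vector_def
      proof (intro span_sum)
        show "coeff i (y j) *\<^sub>R v i \<in> span (v ` {..<m})" for i
          using m[of i] by (cases "i < m") (auto intro: span_scale span_base span_zero)
      qed
      then show ?thesis unfolding Z_def by (intro exI[of _ "v ` {..<m}"]) (auto intro: span_scale)
    qed
    show "\<exists>n. \<forall>j\<ge>n. \<forall>z\<in>Z j. f z \<le> 0 + e'" if f: "f \<in> dual_ball" and e': "e' > 0" for f e'
    proof -
      obtain n where n: "\<And>z. z \<in> span (v ` {n..}) \<Longrightarrow> \<bar>f z\<bar> \<le> e' * norm z" using far[OF f e'] by blast
      have "f z \<le> e'" if j: "j \<ge> n" and z: "z \<in> Z j" for j z
      proof -
        have "coeff i (y j) *\<^sub>R v i \<in> span (v ` {n..})" for i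
        proof (cases "i < j")
          case True
          then show ?thesis using coeff_span_tail[OF y] by (simp add: span_zero)
        next
          case False
          then have "v i \<in> v ` {n..}" using j by auto
          then show ?thesis by (intro span_scale span_base)
        qed
        then have "pattern_vector L s (y j) \<in> span (v ` {n..})" for L s unfolding pattern_vector_def by (intro span_sum)
        then have "z \<in> span (v ` {n..})" using z unfolding Z_def by (auto intro: span_scale)
        then have "\<bar>f z\<bar> \<le> e' * norm z" by (rule n)
        also have "\<dots> \<le> e'" using bd[OF z] e' mult_left_mono[of "norm z" 1 e'] by simp
        finally show ?thesis by simp
      qed
      then show ?thesis by auto
    qed
  qed (rule e)
  then obtain m \<alpha> where \<alpha>: "convex_weights 0 m \<alpha>"
    and le: "\<And>f. f \<in> dual_ball \<Longrightarrow> (\<Sum>j=0..<m. \<alpha> j * (SUP z\<in>Z j. f z)) \<le> e" by auto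
  have "norm (pattern_vector L s (\<Sum>j=0..<m. \<alpha> j *\<^sub>R y j)) \<le> e * (D ^ length L * \<gamma> s)" for L s
  proof -
    let ?r = "D ^ length L * \<gamma> s"
    let ?p = "pattern_vector L s (\<Sum>j=0..<m. \<alpha> j *\<^sub>R y j)"
    obtain f where f: "f \<in> dual_ball" "f ?p = norm ?p" using norming_functional by blast
    have lin: "linear f" and fle: "\<And>x. \<bar>f x\<bar> \<le> norm x" using f(1) by (auto simp: dual_ball_def)
    have "norm ?p = (\<Sum>j=0..<m. \<alpha> j * f (pattern_vector L s (y j)))"
      using f(2) by (simp add: linear_sum[OF pattern_vector_linear] linear_cmul[OF pattern_vector_linear] linear_sum[OF lin] linear_cmul[OF lin])
    also have "\<dots> \<le> (\<Sum>j=0..<m. \<alpha> j * ((SUP z\<in>Z j. f z) * ?r))"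
    proof (rule sum_mono, rule mult_left_mono)
      fix j
      have "f ((1 / ?r) *\<^sub>R pattern_vector L s (y j)) \<le> (SUP z\<in>Z j. f z)"
      proof (rule cSUP_upper)
        show "(1 / ?r) *\<^sub>R pattern_vector L s (y j) \<in> Z j" unfolding Z_def by (rule image_eqI[of _ _ "(1, L, s)"]) auto
        show "bdd_above (f ` Z j)"
          by (rule bdd_aboveI2[of _ _ 1]) (use fle bd in \<open>meson abs_le_D1 order_trans\<close>)
      qed
      then show "f (pattern_vector L s (y j)) \<le> (SUP z\<in>Z j. f z) * ?r"
        using weight_pos[of L s] by (simp add: linear_cmul[OF lin] pos_divide_le_eq)
      show "0 \<le> \<alpha> j" using \<alpha> by (simp add: convex_weights_def)
    qed
    also have "\<dots> = (\<Sum>j=0..<m. \<alpha> j * (SUP z\<in>Z j. f z)) * ?r" by (simp add: sum_distrib_right mult.assoc)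
    also have "\<dots> \<le> e * ?r" using le[OF f(1)] weight_pos[of L s] by (intro mult_right_mono) auto
    finally show ?thesis .
  qed
  then show ?thesis using \<alpha> by blast
qed

text \<open>
  Otherwise the averaged vectors of \<open>spread_out_vectors\<close> exist arbitrarily far out. All their convex combinations have small
  coefficients and values at least \<open>e\<close> under \<open>\<psi>\<close>, and by \<open>small_far_combination\<close> one of them also has small pattern vectors,
  hence small norm.
\<close>

lemma functional_small_on_tails:
  assumes \<psi>: "bounded_functional_on W \<psi>" and e: "e > 0"
  shows "\<exists>n. \<forall>z\<in>span (w ` {n..}). \<bar>\<psi> z\<bar> \<le> e * norm z"
proof (rule ccontr)
  assume "\<not> ?thesis"
  then have bad: "\<exists>z\<in>span (w ` {n..}). e * norm z < \<bar>\<psi> z\<bar>" for n by (force simp: not_le)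
  have add: "\<psi> (x + y) = \<psi> x + \<psi> y" if "x \<in> W" "y \<in> W" for x y
    using \<psi> that unfolding bounded_functional_on_def by blast
  have scale: "\<psi> (c *\<^sub>R x) = c * \<psi> x" if "x \<in> W" for c x
    using \<psi> that unfolding bounded_functional_on_def by blast
  obtain M0 where M0: "\<And>x. x \<in> W \<Longrightarrow> \<bar>\<psi> x\<bar> \<le> M0 * norm x" using \<psi> unfolding bounded_functional_on_def by blast
  define M where "M = \<bar>M0\<bar> + 1"
  have M: "M > 0" "\<And>x. x \<in> W \<Longrightarrow> \<bar>\<psi> x\<bar> \<le> M * norm x"
  proof -
    show "\<bar>\<psi> x\<bar> \<le> M * norm x" if "x \<in> W" for x
    proof -
      have "M0 * norm x \<le> M * norm x" by (rule mult_right_mono) (auto simp: M_def)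
      then show ?thesis using M0[OF that] by linarith
    qed
  qed (simp add: M_def)
  obtain K :: nat where K: "K > 0" "1 / real K < e / (2 * M)"
    using reals_Archimedean[of "e / (2 * M)"] e M by (auto simp: inverse_eq_divide intro: that[of "Suc _"])
  have "\<exists>u. u \<in> span (w ` {n..}) \<and> norm u \<le> 1 \<and> e \<le> \<psi> u \<and> (\<forall>i. \<bar>coeff i u\<bar> \<le> \<kappa> i / K)" for n
  proof -
    obtain u where u: "u \<in> span (w ` {n..})" "norm u \<le> real K" "real K * e \<le> \<psi> u" "\<And>i. \<bar>coeff i u\<bar> \<le> \<kappa> i"
      using spread_out_vectors[OF add scale bad e, of n K] by blast
    have uW: "u \<in> W" using u(1) span_tail_basis_span basis_span_subset_W by blast
    show ?thesis
    proof (intro exI[of _ "(1 / real K) *\<^sub>R u"] conjI allI)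
      show "(1 / real K) *\<^sub>R u \<in> span (w ` {n..})" by (intro span_scale u)
      show "norm ((1 / real K) *\<^sub>R u) \<le> 1" using u(2) K(1) by simp
      show "e \<le> \<psi> ((1 / real K) *\<^sub>R u)" using u(3) K(1) by (simp add: scale[OF uW] field_simps)
      show "\<bar>coeff i ((1 / real K) *\<^sub>R u)\<bar> \<le> \<kappa> i / real K" for i
        using u(4)[of i] by (simp add: linear_cmul[OF coeff_linear] divide_right_mono)
    qed
  qed
  then obtain y where y: "\<And>n. y n \<in> span (w ` {n..})" "\<And>n. norm (y n) \<le> 1" "\<And>n. e \<le> \<psi> (y n)"
      "\<And>n i. \<bar>coeff i (y n)\<bar> \<le> \<kappa> i / K" by metis
  have "e / (2 * M) > 0" using e M by simp
  from small_far_combination[OF y(1,2) this] obtain m \<alpha> where \<alpha>: "convex_weights 0 m \<alpha>"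
    and pattern_vector: "\<And>L s. norm (pattern_vector L s (\<Sum>j=0..<m. \<alpha> j *\<^sub>R y j)) \<le> e / (2 * M) * (D ^ length L * \<gamma> s)" by blast
  define u where "u = (\<Sum>j=0..<m. \<alpha> j *\<^sub>R y j)"
  have yf: "y j \<in> basis_span" for j using y(1) span_tail_basis_span by blast
  have uf: "u \<in> basis_span" unfolding u_def by (intro subspace_sum subspace_scale subspace_basis_span yf)
  have "norm u \<le> e / (2 * M)"
  proof (rule norm_basis_span_le[OF uf])
    show "norm (pattern_vector L s u) \<le> e / (2 * M) * (D ^ length L * \<gamma> s)" for L s unfolding u_def by (rule pattern_vector)
    fix i
    have "\<bar>coeff i u\<bar> \<le> (\<Sum>j=0..<m. \<alpha> j * \<bar>coeff i (y j)\<bar>)"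
      unfolding u_def using \<alpha> by (simp add: coeff_simps convex_weights_def order_trans[OF sum_abs] abs_mult)
    also have "\<dots> \<le> \<kappa> i / K" by (rule convex_weights_le[OF \<alpha>]) (rule y(4))
    also have "\<dots> = 1 / K * \<kappa> i" by simp
    also have "\<dots> \<le> e / (2 * M) * \<kappa> i" using K(2) \<kappa>[of i] by (intro mult_right_mono) auto
    finally show "\<bar>coeff i u\<bar> \<le> e / (2 * M) * \<kappa> i" .
  qed
  then have "M * norm u \<le> e / 2" using M(1) by (simp add: field_simps)
  then have "\<psi> u \<le> e / 2" using M(2)[of u] uf basis_span_subset_W by (force simp: abs_le_iff)
  moreover have "\<psi> u = (\<Sum>j=0..<m. \<alpha> j * \<psi> (y j))"
  proof -
    have "(\<Sum>j\<in>J. \<alpha> j *\<^sub>R y j) \<in> W \<and> \<psi> (\<Sum>j\<in>J. \<alpha> j *\<^sub>R y j) = (\<Sum>j\<in>J. \<alpha> j * \<psi> (y j))" if "finite J" for J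
      using that
    proof induction
      case empty
      then show ?case using scale[of 0 0] subspace_0[OF subspace_W] by simp
    next
      case (insert j J)
      have yW: "y j \<in> W" using yf basis_span_subset_W by blast
      then have "\<alpha> j *\<^sub>R y j \<in> W" by (intro subspace_scale subspace_W)
      then show ?case using insert add scale[OF yW] subspace_add[OF subspace_W] by simp
    qed
    then show ?thesis unfolding u_def by simp
  qed
  moreover have "(\<Sum>j=0..<m. \<alpha> j * \<psi> (y j)) \<ge> e"
    using convex_weights_le[OF \<alpha>, of "\<lambda>j. - \<psi> (y j)" "- e"] y(3) by (simp add: sum_negf)
  ultimately show False using e by simp
qed

lemma shrinking_W: "FDD_shrinking W (basis_FDD w)"
  unfolding FDD_shrinking_def
proof (intro allI impI)
  fix \<psi> :: "linfty \<Rightarrow> real" assume \<psi>: "bounded_functional_on W \<psi>"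
  let ?Z = "\<lambda>n. closure (span (\<Union>k\<in>{n..}. basis_FDD w k))"
  have tail: "?Z n \<subseteq> closure (span (w ` {n..}))" for n
  proof (intro closure_mono span_minimal UN_least)
    show "basis_FDD w k \<subseteq> span (w ` {n..})" if "k \<in> {n..}" for k
      unfolding basis_FDD_def using that by (intro span_mono) auto
  qed simp
  obtain M where M: "\<And>x. x \<in> W \<Longrightarrow> \<bar>\<psi> x\<bar> \<le> M * norm x" using \<psi> unfolding bounded_functional_on_def by blast
  have add: "\<psi> (x + y) = \<psi> x + \<psi> y" if "x \<in> W" "y \<in> W" for x y
    using \<psi> that unfolding bounded_functional_on_def by blast
  show "(\<lambda>n. opnorm_on (?Z n) \<psi>) \<longlonglongrightarrow> 0"
  proof (rule order_tendstoI)
    fix a :: ereal assume "a < 0"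
    have "0 \<in> ?Z n" for n by (rule subsetD[OF closure_subset]) (rule span_zero)
    then have "0 \<le> opnorm_on (?Z n) \<psi>" for n
      unfolding opnorm_on_def by (intro SUP_upper2[of 0]) auto
    then show "\<forall>\<^sub>F n in sequentially. a < opnorm_on (?Z n) \<psi>" using \<open>a < 0\<close>
      by (intro always_eventually allI) (rule less_le_trans)
  next
    fix a :: ereal assume "0 < a"
    then obtain e where e: "0 < ereal e" "ereal e < a" using ereal_dense2 by blast
    then have "e > 0" by simp
    then obtain N where N: "\<And>z. z \<in> span (w ` {N..}) \<Longrightarrow> \<bar>\<psi> z\<bar> \<le> e * norm z"
      using functional_small_on_tails[OF \<psi>] by blast
    have NW: "closure (span (w ` {N..})) \<subseteq> W" unfolding W_def by (intro closure_mono span_tail_basis_span)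
    have cl: "\<bar>\<psi> z\<bar> \<le> e * norm z" if z: "z \<in> closure (span (w ` {N..}))" for z
    proof -
      obtain x where x: "\<And>n. x n \<in> span (w ` {N..})" "x \<longlonglongrightarrow> z" using z unfolding closure_sequential by blast
      have zW: "z \<in> W" using z NW by blast
      have xW: "x n \<in> W" for n using x(1) NW closure_subset by blast
      have le: "\<bar>\<psi> z\<bar> \<le> e * norm (x n) + M * norm (z - x n)" for n
      proof -
        have d: "z - x n \<in> W" by (rule subspace_diff[OF subspace_W zW xW])
        have "\<psi> z = \<psi> (x n) + \<psi> (z - x n)" using add[OF xW d, of n] by simp
        then show ?thesis using N[OF x(1), of n] M[OF d] by linarith
      qed
      have "(\<lambda>n. e * norm (x n) + M * norm (z - x n)) \<longlonglongrightarrow> e * norm z + M * norm (z - z)"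
        by (intro tendsto_intros x(2))
      then show ?thesis using le by (intro LIMSEQ_le_const[of _ "e * norm z"]) auto
    qed
    have "opnorm_on (?Z n) \<psi> < a" if "n \<ge> N" for n
    proof -
      have "?Z n \<subseteq> closure (span (w ` {N..}))"
        using tail[of n] closure_mono[OF span_mono[of "w ` {n..}" "w ` {N..}"]] that by fastforce
      then have "opnorm_on (?Z n) \<psi> \<le> ereal e"
        using cl \<open>e > 0\<close> by (intro opnorm_on_le) auto
      then show ?thesis using e(2) by (rule le_less_trans)
    qed
    then show "\<forall>\<^sub>F n in sequentially. opnorm_on (?Z n) \<psi> < a" by (auto simp: eventually_sequentially)
  qed
qed

theorem embeds_in_space_with_basis:
  "subspace W \<and> closed W \<and> is_Schauder_basis W w \<and> FDD_shrinking W (basis_FDD w) \<and>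
   FDD_monotone (\<gamma>\<^sub>0 + \<eta>) W (basis_FDD w) \<and>
   strong_bimonotonicity_constant W (basis_FDD w) \<le> ereal (D + 2 * \<eta>) \<and>
   linear T \<and> (\<forall>x. norm (T x) = norm x) \<and> range T \<subseteq> W"
  using subspace_W Schauder_basis_W shrinking_W monotone_W bimonotone_W T_linear norm_T range_T
  by (auto simp: W_def)

end

section \<open>Enumerating slices\<close>

text \<open>
  Numbering of the disjoint union of blocks of sizes \<open>d 0, d 1, \<dots>\<close>: the block \<open>s\<close> begins at \<open>start d s\<close>, and \<open>slice d i\<close>
  is the block that contains \<open>i\<close>. This is used for the interpolation steps between averages and
  again for the rank one pieces of each step.
\<close>

definition start :: "(nat \<Rightarrow> nat) \<Rightarrow> nat \<Rightarrow> nat" where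
  "start d s = sum d {..<s}"

definition slice :: "(nat \<Rightarrow> nat) \<Rightarrow> nat \<Rightarrow> nat" where
  "slice d i = (LEAST s. i < start d (Suc s))"

lemma start_Suc: "start d (Suc s) = start d s + d s" and start_0 [simp]: "start d 0 = 0"
  by (simp_all add: start_def)

context
  fixes d :: "nat \<Rightarrow> nat"
  assumes d: "\<And>s. 1 \<le> d s"
begin

lemma start_strict_mono: "strict_mono (start d)"
  by (rule strict_mono_Suc_iff[THEN iffD2]) (use d in \<open>auto simp: start_Suc Suc_le_eq\<close>)

lemma slice_less_iff: "slice d i < s \<longleftrightarrow> i < start d s"
proof -
  have ex: "i < start d (Suc i)" using strict_mono_imp_increasing[OF start_strict_mono, of "Suc i"] by simp
  have 1: "i < start d (Suc (slice d i))" unfolding slice_def by (rule LeastI[of _ i]) (rule ex)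
  show ?thesis
  proof
    assume "slice d i < s"
    then have "start d (Suc (slice d i)) \<le> start d s"
      using strict_mono_less_eq[OF start_strict_mono] by simp
    then show "i < start d s" using 1 by simp
  next
    assume i: "i < start d s"
    then obtain t where t: "s = Suc t" by (cases s) auto
    have "slice d i \<le> t" unfolding slice_def by (rule Least_le) (use i t in simp)
    then show "slice d i < s" using t by simp
  qed
qed

lemma slice_eq_iff: "slice d i = s \<longleftrightarrow> start d s \<le> i \<and> i < start d (Suc s)"
  using slice_less_iff[of i s] slice_less_iff[of i "Suc s"] by auto

lemma slice_mono: "mono (slice d)"
proof (rule monoI)
  fix i j :: nat assume "i \<le> j"
  then show "slice d i \<le> slice d j"
    using slice_less_iff[of i "Suc (slice d j)"] slice_less_iff[of j "Suc (slice d j)"] by simp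
qed

lemma slice_le: "slice d i \<le> i"
  using slice_less_iff[of i "Suc i"] strict_mono_imp_increasing[OF start_strict_mono, of "Suc i"] by simp

lemma slice_at_top: "\<exists>i0. \<forall>i\<ge>i0. s \<le> slice d i"
  using slice_less_iff[of _ s] by (metis not_le)

lemma sum_slice: "(\<Sum>i | slice d i = s. g (i - start d s)) = (\<Sum>j<d s. g j)"
proof -
  have "{i. slice d i = s} = {0 + start d s..<d s + start d s}"
    by (auto simp: slice_eq_iff start_Suc)
  then show ?thesis by (simp only: sum.shift_bounds_nat_ivl lessThan_atLeast0) simp
qed

lemma slice_pos: "i - start d (slice d i) < d (slice d i)"
  using iffD1[OF slice_eq_iff refl, of i] start_Suc[of d "slice d i"] by linarith

end

section \<open>Random thresholds\<close>

lemma has_integral_below: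
  assumes "0 \<le> (r::real)" "r \<le> 1"
  shows "((\<lambda>\<theta>. if \<theta> < r then 1 else 0 :: real) has_integral r) {0..1}"
proof -
  have "((\<lambda>\<theta>::real. 1::real) has_integral r) {0..r}"
    using has_integral_const_real[of "1::real" 0 r] assms by simp
  then have "((\<lambda>\<theta>. if \<theta> \<in> {0..r} then 1 else 0 :: real) has_integral r) {0..1}"
    using has_integral_restrict[of "{0..r}" "{0..1}" "\<lambda>_. 1::real"] assms by auto
  then show ?thesis
    by (rule has_integral_spike[of "{r}", rotated 2]) auto
qed

text \<open>
  For weights \<open>\<alpha>\<close> on thresholds \<open>m < K\<close> this is the probability that a random threshold exceeds \<open>k\<close>, that is, the
  multiplier of the \<open>k\<close>-th component in the average of the projections onto the components before the
  threshold.
\<close>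

definition upper_sum :: "nat \<Rightarrow> (nat \<Rightarrow> real) \<Rightarrow> nat \<Rightarrow> real" where
  "upper_sum K \<alpha> k = sum \<alpha> {Suc k..<K}"

text \<open>
  The level set of \<open>upper_sum\<close> at height \<open>\<theta>\<close> is an initial segment, and this is its length. For \<open>\<theta>\<close> uniform in
  the unit interval it is distributed according to \<open>\<alpha>\<close> (\<open>integral_threshold\<close>), and it depends monotonically on the weights
  (\<open>threshold_mono\<close>): all thresholds are coupled on one probability space.
\<close>

definition threshold :: "nat \<Rightarrow> (nat \<Rightarrow> real) \<Rightarrow> real \<Rightarrow> nat" where
  "threshold K \<alpha> \<theta> = card {k. k < K \<and> \<theta> < upper_sum K \<alpha> k}"

lemma less_threshold_iff:
  assumes "\<And>k. 0 \<le> \<alpha> k" "k < K"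
  shows "k < threshold K \<alpha> \<theta> \<longleftrightarrow> \<theta> < upper_sum K \<alpha> k"
proof -
  let ?A = "{k. k < K \<and> \<theta> < upper_sum K \<alpha> k}"
  have anti: "upper_sum K \<alpha> j \<le> upper_sum K \<alpha> i" if "i \<le> j" for i j
    unfolding upper_sum_def by (rule sum_mono2) (use that assms(1) in auto)
  have down: "i \<in> ?A" if "j \<in> ?A" "i \<le> j" for i j using that anti[of i j] by auto
  have fin: "finite ?A" by simp
  have "?A = {..<card ?A}"
  proof (rule card_subset_eq[symmetric, OF fin])
    show "{..<card ?A} \<subseteq> ?A"
    proof
      fix i assume i: "i \<in> {..<card ?A}"
      show "i \<in> ?A"
      proof (rule ccontr)
        assume "i \<notin> ?A"
        then have "?A \<subseteq> {..<i}" using down by (meson lessThan_iff not_le subsetI)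
        then have "card ?A \<le> i" using card_mono[of "{..<i}" ?A] by simp
        then show False using i by simp
      qed
    qed
  qed simp
  then have "k < card ?A \<longleftrightarrow> k \<in> ?A" by blast
  then show ?thesis unfolding threshold_def using assms(2) by simp
qed

lemma threshold_le: "threshold K \<alpha> \<theta> \<le> K"
proof -
  have "card {k. k < K \<and> \<theta> < upper_sum K \<alpha> k} \<le> card {..<K}" by (rule card_mono) auto
  then show ?thesis unfolding threshold_def by simp
qed

lemma threshold_mono:
  assumes "\<And>k. k < K \<Longrightarrow> upper_sum K \<alpha> k \<le> upper_sum K \<beta> k"
  shows "threshold K \<alpha> \<theta> \<le> threshold K \<beta> \<theta>"
  unfolding threshold_def by (rule card_mono) (use assms in \<open>auto intro: less_le_trans\<close>)

text \<open>
  Telescoping of \<open>g\<close> up to the threshold turns the integral into a sum of probabilities that the threshold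
  exceeds \<open>k\<close>; summation by parts turns these into the weights.
\<close>

lemma integral_threshold:
  fixes g :: "nat \<Rightarrow> real"
  assumes pos: "\<And>k. 0 \<le> \<alpha> k" and one: "sum \<alpha> {..<K} = 1"
  shows "((\<lambda>\<theta>. g (threshold K \<alpha> \<theta>)) has_integral (\<Sum>m<K. \<alpha> m * g m)) {0..1}"
proof -
  have r: "0 \<le> upper_sum K \<alpha> k" "upper_sum K \<alpha> k \<le> 1" for k
  proof -
    show "0 \<le> upper_sum K \<alpha> k" unfolding upper_sum_def by (intro sum_nonneg pos)
    have "upper_sum K \<alpha> k \<le> sum \<alpha> {..<K}" unfolding upper_sum_def by (rule sum_mono2) (use pos in auto)
    then show "upper_sum K \<alpha> k \<le> 1" using one by simp
  qed
  have "((\<lambda>\<theta>. g 0 + (\<Sum>k<K. (g (Suc k) - g k) * (if \<theta> < upper_sum K \<alpha> k then 1 else 0)))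
      has_integral (g 0 + (\<Sum>k<K. (g (Suc k) - g k) * upper_sum K \<alpha> k))) {0..1}"
    by (intro has_integral_add has_integral_sum has_integral_mult_right has_integral_below r)
      (use has_integral_const_real[of "g 0" 0 1] in auto)
  moreover have "g 0 + (\<Sum>k<K. (g (Suc k) - g k) * (if \<theta> < upper_sum K \<alpha> k then 1 else 0)) = g (threshold K \<alpha> \<theta>)" for \<theta>
  proof -
    have "(\<Sum>k<K. (g (Suc k) - g k) * (if \<theta> < upper_sum K \<alpha> k then 1 else 0)) = (\<Sum>k<threshold K \<alpha> \<theta>. g (Suc k) - g k)"
    proof (rule sum.mono_neutral_cong_right)
      have iff: "k < threshold K \<alpha> \<theta> \<longleftrightarrow> k < K \<and> \<theta> < upper_sum K \<alpha> k" for k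
        using less_threshold_iff[of \<alpha> k K \<theta>, OF pos] threshold_le[of K \<alpha> \<theta>] by fastforce
      show "{..<threshold K \<alpha> \<theta>} \<subseteq> {..<K}" by (simp add: threshold_le)
      show "\<forall>k\<in>{..<K} - {..<threshold K \<alpha> \<theta>}. (g (Suc k) - g k) * (if \<theta> < upper_sum K \<alpha> k then 1 else 0) = 0"
      proof
        fix k assume "k \<in> {..<K} - {..<threshold K \<alpha> \<theta>}"
        then have "k < K" "\<not> k < threshold K \<alpha> \<theta>" by auto
        then have "\<not> \<theta> < upper_sum K \<alpha> k" using iff[of k] by blast
        then show "(g (Suc k) - g k) * (if \<theta> < upper_sum K \<alpha> k then 1 else 0) = 0" by simp
      qed
      show "(g (Suc k) - g k) * (if \<theta> < upper_sum K \<alpha> k then 1 else 0) = g (Suc k) - g k"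
        if "k \<in> {..<threshold K \<alpha> \<theta>}" for k using that by (simp add: iff)
    qed simp
    then show ?thesis by (simp add: sum_lessThan_telescope)
  qed
  moreover have "g 0 + (\<Sum>k<K. (g (Suc k) - g k) * upper_sum K \<alpha> k) = (\<Sum>m<K. \<alpha> m * g m)"
  proof -
    have "(\<Sum>k<K. (g (Suc k) - g k) * upper_sum K \<alpha> k) = (\<Sum>k<K. \<Sum>m<K. if k < m then (g (Suc k) - g k) * \<alpha> m else 0)"
    proof (rule sum.cong[OF refl])
      fix k
      have "(\<Sum>m<K. if k < m then (g (Suc k) - g k) * \<alpha> m else 0) = (\<Sum>m=Suc k..<K. (g (Suc k) - g k) * \<alpha> m)"
        by (rule sum.mono_neutral_cong_right) auto
      then show "(g (Suc k) - g k) * upper_sum K \<alpha> k = (\<Sum>m<K. if k < m then (g (Suc k) - g k) * \<alpha> m else 0)"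
        by (simp add: upper_sum_def sum_distrib_left)
    qed
    also have "\<dots> = (\<Sum>m<K. \<Sum>k<K. if k < m then (g (Suc k) - g k) * \<alpha> m else 0)" by (rule sum.swap)
    also have "\<dots> = (\<Sum>m<K. \<alpha> m * (g m - g 0))"
    proof (rule sum.cong[OF refl])
      fix m assume m: "m \<in> {..<K}"
      have "(\<Sum>k<K. if k < m then (g (Suc k) - g k) * \<alpha> m else 0) = (\<Sum>k<m. (g (Suc k) - g k) * \<alpha> m)"
        by (rule sum.mono_neutral_cong_right) (use m in auto)
      also have "\<dots> = (g m - g 0) * \<alpha> m" by (simp add: sum_lessThan_telescope flip: sum_distrib_right)
      finally show "(\<Sum>k<K. if k < m then (g (Suc k) - g k) * \<alpha> m else 0) = \<alpha> m * (g m - g 0)" by simp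
    qed
    also have "\<dots> = (\<Sum>m<K. \<alpha> m * g m) - g 0"
      using one by (simp add: right_diff_distrib sum_subtractf flip: sum_distrib_right)
    finally show ?thesis by simp
  qed
  ultimately show ?thesis by simp
qed

section \<open>Averages of the partial sum projections\<close>

text \<open>
  A shrinking decomposition in which all intervals, including those of length one, and their complements
  have constant \<open>D\<close>. An FDD acquires this property when consecutive components are paired.
\<close>

locale decomposition =
  fixes Q :: "nat \<Rightarrow> 'a::real_normed_vector \<Rightarrow> 'a" and D :: real
  assumes Q_linear: "\<And>k. linear (Q k)"
    and Q_Q: "\<And>j k x. Q j (Q k x) = (if j = k then Q k x else 0)"
    and Q_finite: "\<And>k. \<exists>B. finite B \<and> range (Q k) \<subseteq> span B"
    and D: "D \<ge> 1"
    and interval: "\<And>a b x. norm (\<Sum>k=a..<b. Q k x) \<le> D * norm x"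
    and cointerval: "\<And>a b x. norm (x - (\<Sum>k=a..<b. Q k x)) \<le> D * norm x"
    and Q_sums: "\<And>x. (\<lambda>k. Q k x) sums x"
    and Q_tail: "\<And>f e. f \<in> dual_ball \<Longrightarrow> e > 0 \<Longrightarrow>
      \<exists>n. \<forall>z. (\<forall>k<n. Q k z = 0) \<longrightarrow> \<bar>f z\<bar> \<le> e * norm z"
begin

definition P :: "nat \<Rightarrow> 'a \<Rightarrow> 'a" where "P n x = (\<Sum>k<n. Q k x)"

lemma P_linear: "linear (P n)"
  unfolding P_def by (intro linear_compose_sum ballI Q_linear)

lemma P_0 [simp]: "P 0 x = 0" by (simp add: P_def)

lemma P_le: "norm (P n x) \<le> D * norm x"
  using interval[where a = 0 and b = n and x = x] by (simp add: P_def lessThan_atLeast0)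

lemma P_diff:
  assumes "a \<le> b"
  shows "P b x - P a x = (\<Sum>k=a..<b. Q k x)"
proof -
  have "{..<b} = {..<a} \<union> {a..<b}" using assms by auto
  moreover have "{..<a} \<inter> {a..<b} = {}" by auto
  ultimately show ?thesis unfolding P_def by (simp add: sum.union_disjoint)
qed

lemma Q_sum: "finite B \<Longrightarrow> Q j (\<Sum>k\<in>B. Q k x) = (if j \<in> B then Q j x else 0)"
proof -
  assume B: "finite B"
  have "Q j (\<Sum>k\<in>B. Q k x) = (\<Sum>k\<in>B. if j = k then Q k x else 0)"
    by (simp add: linear_sum[OF Q_linear] Q_Q)
  then show ?thesis using B by simp
qed

lemma sum_Q_sum:
  assumes "finite A" "finite B"
  shows "(\<Sum>j\<in>A. Q j (\<Sum>k\<in>B. Q k x)) = (\<Sum>j\<in>A \<inter> B. Q j x)"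
  by (subst sum.inter_restrict[OF assms(1)]) (simp add: Q_sum[OF assms(2)])

text \<open>
  For sharp cuts at increasing places \<open>\<tau> t\<close> the sum over a pattern is a product: each block of the pattern is an
  interval projection or its complement, and the bound \<open>s\<close> is the projection \<open>P (\<tau> s)\<close>, which is applied last. The vector \<open>y\<close> does
  not depend on \<open>s\<close>, and the norm of \<open>P (\<tau> s)\<close> does not enter its bound.
\<close>

lemma pattern_projection:
  fixes \<tau> :: "nat \<Rightarrow> nat"
  assumes \<tau>: "mono \<tau>" "\<tau> 0 = 0"
  shows "\<exists>y. norm y \<le> D ^ length L * norm x \<and>
    (\<forall>s. (\<Sum>t\<in>{t. t < s \<and> t \<in> pattern_set L}. P (\<tau> (Suc t)) x - P (\<tau> t) x) = P (\<tau> s) y)"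
proof (induction L arbitrary: x)
  case Nil
  show ?case
  proof (intro exI[of _ x] conjI allI)
    fix s
    have "{t. t < s \<and> t \<in> pattern_set []} = {..<s}" by auto
    then show "(\<Sum>t\<in>{t. t < s \<and> t \<in> pattern_set []}. P (\<tau> (Suc t)) x - P (\<tau> t) x) = P (\<tau> s) x"
      using sum_lessThan_telescope[of "\<lambda>t. P (\<tau> t) x" s] \<tau>(2) by simp
  qed simp
next
  case (Cons I L)
  obtain b l h where I: "I = (b, l, h)" by (cases I) auto
  define J where "J = {\<tau> l..<\<tau> (max l h)}"
  define x' where "x' = (if b then (\<Sum>k\<in>J. Q k x) else x - (\<Sum>k\<in>J. Q k x))"
  have x': "norm x' \<le> D * norm x" unfolding x'_def J_def using interval cointerval by auto
  have inc: "\<tau> i \<le> \<tau> j" if "i \<le> j" for i j using monoD[OF \<tau>(1) that] .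
  have step: "P (\<tau> (Suc t)) x' - P (\<tau> t) x' = (if t \<in> block_set I then P (\<tau> (Suc t)) x - P (\<tau> t) x else 0)" for t
  proof -
    let ?H = "{\<tau> t..<\<tau> (Suc t)}"
    have d: "P (\<tau> (Suc t)) z - P (\<tau> t) z = (\<Sum>k\<in>?H. Q k z)" for z
      by (rule P_diff) (rule inc, simp)
    have HJ: "?H \<inter> J = (if l \<le> t \<and> t < h then ?H else {})"
    proof (cases "l \<le> t \<and> t < h")
      case True
      then have "\<tau> l \<le> \<tau> t" "\<tau> (Suc t) \<le> \<tau> (max l h)" by (auto intro!: inc)
      then show ?thesis using True unfolding J_def by auto
    next
      case False
      then have "\<tau> (Suc t) \<le> \<tau> l \<or> \<tau> (max l h) \<le> \<tau> t" using inc[of "Suc t" l] inc[of "max l h" t] by fastforce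
      then show ?thesis using False unfolding J_def by auto
    qed
    have "(\<Sum>k\<in>?H. Q k (\<Sum>k\<in>J. Q k x)) = (if l \<le> t \<and> t < h then \<Sum>k\<in>?H. Q k x else 0)"
      using sum_Q_sum[of ?H J x] unfolding HJ by (simp add: J_def)
    then show ?thesis unfolding d x'_def I
      by (auto simp: linear_diff[OF Q_linear] sum_subtractf)
  qed
  obtain y where y: "norm y \<le> D ^ length L * norm x'"
    "\<And>s. (\<Sum>t\<in>{t. t < s \<and> t \<in> pattern_set L}. P (\<tau> (Suc t)) x' - P (\<tau> t) x') = P (\<tau> s) y"
    using Cons.IH[of x'] by blast
  show ?case
  proof (intro exI[of _ y] conjI allI)
    have "norm y \<le> D ^ length L * (D * norm x)" using y(1) x' D by (meson mult_left_mono order_trans zero_le_power zero_le_one)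
    then show "norm y \<le> D ^ length (I # L) * norm x" by (simp add: mult_ac)
    fix s
    have "(\<Sum>t\<in>{t. t < s \<and> t \<in> pattern_set (I # L)}. P (\<tau> (Suc t)) x - P (\<tau> t) x) =
        (\<Sum>t\<in>{t. t < s \<and> t \<in> pattern_set L}. P (\<tau> (Suc t)) x' - P (\<tau> t) x')"
      unfolding step by (rule sum.mono_neutral_cong_left) auto
    then show "(\<Sum>t\<in>{t. t < s \<and> t \<in> pattern_set (I # L)}. P (\<tau> (Suc t)) x - P (\<tau> t) x) = P (\<tau> s) y"
      using y(2) by simp
  qed
qed

text \<open>
  For linear \<open>f\<close>, the norm of the functional \<open>f \<circ> P n\<close>.
\<close>

definition adjoint_norm :: "('a \<Rightarrow> real) \<Rightarrow> nat \<Rightarrow> real" where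
  "adjoint_norm f n = (SUP z\<in>P n ` cball 0 1. f z)"

lemma adjoint_norm_bound:
  assumes f: "f \<in> dual_ball"
  shows "f (P n x) \<le> adjoint_norm f n * norm x"
proof (cases "x = 0")
  case True
  then show ?thesis using f linear_0[OF P_linear] by (simp add: dual_ball_def linear_0)
next
  case False
  have lin: "linear f" and fle: "\<And>z. \<bar>f z\<bar> \<le> norm z" using f by (auto simp: dual_ball_def)
  have "f (P n ((1 / norm x) *\<^sub>R x)) \<le> adjoint_norm f n"
    unfolding adjoint_norm_def
  proof (rule cSUP_upper)
    show "P n ((1 / norm x) *\<^sub>R x) \<in> P n ` cball 0 1" using False by (intro imageI) auto
    have "f z \<le> D" if z: "z \<in> P n ` cball 0 1" for z
    proof -
      obtain x where x: "z = P n x" "norm x \<le> 1" using z by auto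
      have "f z \<le> norm z" using fle[of z] by simp
      also have "\<dots> \<le> D * norm x" using P_le x(1) by simp
      also have "\<dots> \<le> D * 1" using x(2) D by (intro mult_left_mono) auto
      finally show ?thesis by simp
    qed
    then show "bdd_above (f ` P n ` cball 0 1)" by (intro bdd_aboveI2)
  qed
  then show ?thesis using False by (simp add: linear_cmul[OF P_linear] linear_cmul[OF lin] pos_divide_le_eq)
qed

lemma adjoint_norm_nonneg:
  fixes x :: 'a
  assumes f: "f \<in> dual_ball" and x: "x \<noteq> 0"
  shows "0 \<le> adjoint_norm f n"
proof -
  have "f (P n (- x)) = - f (P n x)" using f linear_neg[OF P_linear] by (simp add: dual_ball_def linear_neg)
  then have "0 \<le> 2 * (adjoint_norm f n * norm x)" using adjoint_norm_bound[OF f, of n x] adjoint_norm_bound[OF f, of n "- x"] by simp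
  then show ?thesis using x by (simp add: zero_le_mult_iff)
qed

text \<open>
  Since the decomposition is shrinking, \<open>f \<circ> P n\<close> converges to \<open>f\<close> in norm, so its norm is eventually at
  most \<open>1 + e\<close>. That the averages of these norms are bounded, and not only the norms of the averages, is
  essential, because the threshold of the last cut is correlated with the other cuts of a pattern.
\<close>

lemma averaging_weights:
  assumes e: "e > 0"
  shows "\<exists>m \<alpha>. convex_weights n m \<alpha> \<and> (\<forall>f\<in>dual_ball. (\<Sum>j=n..<m. \<alpha> j * adjoint_norm f j) \<le> 1 + e)"
  unfolding adjoint_norm_def
proof (rule convex_combination_of_support_functions[where M = D])
  show "norm z \<le> D" if z: "z \<in> P j ` cball 0 1" for z j
  proof -
    obtain x where x: "z = P j x" "norm x \<le> 1" using z by auto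
    have "norm z \<le> D * norm x" using P_le x(1) by simp
    also have "\<dots> \<le> D * 1" using x(2) D by (intro mult_left_mono) auto
    finally show ?thesis by simp
  qed
  show "P j ` cball 0 1 \<noteq> {}" for j by simp
  show "\<exists>B. finite B \<and> P j ` cball 0 1 \<subseteq> span B" for j
  proof -
    obtain B where B: "\<And>k. finite (B k)" "\<And>k. range (Q k) \<subseteq> span (B k)" using Q_finite by metis
    have "Q k x \<in> span (\<Union>k<j. B k)" if "k < j" for k x
      using B(2)[of k] span_mono[of "B k" "\<Union>k<j. B k"] that by blast
    then have "P j x \<in> span (\<Union>k<j. B k)" for x unfolding P_def by (intro span_sum) auto
    then show ?thesis using B(1) by (intro exI[of _ "\<Union>k<j. B k"]) auto
  qed
  show "\<exists>n. \<forall>j\<ge>n. \<forall>z\<in>P j ` cball 0 1. f z \<le> 1 + e" if f: "f \<in> dual_ball" and e: "e > 0" for f e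
  proof -
    have lin: "linear f" and fle: "\<And>z. \<bar>f z\<bar> \<le> norm z" using f by (auto simp: dual_ball_def)
    obtain n where n: "\<And>z. (\<And>k. k < n \<Longrightarrow> Q k z = 0) \<Longrightarrow> \<bar>f z\<bar> \<le> e / D * norm z"
      using Q_tail[OF f, of "e / D"] e D by auto
    have "f (P j x) \<le> 1 + e" if "j \<ge> n" "norm x \<le> 1" for j x
    proof -
      have "Q k (x - P j x) = 0" if "k < n" for k
        using that \<open>j \<ge> n\<close> by (simp add: P_def linear_diff[OF Q_linear] Q_sum)
      then have "\<bar>f (x - P j x)\<bar> \<le> e / D * norm (x - P j x)" by (rule n)
      also have "\<dots> \<le> e / D * (D * norm x)"
        using cointerval[where a = 0 and b = j and x = x] e D by (intro mult_left_mono) (auto simp: P_def lessThan_atLeast0)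
      also have "\<dots> \<le> e" using that(2) e D mult_left_mono[of "norm x" 1 e] by simp
      finally have "\<bar>f (x - P j x)\<bar> \<le> e" .
      moreover have "f (P j x) = f x - f (x - P j x)" by (simp add: linear_diff[OF lin])
      ultimately show ?thesis using fle[of x] that(2) by linarith
    qed
    then show ?thesis by (intro exI[of _ n]) auto
  qed
  show "e > 0" by (rule e)
qed

lemma averaging_sequence:
  assumes e: "e > 0"
  obtains lo :: "nat \<Rightarrow> nat" and A :: "nat \<Rightarrow> nat \<Rightarrow> real" where
    "A 0 0 = 1" "\<And>n. convex_weights (lo n) (lo (Suc n)) (A n)"
    "\<And>n f. f \<in> dual_ball \<Longrightarrow> (\<Sum>j=lo n..<lo (Suc n). A n j * adjoint_norm f j) \<le> 1 + e / real (Suc n)"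
proof -
  define R where "R n p \<longleftrightarrow> (case p of (l, h, \<alpha>) \<Rightarrow> convex_weights l h \<alpha> \<and> (n = 0 \<longrightarrow> l = 0 \<and> h = 1) \<and>
    (\<forall>f\<in>dual_ball. (\<Sum>j=l..<h. \<alpha> j * adjoint_norm f j) \<le> 1 + e / real (Suc n)))" for n :: nat and p :: "nat \<times> nat \<times> (nat \<Rightarrow> real)"
  have "\<exists>p. \<forall>n. R n (p n) \<and> fst (p (Suc n)) = fst (snd (p n))"
  proof (rule dependent_nat_choice)
    have "adjoint_norm f 0 \<le> 1" if "f \<in> dual_ball" for f
      unfolding adjoint_norm_def by (rule cSUP_least) (use that in \<open>auto simp: dual_ball_def linear_0\<close>)
    then have "R 0 (0, 1, \<lambda>k. if k = 0 then 1 else 0)"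
      using e by (fastforce simp: R_def convex_weights_def)
    then show "\<exists>p. R 0 p" by blast
    fix p n
    have "e / real (Suc (Suc n)) > 0" using e by simp
    from averaging_weights[OF this, of "fst (snd p)"] show "\<exists>p'. R (Suc n) p' \<and> fst p' = fst (snd p)"
      by (force simp: R_def)
  qed
  then obtain p where p: "\<And>n. R n (p n)" "\<And>n. fst (p (Suc n)) = fst (snd (p n))" by blast
  define lo where "lo n = fst (p n)" for n
  define A where "A n = snd (snd (p n))" for n
  have pe: "p n = (lo n, lo (Suc n), A n)" for n using p(2)[of n] by (simp add: lo_def A_def prod_eq_iff)
  show ?thesis
  proof (rule that)
    show cw: "convex_weights (lo n) (lo (Suc n)) (A n)" for n using p(1)[of n] by (simp add: R_def pe)
    have l0: "lo 0 = 0" using p(1)[of 0] by (simp add: R_def pe)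
    have "lo 1 = 1" using p(1)[of 0] by (simp add: R_def pe)
    then show "A 0 0 = 1" using cw[of 0] l0 by (simp add: convex_weights_def)
    show "(\<Sum>j=lo n..<lo (Suc n). A n j * adjoint_norm f j) \<le> 1 + e / real (Suc n)" if "f \<in> dual_ball" for n f
      using p(1)[of n] that by (simp add: R_def pe)
  qed
qed

end

section \<open>Moving slowly from one average to the next\<close>

text \<open>
  The weights \<open>A n\<close> have successive supports, and \<open>N n\<close> is the number of steps in which \<open>A n\<close> is
  moved to \<open>A (Suc n)\<close>. As \<open>A 0\<close> is concentrated at the threshold 0, the averages start at the zero operator.
\<close>

locale averaged_decomposition = decomposition Q D
  for Q :: "nat \<Rightarrow> 'a::real_normed_vector \<Rightarrow> 'a" and D :: real +
  fixes lo N :: "nat \<Rightarrow> nat" and A :: "nat \<Rightarrow> nat \<Rightarrow> real" and \<epsilon> :: real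
  assumes A_0: "A 0 0 = 1"
    and A_weights: "\<And>n. convex_weights (lo n) (lo (Suc n)) (A n)"
    and A_average: "\<And>n f. f \<in> dual_ball \<Longrightarrow> (\<Sum>j=lo n..<lo (Suc n). A n j * adjoint_norm f j) \<le> 1 + \<epsilon> / real (Suc n)"
    and N: "\<And>n. 1 \<le> N n" and \<epsilon>: "\<epsilon> > 0"
begin

lemma lo_less: "lo n < lo (Suc n)"
  using A_weights[of n] by (cases "lo n < lo (Suc n)") (auto simp: convex_weights_def)

lemma lo_strict_mono: "strict_mono lo"
  using lo_less by (simp add: strict_mono_Suc_iff)

lemma lo_mono: "m \<le> n \<Longrightarrow> lo m \<le> lo n"
  using strict_mono_less_eq[OF lo_strict_mono] by simp

lemma lo_ge: "n \<le> lo n"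
  by (rule strict_mono_imp_increasing[OF lo_strict_mono])

lemma A_nonneg: "0 \<le> A n m" using A_weights[of n] by (simp add: convex_weights_def)

lemma A_support: "A n m \<noteq> 0 \<Longrightarrow> lo n \<le> m \<and> m < lo (Suc n)"
  using A_weights[of n] unfolding convex_weights_def by (metis atLeastLessThan_iff)

lemma A_sum:
  assumes "lo (Suc n) \<le> K"
  shows "(\<Sum>m<K. A n m * g m) = (\<Sum>m=lo n..<lo (Suc n). A n m * g m)"
  by (rule convex_weights_sum[OF A_weights]) (use assms in auto)

lemma A_total: "lo (Suc n) \<le> K \<Longrightarrow> sum (A n) {..<K} = 1"
  using A_sum[of n K "\<lambda>_. 1"] A_weights[of n] by (simp add: convex_weights_def)

text \<open>
  The weights after \<open>s\<close> steps in all; \<open>n\<close> is the number of completed passages from one average to the next.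
\<close>

definition mixed :: "nat \<Rightarrow> nat \<Rightarrow> real" where
  "mixed s m = (let n = slice N s; t = real (s - start N n) / real (N n) in (1 - t) * A n m + t * A (Suc n) m)"

text \<open>
  The formula of a block of steps holds also at its right end point, where the next block begins.
\<close>

lemma mixed_eq:
  assumes "start N n \<le> s" "s \<le> start N (Suc n)"
  shows "mixed s m = (1 - real (s - start N n) / real (N n)) * A n m + real (s - start N n) / real (N n) * A (Suc n) m"
proof (cases "s < start N (Suc n)")
  case True
  then have "slice N s = n" using slice_eq_iff[of N, OF N] assms by blast
  then show ?thesis by (simp add: mixed_def)
next
  case False
  then have s: "s = start N (Suc n)" using assms by simp
  have "start N (Suc n) < start N (Suc (Suc n))" using N[of "Suc n"] by (simp add: start_Suc)
  then have "slice N s = Suc n" using slice_eq_iff[of N, OF N] s by simp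
  then show ?thesis using s N[of n] by (simp add: mixed_def start_Suc)
qed

lemma mixed_Suc: "mixed (Suc s) m - mixed s m = (A (Suc (slice N s)) m - A (slice N s) m) / real (N (slice N s))"
proof -
  let ?n = "slice N s"
  have b: "start N ?n \<le> s" "s < start N (Suc ?n)" using slice_eq_iff[of N, OF N, of s ?n] by auto
  define r where "r = real (s - start N ?n) / real (N ?n)"
  have "real (Suc s - start N ?n) = real (s - start N ?n) + 1" using b by simp
  then have r: "real (Suc s - start N ?n) / real (N ?n) = r + 1 / real (N ?n)"
    by (simp add: r_def add_divide_distrib)
  have "mixed (Suc s) m = (1 - (r + 1 / real (N ?n))) * A ?n m + (r + 1 / real (N ?n)) * A (Suc ?n) m"
    using mixed_eq[of ?n "Suc s" m] b unfolding r by simp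
  moreover have "mixed s m = (1 - r) * A ?n m + r * A (Suc ?n) m"
    using mixed_eq[of ?n s m] b unfolding r_def by simp
  ultimately show ?thesis by (simp add: algebra_simps diff_divide_distrib)
qed

lemma mixed_frac:
  obtains t where "0 \<le> t" "t \<le> 1" "\<And>m. mixed s m = (1 - t) * A (slice N s) m + t * A (Suc (slice N s)) m"
proof -
  let ?n = "slice N s"
  define t where "t = real (s - start N ?n) / real (N ?n)"
  have "s - start N ?n < N ?n" by (rule slice_pos[of N, OF N])
  then have "0 \<le> t" "t \<le> 1" unfolding t_def by auto
  then show ?thesis using that[of t] by (simp add: mixed_def t_def Let_def)
qed

lemma mixed_nonneg: "0 \<le> mixed s m"
  by (rule mixed_frac[of s]) (simp add: A_nonneg)

lemma mixed_support: "mixed s m \<noteq> 0 \<Longrightarrow> lo (slice N s) \<le> m"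
  by (rule mixed_frac[of s]) (use A_support lo_less in \<open>smt (verit) mult_eq_0_iff nat_less_le order_trans\<close>)

lemma mixed_sum:
  assumes "lo (s + 2) \<le> K"
  shows "sum (mixed s) {..<K} = 1"
proof -
  obtain t where t: "\<And>m. mixed s m = (1 - t) * A (slice N s) m + t * A (Suc (slice N s)) m" using mixed_frac by metis
  have "lo (Suc (Suc (slice N s))) \<le> K" using assms lo_mono[of "slice N s + 2" "s + 2"] slice_le[of N, OF N, of s] by simp
  then have "sum (A (slice N s)) {..<K} = 1" "sum (A (Suc (slice N s))) {..<K} = 1"
    using A_total lo_less[of "Suc (slice N s)"] by auto
  then show ?thesis by (simp add: t sum.distrib flip: sum_distrib_left)
qed

definition average_bound :: "nat \<Rightarrow> real" where "average_bound s = 1 + \<epsilon> / real (Suc (slice N s))"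

lemma mixed_average:
  assumes f: "f \<in> dual_ball" and K: "lo (s + 2) \<le> K"
  shows "(\<Sum>m<K. mixed s m * adjoint_norm f m) \<le> average_bound s"
proof -
  let ?n = "slice N s"
  obtain t where t: "0 \<le> t" "t \<le> 1" "\<And>m. mixed s m = (1 - t) * A ?n m + t * A (Suc ?n) m" using mixed_frac by metis
  have K2: "lo (Suc (Suc ?n)) \<le> K" using K lo_mono[of "?n + 2" "s + 2"] slice_le[of N, OF N, of s] by simp
  have 1: "(\<Sum>m<K. A ?n m * adjoint_norm f m) \<le> average_bound s"
    using A_average[OF f, of ?n] A_sum[of ?n K] K2 lo_less[of "Suc ?n"] by (simp add: average_bound_def)
  have "\<epsilon> / real (Suc (Suc ?n)) \<le> \<epsilon> / real (Suc ?n)" using \<epsilon> by (intro divide_left_mono) auto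
  then have 2: "(\<Sum>m<K. A (Suc ?n) m * adjoint_norm f m) \<le> average_bound s"
    using A_average[OF f, of "Suc ?n"] A_sum[of "Suc ?n" K] K2 by (simp add: average_bound_def)
  have "(\<Sum>m<K. mixed s m * adjoint_norm f m) = (1 - t) * (\<Sum>m<K. A ?n m * adjoint_norm f m) + t * (\<Sum>m<K. A (Suc ?n) m * adjoint_norm f m)"
    by (simp add: t(3) sum_distrib_left sum.distrib[symmetric] algebra_simps)
  also have "\<dots> \<le> (1 - t) * average_bound s + t * average_bound s" using t 1 2 by (intro add_mono mult_left_mono) auto
  finally show ?thesis by (simp add: algebra_simps)
qed

lemma mixed_0: "m > 0 \<Longrightarrow> mixed 0 m = 0"
proof -
  assume m: "m > 0"
  have "A 0 m = 0"
  proof (rule ccontr)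
    assume "A 0 m \<noteq> 0"
    then have "{0, m} \<subseteq> {..<lo (Suc 0)}" using A_support[of 0 m] lo_less[of 0] by auto
    then have "sum (A 0) {0, m} \<le> sum (A 0) {..<lo (Suc 0)}" by (intro sum_mono2) (auto simp: A_nonneg)
    then show False using A_total[of 0 "lo (Suc 0)"] A_0 m \<open>A 0 m \<noteq> 0\<close> A_nonneg[of 0 m] by simp
  qed
  then show ?thesis using mixed_eq[of 0 0 m] by simp
qed

text \<open>
  The thresholds move to the right, because the support of \<open>A (Suc n)\<close> lies beyond that of \<open>A n\<close>.
\<close>

lemma upper_sum_mixed_mono:
  assumes "lo (Suc t + 2) \<le> K"
  shows "upper_sum K (mixed t) k \<le> upper_sum K (mixed (Suc t)) k"
proof -
  let ?n = "slice N t"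
  have K: "lo (Suc (Suc ?n)) \<le> K" using assms lo_mono[of "?n + 2" "Suc t + 2"] slice_le[of N, OF N, of t] by simp
  have le: "upper_sum K (A ?n) k \<le> upper_sum K (A (Suc ?n)) k"
  proof (cases "Suc k \<le> lo (Suc ?n)")
    case True
    have "upper_sum K (A ?n) k \<le> sum (A ?n) {..<K}"
      unfolding upper_sum_def by (rule sum_mono2) (auto simp: A_nonneg)
    also have "\<dots> = sum (A (Suc ?n)) {..<K}" using A_total K lo_less[of "Suc ?n"] by simp
    also have "\<dots> = upper_sum K (A (Suc ?n)) k"
      unfolding upper_sum_def
    proof (rule sum.mono_neutral_right)
      show "\<forall>i\<in>{..<K} - {Suc k..<K}. A (Suc ?n) i = 0"
        using A_support[of "Suc ?n"] True by (metis DiffE atLeastLessThan_iff lessThan_iff not_le order_trans)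
    qed auto
    finally show ?thesis .
  next
    case False
    have "upper_sum K (A ?n) k = 0"
      unfolding upper_sum_def using A_support[of ?n] False by (intro sum.neutral) fastforce
    then show ?thesis unfolding upper_sum_def by (simp add: sum_nonneg A_nonneg)
  qed
  have "upper_sum K (mixed (Suc t)) k - upper_sum K (mixed t) k = (upper_sum K (A (Suc ?n)) k - upper_sum K (A ?n) k) / real (N ?n)"
    unfolding upper_sum_def by (simp add: mixed_Suc sum_divide_distrib flip: sum_subtractf)
  also have "\<dots> \<ge> 0" using le by simp
  finally show ?thesis by simp
qed

definition smoothed :: "nat \<Rightarrow> 'a \<Rightarrow> 'a" where "smoothed s x = (\<Sum>m<lo (s + 2). mixed s m *\<^sub>R P m x)"

lemma mixed_zero_above: "lo (s + 2) \<le> m \<Longrightarrow> mixed s m = 0"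
proof -
  assume m: "lo (s + 2) \<le> m"
  have "slice N s \<le> s" by (rule slice_le[of N, OF N])
  then have "lo (Suc (slice N s)) \<le> m" "lo (Suc (Suc (slice N s))) \<le> m"
    using m lo_mono[of "Suc (slice N s)" "s + 2"] lo_mono[of "Suc (Suc (slice N s))" "s + 2"] by auto
  then have "A (slice N s) m = 0" "A (Suc (slice N s)) m = 0" using A_support by (meson not_le)+
  then show ?thesis by (simp add: mixed_def Let_def)
qed

lemma smoothed_eq:
  assumes "lo (s + 2) \<le> K"
  shows "smoothed s x = (\<Sum>m<K. mixed s m *\<^sub>R P m x)"
  unfolding smoothed_def by (rule sum.mono_neutral_left) (use assms mixed_zero_above in auto)

lemma smoothed_0: "smoothed 0 x = 0"
  unfolding smoothed_def using mixed_0 by (intro sum.neutral ballI) (metis P_0 gr0I scaleR_zero_left scaleR_zero_right)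

text \<open>
  At each height \<open>\<theta>\<close> the coupled thresholds give sharp cuts, to which \<open>pattern_projection\<close> applies. Integration leaves
  \<open>D ^ length L\<close> times the average of \<open>adjoint_norm f\<close> over the weights \<open>mixed s\<close>.
\<close>

lemma averaged_pattern_bound:
  "norm (\<Sum>t\<in>{t. t < s \<and> t \<in> pattern_set L}. smoothed (Suc t) x - smoothed t x) \<le> D ^ length L * average_bound s * norm x"
proof (cases "x = 0")
  case True
  then show ?thesis by (simp add: smoothed_def linear_0[OF P_linear])
next
  case False
  let ?I = "{t. t < s \<and> t \<in> pattern_set L}"
  let ?z = "\<Sum>t\<in>?I. smoothed (Suc t) x - smoothed t x"
  obtain f where f: "f \<in> dual_ball" "f ?z = norm ?z" using norming_functional by blast
  have lin: "linear f" using f(1) by (simp add: dual_ball_def)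
  define K where "K = lo (s + 2)"
  have K: "lo (t + 2) \<le> K" if "t \<le> s" for t unfolding K_def using lo_mono[of "t + 2" "s + 2"] that by simp
  define thr where "thr t = threshold K (mixed t)" for t
  have int: "((\<lambda>\<theta>. g (thr t \<theta>)) has_integral (\<Sum>m<K. mixed t m * g m)) {0..1}" if "t \<le> s" for t g
    unfolding thr_def by (rule integral_threshold) (use mixed_nonneg mixed_sum[OF K[OF that]] in auto)
  define F where "F m = f (P m x)" for m
  have fV: "f (smoothed t x) = (\<Sum>m<K. mixed t m * F m)" if "t \<le> s" for t
    by (simp add: smoothed_eq[OF K[OF that]] linear_sum[OF lin] linear_cmul[OF lin] F_def)
  have eq: "norm ?z = (\<Sum>t\<in>?I. (\<Sum>m<K. mixed (Suc t) m * F m) - (\<Sum>m<K. mixed t m * F m))"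
    unfolding f(2)[symmetric] linear_sum[OF lin] by (rule sum.cong) (auto simp: linear_diff[OF lin] fV)
  have i1: "((\<lambda>\<theta>. \<Sum>t\<in>?I. F (thr (Suc t) \<theta>) - F (thr t \<theta>)) has_integral norm ?z) {0..1}"
    unfolding eq by (intro has_integral_sum has_integral_diff int) auto
  have i2: "((\<lambda>\<theta>. adjoint_norm f (thr s \<theta>) * (D ^ length L * norm x)) has_integral
      (\<Sum>m<K. mixed s m * adjoint_norm f m) * (D ^ length L * norm x)) {0..1}"
    by (intro has_integral_mult_left int) simp
  have "norm ?z \<le> (\<Sum>m<K. mixed s m * adjoint_norm f m) * (D ^ length L * norm x)"
  proof (rule has_integral_le[OF i1 i2])
    fix \<theta> :: real assume \<theta>: "\<theta> \<in> {0..1}"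
    \<comment> \<open>Truncated at $s$, since $K$ accommodates only the weights up to $s$.\<close>
    define \<tau> where "\<tau> t = thr (min t s) \<theta>" for t
    have "mono \<tau>"
    proof (rule incseq_SucI)
      fix t
      show "\<tau> t \<le> \<tau> (Suc t)"
      proof (cases "t < s")
        case True
        then have "min t s = t" "min (Suc t) s = Suc t" "lo (Suc t + 2) \<le> K" using K[of "Suc t"] by auto
        then show ?thesis unfolding \<tau>_def thr_def using upper_sum_mixed_mono by (simp add: threshold_mono)
      qed (simp add: \<tau>_def)
    qed
    moreover have "\<tau> 0 = 0"
    proof -
      have "upper_sum K (mixed 0) k = 0" for k unfolding upper_sum_def by (rule sum.neutral) (auto simp: mixed_0)
      then show ?thesis using \<theta> unfolding \<tau>_def thr_def threshold_def by simp
    qed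
    ultimately obtain y where y: "norm y \<le> D ^ length L * norm x"
      "(\<Sum>t\<in>?I. P (\<tau> (Suc t)) x - P (\<tau> t) x) = P (\<tau> s) y"
      using pattern_projection[of \<tau> L x] by blast
    have "(\<Sum>t\<in>?I. F (thr (Suc t) \<theta>) - F (thr t \<theta>)) = (\<Sum>t\<in>?I. f (P (\<tau> (Suc t)) x - P (\<tau> t) x))"
      by (rule sum.cong) (auto simp: F_def \<tau>_def linear_diff[OF lin] min_absorb1 Suc_le_eq)
    also have "\<dots> = f (P (\<tau> s) y)" unfolding y(2)[symmetric] by (rule linear_sum[OF lin, symmetric])
    also have "\<dots> \<le> adjoint_norm f (\<tau> s) * norm y" by (rule adjoint_norm_bound[OF f(1)])
    also have "\<dots> \<le> adjoint_norm f (\<tau> s) * (D ^ length L * norm x)" using y(1) adjoint_norm_nonneg[OF f(1) False] by (rule mult_left_mono)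
    finally show "(\<Sum>t\<in>?I. F (thr (Suc t) \<theta>) - F (thr t \<theta>)) \<le> adjoint_norm f (thr s \<theta>) * (D ^ length L * norm x)"
      by (simp add: \<tau>_def)
  qed
  also have "\<dots> \<le> average_bound s * (D ^ length L * norm x)"
    using mixed_average[OF f(1), of s K] D by (intro mult_right_mono) (auto simp: K_def)
  finally show ?thesis by (simp add: mult_ac)
qed

lemma smoothed_eventually:
  assumes x: "\<And>k. k \<ge> K \<Longrightarrow> Q k x = 0" and s: "slice N s \<ge> K"
  shows "smoothed s x = x"
proof -
  have Px: "P m x = x" if "m \<ge> K" for m
  proof -
    have "(\<lambda>k. Q k x) sums (\<Sum>k<m. Q k x)" by (rule sums_finite) (use x that in auto)
    then show ?thesis using Q_sums[of x] sums_unique2 unfolding P_def by blast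
  qed
  have "mixed s m *\<^sub>R P m x = mixed s m *\<^sub>R x" for m
  proof (cases "mixed s m = 0")
    case False
    then have "K \<le> m" using mixed_support[of s m] s lo_ge[of "slice N s"] by linarith
    then show ?thesis by (simp add: Px)
  qed simp
  then have "smoothed s x = (\<Sum>m<lo (s + 2). mixed s m *\<^sub>R x)" unfolding smoothed_def by (intro sum.cong refl)
  then have "smoothed s x = (\<Sum>m<lo (s + 2). mixed s m) *\<^sub>R x" by (simp only: scaleR_sum_left)
  then show ?thesis using mixed_sum[of s "lo (s + 2)"] by simp
qed

definition increment :: "nat \<Rightarrow> 'a \<Rightarrow> 'a" where
  "increment n x = (\<Sum>m<lo (n + 2). (A (Suc n) m - A n m) *\<^sub>R P m x)"

lemma smoothed_Suc: "smoothed (Suc s) x - smoothed s x = (1 / real (N (slice N s))) *\<^sub>R increment (slice N s) x"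
proof -
  let ?n = "slice N s" and ?K = "lo (Suc s + 2)"
  have sl: "?n \<le> s" by (rule slice_le[of N, OF N])
  have "smoothed (Suc s) x - smoothed s x = (\<Sum>m<?K. (mixed (Suc s) m - mixed s m) *\<^sub>R P m x)"
    using smoothed_eq[of "Suc s" ?K x] smoothed_eq[of s ?K x] lo_mono[of "s + 2" "Suc s + 2"]
    by (simp add: scaleR_diff_left sum_subtractf)
  also have "\<dots> = (1 / real (N ?n)) *\<^sub>R (\<Sum>m<?K. (A (Suc ?n) m - A ?n m) *\<^sub>R P m x)"
    by (simp add: mixed_Suc scaleR_sum_right)
  also have "(\<Sum>m<?K. (A (Suc ?n) m - A ?n m) *\<^sub>R P m x) = increment ?n x"
    unfolding increment_def
  proof (rule sum.mono_neutral_right)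
    show "{..<lo (?n + 2)} \<subseteq> {..<?K}" using lo_mono[of "?n + 2" "Suc s + 2"] sl by auto
    show "\<forall>m\<in>{..<?K} - {..<lo (?n + 2)}. (A (Suc ?n) m - A ?n m) *\<^sub>R P m x = 0"
    proof
      fix m assume "m \<in> {..<?K} - {..<lo (?n + 2)}"
      then have "lo (Suc (Suc ?n)) \<le> m" "lo (Suc ?n) \<le> m" using lo_less[of "Suc ?n"] by auto
      then have "A (Suc ?n) m = 0" "A ?n m = 0" using A_support by (meson not_le)+
      then show "(A (Suc ?n) m - A ?n m) *\<^sub>R P m x = 0" by simp
    qed
  qed simp
  finally show ?thesis .
qed

lemma increment_multiplier:
  "increment n x = (\<Sum>k<lo (n + 2). (upper_sum (lo (n + 2)) (A (Suc n)) k - upper_sum (lo (n + 2)) (A n) k) *\<^sub>R Q k x)"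
proof -
  let ?K = "lo (n + 2)"
  have "increment n x = (\<Sum>m<?K. \<Sum>k<?K. if k < m then (A (Suc n) m - A n m) *\<^sub>R Q k x else 0)"
    unfolding increment_def
  proof (rule sum.cong[OF refl])
    fix m assume "m \<in> {..<?K}"
    then have "(\<Sum>k<?K. if k < m then (A (Suc n) m - A n m) *\<^sub>R Q k x else 0) = (\<Sum>k<m. (A (Suc n) m - A n m) *\<^sub>R Q k x)"
      by (intro sum.mono_neutral_cong_right) auto
    then show "(A (Suc n) m - A n m) *\<^sub>R P m x = (\<Sum>k<?K. if k < m then (A (Suc n) m - A n m) *\<^sub>R Q k x else 0)"
      by (simp add: P_def scaleR_sum_right)
  qed
  also have "\<dots> = (\<Sum>k<?K. \<Sum>m<?K. if k < m then (A (Suc n) m - A n m) *\<^sub>R Q k x else 0)" by (rule sum.swap)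
  also have "\<dots> = (\<Sum>k<?K. (upper_sum ?K (A (Suc n)) k - upper_sum ?K (A n) k) *\<^sub>R Q k x)"
  proof (rule sum.cong[OF refl])
    fix k
    have "(\<Sum>m<?K. if k < m then (A (Suc n) m - A n m) *\<^sub>R Q k x else 0) = (\<Sum>m=Suc k..<?K. (A (Suc n) m - A n m) *\<^sub>R Q k x)"
      by (rule sum.mono_neutral_cong_right) auto
    then show "(\<Sum>m<?K. if k < m then (A (Suc n) m - A n m) *\<^sub>R Q k x else 0) =
        (upper_sum ?K (A (Suc n)) k - upper_sum ?K (A n) k) *\<^sub>R Q k x"
      by (simp add: upper_sum_def scaleR_sum_left[symmetric] sum_subtractf)
  qed
  finally show ?thesis .
qed

text \<open>
  Both averages act as the identity on the components before \<open>lo n\<close>.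
\<close>

lemma increment_far:
  "increment n x = (\<Sum>k=lo n..<lo (n + 2). (upper_sum (lo (n + 2)) (A (Suc n)) k - upper_sum (lo (n + 2)) (A n) k) *\<^sub>R Q k x)"
  unfolding increment_multiplier
proof (rule sum.mono_neutral_right)
  let ?K = "lo (n + 2)"
  have one: "upper_sum ?K (A j) k = 1" if j: "j = n \<or> j = Suc n" and k: "k < lo n" for j k
  proof -
    have lj: "lo n \<le> lo j" "lo (Suc j) \<le> ?K" using j lo_mono[of n j] lo_less[of "Suc n"] by auto
    have "upper_sum ?K (A j) k = sum (A j) {..<?K}"
      unfolding upper_sum_def
    proof (rule sum.mono_neutral_left)
      show "\<forall>i\<in>{..<?K} - {Suc k..<?K}. A j i = 0"
        using A_support[of j] k lj by (metis DiffE Suc_leI atLeastLessThan_iff lessThan_iff order_trans)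
    qed auto
    then show ?thesis using A_total[OF lj(2)] by simp
  qed
  show "\<forall>k\<in>{..<?K} - {lo n..<?K}. (upper_sum ?K (A (Suc n)) k - upper_sum ?K (A n) k) *\<^sub>R Q k x = 0"
    using one by auto
qed auto

end

section \<open>Rank one pieces\<close>

context decomposition
begin

text \<open>
  A rank one operator \<open>\<lambda>x. \<phi> x *\<^sub>R v\<close> that lives on the components from \<open>n\<close> on, with a positive
  bound \<open>\<kappa>\<close> for the norm of \<open>\<phi>\<close>.
\<close>

definition piece :: "nat \<Rightarrow> 'a \<times> ('a \<Rightarrow> real) \<times> real \<Rightarrow> bool" where
  "piece n p \<longleftrightarrow> (case p of (v, \<phi>, \<kappa>) \<Rightarrow> linear \<phi> \<and> \<kappa> > 0 \<and> (\<forall>x. \<bar>\<phi> x\<bar> \<le> \<kappa> * norm x) \<and>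
    (\<forall>k<n. Q k v = 0) \<and> (\<forall>x. (\<forall>k\<ge>n. Q k x = 0) \<longrightarrow> \<phi> x = 0))"

definition pieces :: "nat \<Rightarrow> ('a \<Rightarrow> 'a) \<Rightarrow> ('a \<times> ('a \<Rightarrow> real) \<times> real) list \<Rightarrow> bool" where
  "pieces n R ps \<longleftrightarrow> (\<forall>p\<in>set ps. piece n p) \<and> (\<forall>x. R x = (\<Sum>(v, \<phi>, \<kappa>)\<leftarrow>ps. \<phi> x *\<^sub>R v))"

lemma pieces_sum:
  assumes "finite S" "\<And>k. k \<in> S \<Longrightarrow> \<exists>ps. pieces n (R k) ps"
  shows "\<exists>ps. pieces n (\<lambda>x. \<Sum>k\<in>S. R k x) ps"
  using assms
proof (induction S)
  case empty
  then show ?case by (intro exI[of _ "[]"]) (simp add: pieces_def)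
next
  case (insert k S)
  then obtain ps qs where "pieces n (R k) ps" "pieces n (\<lambda>x. \<Sum>k\<in>S. R k x) qs" by blast
  then have "pieces n (\<lambda>x. \<Sum>k\<in>insert k S. R k x) (ps @ qs)"
    using insert(1,2) by (auto simp: pieces_def)
  then show ?case by blast
qed

lemma pieces_single: "piece n (v, \<phi>, \<kappa>) \<Longrightarrow> pieces n (\<lambda>x. \<phi> x *\<^sub>R v) [(v, \<phi>, \<kappa>)]"
  by (simp add: pieces_def)

text \<open>
  The pieces are the coordinates with respect to a basis of the range of \<open>Q k\<close>.
\<close>

lemma Q_pieces:
  assumes k: "n \<le> k"
  shows "\<exists>ps. pieces n (\<lambda>x. \<rho> *\<^sub>R Q k x) ps"
proof -
  obtain B where B: "B \<subseteq> range (Q k)" "independent B" "range (Q k) \<subseteq> span B"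
    using maximal_independent_subset[of "range (Q k)"] by blast
  obtain B' where B': "finite B'" "range (Q k) \<subseteq> span B'" using Q_finite by blast
  have fin: "finite B" using independent_span_bound[OF B'(1) B(2)] B(1) B'(2) by blast
  obtain C where C: "\<And>z b. z \<in> span B \<Longrightarrow> \<bar>representation B z b\<bar> \<le> C * norm z"
    using coordinates_bounded[OF fin B(2)] by blast
  have Qs: "Q k x \<in> span B" for x using B(3) by blast
  define \<kappa> where "\<kappa> = \<bar>\<rho>\<bar> * \<bar>C\<bar> * D + 1"
  have "\<exists>ps. pieces n (\<lambda>x. \<Sum>b\<in>B. (\<rho> * representation B (Q k x) b) *\<^sub>R b) ps"
  proof (rule pieces_sum[OF fin])
    fix b assume b: "b \<in> B"
    have "piece n (b, \<lambda>x. \<rho> * representation B (Q k x) b, \<kappa>)"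
      unfolding piece_def prod.case
    proof (intro conjI allI impI)
      show "linear (\<lambda>x. \<rho> * representation B (Q k x) b)"
        by (rule linearI) (simp_all add: linear_add[OF Q_linear] linear_cmul[OF Q_linear]
            representation_add[OF B(2) Qs Qs] representation_scale[OF B(2) Qs] algebra_simps)
      show "\<kappa> > 0" using D unfolding \<kappa>_def by (intro add_nonneg_pos mult_nonneg_nonneg) auto
      fix x
      have "norm (Q k x) \<le> D * norm x" using interval[where a = k and b = "Suc k" and x = x] by simp
      then have "\<bar>representation B (Q k x) b\<bar> \<le> \<bar>C\<bar> * (D * norm x)"
        by (intro order_trans[OF C[OF Qs]] mult_mono) auto
      then have "\<bar>\<rho> * representation B (Q k x) b\<bar> \<le> \<bar>\<rho>\<bar> * (\<bar>C\<bar> * (D * norm x))"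
        unfolding abs_mult by (intro mult_left_mono) auto
      also have "\<dots> \<le> \<kappa> * norm x" by (simp add: \<kappa>_def algebra_simps)
      finally show "\<bar>\<rho> * representation B (Q k x) b\<bar> \<le> \<kappa> * norm x" .
    next
      fix j assume "j < n"
      moreover obtain y where "b = Q k y" using B(1) b by blast
      ultimately show "Q j b = 0" using k by (simp add: Q_Q)
    next
      fix x assume "\<forall>j\<ge>n. Q j x = 0"
      then show "\<rho> * representation B (Q k x) b = 0" using k by (simp add: representation_zero)
    qed
    then show "\<exists>ps. pieces n (\<lambda>x. (\<rho> * representation B (Q k x) b) *\<^sub>R b) ps"
      using pieces_single by blast
  qed
  moreover have "(\<Sum>b\<in>B. (\<rho> * representation B (Q k x) b) *\<^sub>R b) = \<rho> *\<^sub>R Q k x" for x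
    using sum_representation_eq[OF B(2) Qs fin, of x] by (simp flip: scaleR_scaleR scaleR_sum_right)
  ultimately show ?thesis by simp
qed

text \<open>
  Only the number of steps \<open>N n\<close> is left to choose. Each step from \<open>A n\<close> to \<open>A (Suc n)\<close> applies the same
  increment divided by \<open>N n\<close>, so dividing its rank one pieces by a large \<open>N n\<close> makes the slice as small as needed.
\<close>

theorem slow_expansion_exists:
  assumes \<epsilon>: "\<epsilon> > 0" and \<eta>: "\<eta> > 0"
  shows "\<exists>(v :: nat \<Rightarrow> 'a) \<phi> \<kappa> sl \<gamma>. slow_expansion v \<phi> \<kappa> sl D \<eta> (1 + \<epsilon>) \<gamma>"
proof -
  obtain lo A where lo: "A 0 0 = 1" "\<And>n. convex_weights (lo n) (lo (Suc n)) (A n)"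
    "\<And>n f. f \<in> dual_ball \<Longrightarrow> (\<Sum>j=lo n..<lo (Suc n). A n j * adjoint_norm f j) \<le> 1 + \<epsilon> / real (Suc n)"
    by (rule averaging_sequence[OF \<epsilon>], rule that)
  \<comment> \<open>The increments do not depend on the number of steps; any value serves to define them.\<close>
  interpret a1: averaged_decomposition Q D lo "\<lambda>_. 1" A \<epsilon>
    by unfold_locales (use lo \<epsilon> in auto)
  have "\<exists>ps. pieces (lo n) (a1.increment n) ps" for n
  proof -
    have "\<exists>ps. pieces (lo n) (\<lambda>x. \<Sum>k=lo n..<lo (n + 2). (upper_sum (lo (n + 2)) (A (Suc n)) k - upper_sum (lo (n + 2)) (A n) k) *\<^sub>R Q k x) ps"
      by (rule pieces_sum) (auto intro: Q_pieces)
    then show ?thesis unfolding a1.increment_far[abs_def] .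
  qed
  then obtain ps where ps: "\<And>n. pieces (lo n) (a1.increment n) (ps n)" by metis
  \<comment> \<open>A zero piece makes sure that no slice is empty.\<close>
  define l where "l n = (0, \<lambda>_. 0, 1) # ps n" for n
  have l: "pieces (lo n) (a1.increment n) (l n)" for n
    using ps[of n] by (auto simp: l_def pieces_def piece_def linear_0[OF Q_linear] linear_iff)
  define C where "C n = (\<Sum>(v, \<phi>, \<kappa>)\<leftarrow>l n. \<kappa> * norm v)" for n
  define N where "N n = Suc (nat \<lceil>C n / \<eta>\<rceil>)" for n
  have NC: "C n \<le> \<eta> * real (N n)" for n
  proof -
    have "C n / \<eta> \<le> real (N n)" unfolding N_def by linarith
    then show ?thesis using \<eta> by (simp add: pos_divide_le_eq mult.commute)
  qed
  interpret averaged_decomposition Q D lo N A \<epsilon>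
    by unfold_locales (use lo \<epsilon> in \<open>auto simp: N_def\<close>)
  define d where "d s = length (l (slice N s))" for s
  have d: "1 \<le> d s" for s by (simp add: d_def l_def)
  define sl where "sl = slice d"
  define blk where "blk i = slice N (sl i)" for i
  define item where "item i = l (blk i) ! (i - start d (sl i))" for i
  define v where "v i = fst (item i)" for i
  define \<phi> where "\<phi> i x = fst (snd (item i)) x / real (N (blk i))" for i x
  define \<kappa> where "\<kappa> i = snd (snd (item i)) / real (N (blk i))" for i
  have Npos: "real (N n) > 0" for n by (simp add: N_def)
  have "item i \<in> set (l (blk i))" for i
    unfolding item_def by (rule nth_mem) (use slice_pos[of d i, OF d] in \<open>simp add: d_def sl_def blk_def\<close>)
  then have item: "piece (lo (blk i)) (v i, fst (snd (item i)), snd (snd (item i)))" for i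
    using l[of "blk i"] unfolding pieces_def v_def by simp
  have item_linear: "linear (fst (snd (item i)))" and item_pos: "0 < snd (snd (item i))"
    and item_le: "\<bar>fst (snd (item i)) x\<bar> \<le> snd (snd (item i)) * norm x"
    and item_far: "k < lo (blk i) \<Longrightarrow> Q k (v i) = 0"
    and item_zero: "(\<And>k. k \<ge> lo (blk i) \<Longrightarrow> Q k x = 0) \<Longrightarrow> fst (snd (item i)) x = 0" for i x k
    using item[of i, unfolded piece_def prod.case] by blast+
  have fin_slice: "finite {i. sl i < s}" for s
    unfolding sl_def by (simp add: slice_less_iff[of d, OF d])
  have slice_sum: "(\<Sum>i | sl i = s. g (item i)) = (\<Sum>p\<leftarrow>l (slice N s). g p)"
    for s and g :: "'a \<times> ('a \<Rightarrow> real) \<times> real \<Rightarrow> 'b::comm_monoid_add"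
  proof -
    have "(\<Sum>i | sl i = s. g (item i)) = (\<Sum>i | slice d i = s. g (l (slice N s) ! (i - start d s)))"
      by (rule sum.cong) (auto simp: sl_def item_def blk_def)
    also have "\<dots> = (\<Sum>j<d s. g (l (slice N s) ! j))" by (rule sum_slice[of d, OF d])
    also have "\<dots> = (\<Sum>p\<leftarrow>l (slice N s). g p)"
      by (simp add: sum_list_sum_nth d_def atLeast0LessThan)
    finally show ?thesis .
  qed
  have step: "(\<Sum>i | sl i = s. \<phi> i x *\<^sub>R v i) = smoothed (Suc s) x - smoothed s x" for s x
  proof -
    have "(\<Sum>i | sl i = s. \<phi> i x *\<^sub>R v i) = (\<Sum>i | sl i = s. (1 / real (N (slice N s))) *\<^sub>R (fst (snd (item i)) x *\<^sub>R fst (item i)))"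
      by (rule sum.cong) (auto simp: \<phi>_def v_def blk_def)
    also have "\<dots> = (1 / real (N (slice N s))) *\<^sub>R (\<Sum>i | sl i = s. fst (snd (item i)) x *\<^sub>R fst (item i))"
      by (simp add: scaleR_sum_right)
    also have "(\<Sum>i | sl i = s. fst (snd (item i)) x *\<^sub>R fst (item i)) = (\<Sum>p\<leftarrow>l (slice N s). fst (snd p) x *\<^sub>R fst p)"
      by (rule slice_sum)
    also have "\<dots> = increment (slice N s) x"
      using l[of "slice N s"] unfolding pieces_def by (simp add: case_prod_unfold)
    finally show ?thesis by (simp add: smoothed_Suc)
  qed
  have pattern: "(\<Sum>i | sl i < s \<and> sl i \<in> S. \<phi> i x *\<^sub>R v i) = (\<Sum>t\<in>{t. t < s \<and> t \<in> S}. smoothed (Suc t) x - smoothed t x)" for s S x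
  proof -
    let ?I = "{i. sl i < s \<and> sl i \<in> S}" and ?T = "{t. t < s \<and> t \<in> S}"
    have fI: "finite ?I" by (rule finite_subset[OF _ fin_slice[of s]]) auto
    have "(\<Sum>i\<in>?I. \<phi> i x *\<^sub>R v i) = (\<Sum>t\<in>?T. \<Sum>i\<in>{i\<in>?I. sl i = t}. \<phi> i x *\<^sub>R v i)"
      by (rule sum.group[symmetric]) (use fI in auto)
    also have "\<dots> = (\<Sum>t\<in>?T. \<Sum>i | sl i = t. \<phi> i x *\<^sub>R v i)"
      by (intro sum.cong) auto
    finally show ?thesis by (simp add: step)
  qed
  have blk_top: "\<exists>i0. \<forall>i\<ge>i0. n \<le> blk i" for n
  proof -
    obtain s0 where s0: "\<And>s. s \<ge> s0 \<Longrightarrow> n \<le> slice N s" using slice_at_top[of N, OF N] by blast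
    obtain i0 where "\<And>i. i \<ge> i0 \<Longrightarrow> s0 \<le> slice d i" using slice_at_top[of d, OF d] by blast
    then show ?thesis using s0 unfolding blk_def sl_def by blast
  qed
  have "slow_expansion v \<phi> \<kappa> sl D \<eta> (1 + \<epsilon>) average_bound"
  proof (rule slow_expansion.intro)
    show "D \<ge> 1" by (rule D)
    show "\<eta> \<ge> 0" using \<eta> by simp
    show "\<kappa> i > 0" for i using item_pos[of i] Npos[of "blk i"] by (simp add: \<kappa>_def)
    show "mono sl" unfolding sl_def by (rule slice_mono[of d, OF d])
    show "finite {i. sl i < s}" for s by (rule fin_slice)
    show "(\<Sum>i | sl i = s. \<kappa> i * norm (v i)) \<le> \<eta>" for s
    proof -
      have "(\<Sum>i | sl i = s. \<kappa> i * norm (v i)) = (\<Sum>i | sl i = s. snd (snd (item i)) * norm (fst (item i))) / real (N (slice N s))"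
        unfolding sum_divide_distrib by (rule sum.cong) (auto simp: \<kappa>_def v_def blk_def)
      also have "(\<Sum>i | sl i = s. snd (snd (item i)) * norm (fst (item i))) = C (slice N s)"
        unfolding C_def case_prod_unfold by (rule slice_sum)
      also have "C (slice N s) / real (N (slice N s)) \<le> \<eta>" using NC Npos by (simp add: pos_divide_le_eq)
      finally show ?thesis .
    qed
    show "1 \<le> average_bound s" for s using \<epsilon> by (simp add: average_bound_def)
    show "average_bound s \<le> 1 + \<epsilon>" for s using \<epsilon> divide_left_mono[of 1 "real (Suc (slice N s))" \<epsilon>] by (simp add: average_bound_def)
    show "average_bound \<longlonglongrightarrow> 1"
    proof -
      have "filterlim (slice N) at_top sequentially"
        unfolding filterlim_at_top eventually_sequentially using slice_at_top[of N, OF N] by blast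
      then have "(\<lambda>s. \<epsilon> * inverse (real (Suc (slice N s)))) \<longlonglongrightarrow> \<epsilon> * 0"
        by (intro tendsto_mult tendsto_const filterlim_compose[OF LIMSEQ_inverse_real_of_nat])
      then show ?thesis unfolding average_bound_def using tendsto_add[OF tendsto_const, of _ 0 sequentially 1] by (simp add: divide_inverse)
    qed
    show "linear (\<phi> i)" for i
      using item_linear[of i] by (auto simp: \<phi>_def linear_iff add_divide_distrib)
    show "\<bar>\<phi> i x\<bar> \<le> \<kappa> i * norm x" for i x
      using item_le[of i x] Npos[of "blk i"] by (simp add: \<phi>_def \<kappa>_def abs_divide divide_right_mono)
    show "norm (\<Sum>i | sl i < s \<and> sl i \<in> pattern_set L. \<phi> i x *\<^sub>R v i) \<le> D ^ length L * average_bound s * norm x" for s L x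
      unfolding pattern by (rule averaged_pattern_bound)
    show "closure {x. finite {i. \<phi> i x \<noteq> 0} \<and> (\<forall>\<^sub>F s in sequentially. (\<Sum>i | sl i < s. \<phi> i x *\<^sub>R v i) = x)} = UNIV"
    proof -
      have good: "finite {i. \<phi> i x \<noteq> 0} \<and> (\<forall>\<^sub>F s in sequentially. (\<Sum>i | sl i < s. \<phi> i x *\<^sub>R v i) = x)"
        if x: "\<And>k. k \<ge> K \<Longrightarrow> Q k x = 0" for x K
      proof
        obtain i0 where i0: "\<And>i. i \<ge> i0 \<Longrightarrow> K \<le> blk i" using blk_top by blast
        have "\<phi> i x = 0" if "i \<ge> i0" for i
        proof -
          have "fst (snd (item i)) x = 0"
            by (rule item_zero) (use x i0[OF that] lo_ge[of "blk i"] in simp)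
          then show ?thesis by (simp add: \<phi>_def)
        qed
        then have "{i. \<phi> i x \<noteq> 0} \<subseteq> {..<i0}" by (auto simp: not_le[symmetric])
        then show "finite {i. \<phi> i x \<noteq> 0}" by (rule finite_subset) simp
        obtain s0 where s0: "\<And>s. s \<ge> s0 \<Longrightarrow> K \<le> slice N s" using slice_at_top[of N, OF N] by blast
        have "(\<Sum>i | sl i < s. \<phi> i x *\<^sub>R v i) = x" if "s \<ge> s0" for s
        proof -
          have "(\<Sum>i | sl i < s \<and> sl i \<in> UNIV. \<phi> i x *\<^sub>R v i) = (\<Sum>t\<in>{t. t < s \<and> t \<in> UNIV}. smoothed (Suc t) x - smoothed t x)"
            by (rule pattern)
          then have "(\<Sum>i | sl i < s. \<phi> i x *\<^sub>R v i) = (\<Sum>t<s. smoothed (Suc t) x - smoothed t x)"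
            by (simp add: lessThan_def)
          also have "\<dots> = smoothed s x" using sum_lessThan_telescope[of "\<lambda>t. smoothed t x" s] by (simp add: smoothed_0)
          also have "\<dots> = x" by (rule smoothed_eventually[OF x s0[OF that]])
          finally show ?thesis .
        qed
        then show "\<forall>\<^sub>F s in sequentially. (\<Sum>i | sl i < s. \<phi> i x *\<^sub>R v i) = x" by (auto simp: eventually_sequentially)
      qed
      have "x \<in> closure {x. finite {i. \<phi> i x \<noteq> 0} \<and> (\<forall>\<^sub>F s in sequentially. (\<Sum>i | sl i < s. \<phi> i x *\<^sub>R v i) = x)}" for x
        unfolding closure_sequential
      proof (intro exI[of _ "\<lambda>n. P n x"] conjI allI)
        show "(\<lambda>n. P n x) \<longlonglongrightarrow> x" using Q_sums[of x] unfolding sums_def P_def .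
        have "Q k (P n x) = 0" if "k \<ge> n" for k n using that by (simp add: P_def Q_sum)
        then show "P n x \<in> {x. finite {i. \<phi> i x \<noteq> 0} \<and> (\<forall>\<^sub>F s in sequentially. (\<Sum>i | sl i < s. \<phi> i x *\<^sub>R v i) = x)}" for n
          using good by blast
      qed
      then show ?thesis by blast
    qed
    show "\<exists>n. \<forall>z\<in>span (v ` {n..}). \<bar>f z\<bar> \<le> e * norm z" if f: "f \<in> dual_ball" and e: "e > 0" for f e
    proof -
      obtain n where n: "\<And>z. (\<And>k. k < n \<Longrightarrow> Q k z = 0) \<Longrightarrow> \<bar>f z\<bar> \<le> e * norm z" using Q_tail[OF f e] by blast
      obtain i0 where i0: "\<And>i. i \<ge> i0 \<Longrightarrow> n \<le> blk i" using blk_top by blast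
      have "Q k z = 0" if z: "z \<in> span (v ` {i0..})" and k: "k < n" for z k
      proof (rule linear_eq_0_on_span[OF Q_linear _ z])
        fix y assume "y \<in> v ` {i0..}"
        then obtain i where i: "y = v i" "i \<ge> i0" by auto
        then have "k < lo (blk i)" using k i0[of i] lo_ge[of "blk i"] by simp
        then show "Q k y = 0" using item_far i by simp
      qed
      then show ?thesis using n by blast
    qed
  qed
  then show ?thesis by blast
qed

end

section \<open>From the decomposition to the basis\<close>

locale fdd =
  fixes E :: "nat \<Rightarrow> 'a::real_normed_vector set"
  assumes FDD: "is_FDD UNIV E"
begin

definition component :: "nat \<Rightarrow> 'a \<Rightarrow> 'a" where "component n = FDD_component E n"

lemma E_subspace: "subspace (E n)" using FDD by (simp add: is_FDD_def)

lemma component_sums: "(\<lambda>n. component n x) sums x" and component_in: "component n x \<in> E n"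
proof -
  have "\<exists>!y. (\<forall>n. y n \<in> E n) \<and> y sums x" using FDD by (simp add: is_FDD_def)
  from theI'[OF this] show "(\<lambda>n. component n x) sums x" "component n x \<in> E n"
    by (simp_all add: component_def FDD_component_def)
qed

lemma component_unique:
  assumes "\<And>n. y n \<in> E n" "y sums x"
  shows "component n x = y n"
proof -
  have "\<exists>!y. (\<forall>n. y n \<in> E n) \<and> y sums x" using FDD by (simp add: is_FDD_def)
  from the1_equality[OF this, of y] show ?thesis using assms by (simp add: component_def FDD_component_def)
qed

lemma component_linear: "linear (component n)"
proof (rule linearI)
  show "component n (x + y) = component n x + component n y" for x y
    by (rule component_unique[of "\<lambda>n. component n x + component n y"])
      (auto intro: subspace_add[OF E_subspace] component_in sums_add component_sums)
  show "component n (c *\<^sub>R x) = c *\<^sub>R component n x" for c x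
    by (rule component_unique[of "\<lambda>n. c *\<^sub>R component n x"])
      (auto intro: subspace_scale[OF E_subspace] component_in sums_scaleR_right component_sums)
qed

lemma component_component: "component j (component k x) = (if j = k then component k x else 0)"
proof (rule component_unique[of "\<lambda>j. if j = k then component k x else 0"])
  show "(if j = k then component k x else 0) \<in> E j" for j
    using component_in subspace_0[OF E_subspace] by simp
  show "(\<lambda>j. if j = k then component k x else 0) sums component k x"
    using sums_single[of k "\<lambda>_. component k x"] by simp
qed

text \<open>
  The strong bimonotonicity constant speaks of intervals with at least two elements. Pairing consecutive
  components makes every interval of pairs such an interval.
\<close>

definition pair :: "nat \<Rightarrow> 'a \<Rightarrow> 'a" where "pair k x = component (2 * k) x + component (2 * k + 1) x"

lemma pair_linear: "linear (pair k)"
  unfolding pair_def by (intro linear_compose_add component_linear)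

lemma pair_pair: "pair j (pair k x) = (if j = k then pair k x else 0)"
proof -
  have "2 * j \<noteq> 2 * k + 1" "2 * j + 1 \<noteq> 2 * k" by presburger+
  then show ?thesis by (auto simp: pair_def linear_add[OF component_linear] component_component)
qed

lemma pair_finite: "\<exists>B. finite B \<and> range (pair k) \<subseteq> span B"
proof -
  obtain B where B: "\<And>n. finite (B n)" "\<And>n. E n = span (B n)"
    using FDD unfolding is_FDD_def by metis
  let ?B = "B (2 * k) \<union> B (2 * k + 1)"
  have "E (2 * k) \<subseteq> span ?B" "E (2 * k + 1) \<subseteq> span ?B"
    unfolding B(2) by (rule span_mono, blast)+
  then have "component (2 * k) x \<in> span ?B" "component (2 * k + 1) x \<in> span ?B" for x
    using component_in by blast+
  then have "range (pair k) \<subseteq> span ?B"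
    unfolding pair_def by (intro image_subsetI span_add)
  moreover have "finite ?B" using B(1) by simp
  ultimately show ?thesis by (intro exI[of _ ?B] conjI)
qed

lemma pair_sums: "(\<lambda>k. pair k x) sums x"
proof -
  have "(\<lambda>n. sum (\<lambda>n. component n x) {n * 2..<n * 2 + 2}) sums x" by (rule sums_group[OF component_sums]) simp
  moreover have "sum (\<lambda>n. component n x) {n * 2..<n * 2 + 2} = pair n x" for n
  proof -
    have "{n * 2..<n * 2 + 2} = {2 * n, 2 * n + 1}" by auto
    then show ?thesis by (simp add: pair_def)
  qed
  ultimately show ?thesis by simp
qed

lemma sum_pair: "a \<le> b \<Longrightarrow> (\<Sum>k=a..<b. pair k x) = (\<Sum>n=2*a..<2*b. component n x)"
  by (induction b rule: dec_induct) (simp_all add: pair_def add.assoc)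

lemma sum_pair_proj:
  assumes "a < b"
  shows "(\<Sum>k=a..<b. pair k x) = FDD_proj E {2 * a..2 * b - 1} x"
proof -
  have "{2 * a..2 * b - 1} = {2 * a..<2 * b}" using assms by auto
  then show ?thesis using sum_pair[of a b x] assms by (simp add: FDD_proj_def component_def)
qed

lemma FDD_proj_scale: "FDD_proj E B (c *\<^sub>R x) = c *\<^sub>R FDD_proj E B x"
  by (simp add: FDD_proj_def scaleR_sum_right linear_cmul[OF component_linear] flip: component_def)

lemma pair_bounds:
  assumes D: "D \<ge> 1" "strong_bimonotonicity_constant UNIV E \<le> ereal D"
  shows "norm (\<Sum>k=a..<b. pair k x) \<le> D * norm x" "norm (x - (\<Sum>k=a..<b. pair k x)) \<le> D * norm x"
proof -
  have "norm (\<Sum>k=a..<b. pair k x) \<le> D * norm x \<and> norm (x - (\<Sum>k=a..<b. pair k x)) \<le> D * norm x"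
  proof (cases "a < b")
    case True
    let ?m = "2 * a" and ?n = "2 * b - 1"
    have "max (opnorm_on UNIV (FDD_proj E {?m..?n})) (opnorm_on UNIV (\<lambda>z. z - FDD_proj E {?m..?n} z)) \<le> ereal D"
      using D(2) unfolding strong_bimonotonicity_constant_def
      by (rule order_trans[rotated], intro SUP_upper2[of "(?m, ?n)"]) (use True in auto)
    then have 1: "opnorm_on UNIV (FDD_proj E {?m..?n}) \<le> ereal D"
      "opnorm_on UNIV (\<lambda>z. z - FDD_proj E {?m..?n} z) \<le> ereal D" by auto
    show ?thesis
      unfolding sum_pair_proj[OF True]
      by (intro conjI opnorm_on_leD[OF subspace_UNIV _ 1(1)] opnorm_on_leD[OF subspace_UNIV _ 1(2)])
        (auto simp: FDD_proj_scale scaleR_diff_right)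
  next
    case False
    then show ?thesis using D(1) mult_right_mono[of 1 D "norm x"] by simp
  qed
  then show "norm (\<Sum>k=a..<b. pair k x) \<le> D * norm x" "norm (x - (\<Sum>k=a..<b. pair k x)) \<le> D * norm x" by auto
qed

lemma pair_tail:
  assumes shr: "FDD_shrinking UNIV E" and f: "f \<in> dual_ball" and e: "e > 0"
  shows "\<exists>n. \<forall>z. (\<forall>k<n. pair k z = 0) \<longrightarrow> \<bar>f z\<bar> \<le> e * norm z"
proof -
  have lin: "linear f" using f by (simp add: dual_ball_def)
  have "bounded_functional_on UNIV f"
    using f by (auto simp: bounded_functional_on_def dual_ball_def linear_iff intro: exI[of _ 1])
  then have "(\<lambda>n. opnorm_on (closure (span (\<Union>k\<in>{n..}. E k))) f) \<longlonglongrightarrow> 0"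
    using shr unfolding FDD_shrinking_def by blast
  then have "\<forall>\<^sub>F n in sequentially. opnorm_on (closure (span (\<Union>k\<in>{n..}. E k))) f < ereal e"
    by (rule order_tendstoD(2)) (use e in simp)
  then obtain n where n: "opnorm_on (closure (span (\<Union>k\<in>{n..}. E k))) f < ereal e"
    by (auto simp: eventually_sequentially)
  have "\<bar>f z\<bar> \<le> e * norm z" if z: "\<And>k. k < n \<Longrightarrow> pair k z = 0" for z
  proof -
    have zero: "component j z = 0" if "j < n" for j
    proof -
      define k where "k = j div 2"
      have "pair k z = 0" using z[of k] that by (simp add: k_def)
      then have "component j (component (2 * k) z + component (2 * k + 1) z) = 0"
        using linear_0[OF component_linear] by (simp add: pair_def)
      moreover have "j = 2 * k \<or> j = 2 * k + 1" unfolding k_def by presburger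
      ultimately show ?thesis by (auto simp: linear_add[OF component_linear] component_component)
    qed
    have "component j z \<in> span (\<Union>k\<in>{n..}. E k)" for j
    proof (cases "j < n")
      case True
      then show ?thesis by (simp add: zero span_zero)
    next
      case False
      then have "component j z \<in> (\<Union>k\<in>{n..}. E k)" using component_in[of j z] by auto
      then show ?thesis by (rule span_base)
    qed
    then have "\<forall>m. (\<Sum>j<m. component j z) \<in> span (\<Union>k\<in>{n..}. E k)" by (auto intro: span_sum)
    moreover have "(\<lambda>m. \<Sum>j<m. component j z) \<longlonglongrightarrow> z" using component_sums[of z] by (simp add: sums_def)
    ultimately have zc: "z \<in> closure (span (\<Union>k\<in>{n..}. E k))" unfolding closure_sequential
      by (intro exI[of _ "\<lambda>m. \<Sum>j<m. component j z"] conjI)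
    have "norm (f z) \<le> e * norm z"
      by (rule opnorm_on_leD[OF subspace_closure[OF subspace_span] _ less_imp_le[OF n] zc])
        (simp add: linear_cmul[OF lin])
    then show ?thesis by simp
  qed
  then show ?thesis by blast
qed

end

theorem theorem1:
  fixes E :: "nat \<Rightarrow> 'a::banach set" and D \<epsilon> :: real
  assumes "is_FDD UNIV E"
    and "FDD_shrinking UNIV E"
    and "D \<ge> 1"
    and "strong_bimonotonicity_constant UNIV E = ereal D"
    and "\<epsilon> > 0"
  shows "\<exists>(W :: linfty set) (w :: nat \<Rightarrow> linfty) (T :: 'a \<Rightarrow> linfty).
           subspace W \<and> closed W \<and>
           is_Schauder_basis W w \<and>
           FDD_shrinking W (basis_FDD w) \<and>
           FDD_monotone (1 + \<epsilon>) W (basis_FDD w) \<and>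
           strong_bimonotonicity_constant W (basis_FDD w) \<le> ereal (D * (1 + \<epsilon>)) \<and>
           linear T \<and> (\<forall>x. norm (T x) = norm x) \<and> range T \<subseteq> W"
proof -
  interpret fdd E by unfold_locales (rule assms(1))
  have "decomposition pair D"
    by (rule decomposition.intro)
      (use assms pair_linear pair_pair pair_finite pair_bounds pair_sums pair_tail in auto)
  then interpret decomposition pair D .
  \<comment> \<open>One half of $\varepsilon$ pays for the averages, the other for the slices that are cut in the middle.\<close>
  have "\<epsilon> / 2 > 0" using assms(5) by simp
  from slow_expansion_exists[OF this this] obtain v :: "nat \<Rightarrow> 'a" and \<phi> \<kappa> sl \<gamma>
    where "slow_expansion v \<phi> \<kappa> sl D (\<epsilon> / 2) (1 + \<epsilon> / 2) \<gamma>" by blast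
  then interpret slow_expansion v \<phi> \<kappa> sl D "\<epsilon> / 2" "1 + \<epsilon> / 2" \<gamma> .
  have mono: "1 + \<epsilon> / 2 + \<epsilon> / 2 = 1 + \<epsilon>" by simp
  have "D + 2 * (\<epsilon> / 2) \<le> D * (1 + \<epsilon>)"
    using assms(3,5) mult_right_mono[of 1 D \<epsilon>] by (simp add: algebra_simps)
  then have "ereal (D + 2 * (\<epsilon> / 2)) \<le> ereal (D * (1 + \<epsilon>))" by simp
  then have "strong_bimonotonicity_constant W (basis_FDD w) \<le> ereal (D * (1 + \<epsilon>))"
    using embeds_in_space_with_basis order_trans by blast
  then show ?thesis using embeds_in_space_with_basis[unfolded mono] by blast
qed

end
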